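(* Work in the setting and under the standing assumptions stated in the context. Let $g\in L^+_\infty(D\times V)$ with $\langle g,\tilde\varphi\rangle>0$ and $(r,\upsilon)\in D\times V$. For $\varepsilon>0$ there is a choice of $k,t$ (depending on $\varepsilon$) such that $$\mathbb{E}_{\delta_{(r,\upsilon)}}\Big[\big(\Psi^{\mathrm{br}}_k[g](t,r,\upsilon)^{1/t}-e^{\lambda_*}\big)^2\Big]\le\varepsilon^2\qquad(\star)$$ with the following total simulation cost: (i) If $\lambda_*=0$, then $(\star)$ holds in the limit as $\varepsilon\to0$ with $\mathbb{E}_{\delta_{(r,\upsilon)}}[\mathrm{Cost}(k,t)]\le C\varepsilon^{-4}$ for some constant $C$, and the optimal choice of $k,t$ is given by $t=\sqrt{2\kappa_{[0]}}\,\varepsilon^{-1}$ and $k=\kappa_{[1]}\kappa_{[0]}^{-1}t^3$. (ii) If $\lambda_*>0$, then $(\star)$ holds in the limit as $\varepsilon\to0$ with $\mathbb{E}_{\delta_{(r,\upsilon)}}[\mathrm{Cost}(k,t)]\le C\exp\big(\lambda_*\sqrt{\kappa_{[0]}}\,\varepsilon^{-1}\big)$ for some constant $C$, and the optimal choice of $k,t$ corresponds to $t\approx\sqrt{\kappa_{[0]}}\,\varepsilon^{-1}$ and $k\approx\lambda_*\kappa_{[0]}^{1/2}\kappa_{[2]}\varepsilon^{-3}/2$. (iii) If $\lambda_*<0$, then $(\star)$ holds in the limit as $\varepsilon\to0$ with $\mathbb{E}_{\delta_{(r,\upsilon)}}[\mathrm{Cost}(k,t)]\le C\exp\big(|\lambda_*|\sqrt{\kappa_{[0]}}\,\varepsilon^{-1}\big)$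 for some constant $C$, and the optimal choice of $k,t$ corresponds to $t\approx\sqrt{\kappa_{[0]}}\,\varepsilon^{-1}$ and $k\approx|\lambda_*|\kappa_{[0]}^{1/2}\kappa_{[3]}\varepsilon^{-3}\exp(|\lambda_*|t)/2$.
   Context: Domain and cross-sections. $D\subset\mathbb{R}^3$ is non-empty, open, smooth, bounded and convex; $V=\{\upsilon\in\mathbb{R}^3:\upsilon_{\min}\le|\upsilon|\le\upsilon_{\max}\}$ with $0<\upsilon_{\min}<\upsilon_{\max}<\infty$. $L^+_\infty(D\times V)$ is the set of non-negative bounded measurable functions on $D\times V$; $\langle f,g\rangle=\int_{D\times V}f g\,dr\,d\upsilon$. Measurable non-negative functions $\sigma_{\mathrm s}(r,\upsilon),\sigma_{\mathrm f}(r,\upsilon),\pi_{\mathrm s}(r,\upsilon,\upsilon'),\pi_{\mathrm f}(r,\upsilon,\upsilon')$ are given, with $\int_V\pi_{\mathrm s}(r,\upsilon,\upsilon')d\upsilon'=1$. Standing assumptions: all four functions are bounded; $\inf_{r\in D,\upsilon,\upsilon'\in V}(\sigma_{\mathrm s}(r,\upsilon)\pi_{\mathrm s}(r,\upsilon,\upsilon')+\sigma_{\mathrm f}(r,\upsilon)\pi_{\mathrm f}(r,\upsilon,\upsilon'))>0$; there is an open ball $B$ compactly embedded in $D$ with $\inf_{r\in B,\upsilon,\upsilon'\in V}\sigma_{\mathrm f}(r,\upsilon)\pi_{\mathrm f}(r,\upsilon,\upsilon')>0$; the number of fission offspring is bounded by a constant $n_{\max}>1$. Neutron branching process (NBP).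 Particles have configurations in $D\times V$ and evolve independently. A particle at $(r,\upsilon)$ moves along $r+\upsilon t$ until: it leaves $D$ (it is killed); or it scatters, at rate $\sigma_{\mathrm s}$ along its path, taking a new velocity $\upsilon'$ with density $\pi_{\mathrm s}(r,\upsilon,\cdot)$; or fission occurs, at rate $\sigma_{\mathrm f}$ along its path, when the particle dies and is replaced by a random number $N\ge0$ of particles at the same position with velocities $\upsilon_1,\dots,\upsilon_N$, whose joint law $\mathcal P_{(r,\upsilon)}$ (expectation $\mathcal E_{(r,\upsilon)}$) satisfies $\mathcal E_{(r,\upsilon)}[\sum_{i=1}^N g(\upsilon_i)]=\int_Vg(\upsilon')\pi_{\mathrm f}(r,\upsilon,\upsilon')d\upsilon'$ for bounded measurable $g\ge0$. $X_t$ is the sum of the Dirac masses at the configurations of the particles alive at time $t$; $\langle g,X_t\rangle$ is the sum of $g$ over these; $\mathbb{P}_{\delta_{(r,\upsilon)}}$ is the law when starting from one particle at $(r,\upsilon)$; $\psi_t[g](r,\upsilon)=\mathbb{E}_{\delta_{(r,\upsilon)}}[\langle g,X_t\rangle]$. Leading eigen-triple (known): there exist $\lambda_*\in\mathbb{R}$ and $\varphi,\tilde\varphi\in L^+_\infty(D\times V)$, with $\varphi$ positive, such that $\psi_t[\varphi]=e^{\lambda_*t}\varphi$, $\langle\tilde\varphi,\psi_t[g]\rangle=e^{\lambda_*t}\langle\tilde\varphi,g\rangle$, and for some $\epsilon_0>0$, $\sup_{\|g\|_\infty\le1}\|e^{-\lambda_*t}\varphi^{-1}\psi_t[g]-\langle\tilde\varphi,g\rangle\|_\infty=O(e^{-\epsilon_0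 t})$ as $t\to\infty$. Estimator. $\Psi^{\mathrm{br}}_k[g](t,r,\upsilon)=\frac1k\sum_{i=1}^k\langle g,X^i_t\rangle$, with $X^1,\dots,X^k$ independent copies of $X$ under $\mathbb{P}_{\delta_{(r,\upsilon)}}$. Constants. $\kappa_{[0]},\dots,\kappa_{[3]}>0$ (depending on $g,r,\upsilon$) are constants such that, for all $t,k$ sufficiently large, the left side of $(\star)$ is bounded by: $\kappa_{[1]}t/k+\kappa_{[0]}/t^2$ if $\lambda_*=0$; $\kappa_{[2]}/k+\kappa_{[0]}/t^2$ if $\lambda_*>0$; $\kappa_{[3]}e^{-\lambda_*t}/k+\kappa_{[0]}/t^2$ if $\lambda_*<0$. With $C_{[0]}=\langle\tilde\varphi,g\rangle\varphi(r,\upsilon)\ne1$, one takes $\kappa_{[0]}=2[\log(C_{[0]})e^{\lambda_*}]^2+\eta$ and $\kappa_{[i]}=2C_{[i]}C_{[0]}^{-2}+\eta$, with $\eta>0$ arbitrary, where, with $\eta_{\mathrm f}[f](r,\upsilon)=\sigma_{\mathrm f}(r,\upsilon)\mathcal E_{(r,\upsilon)}[\sum_{i\ne j}f(r,\upsilon_i)f(r,\upsilon_j)]$: $C_{[1]}=\langle\eta_{\mathrm f}[\varphi],\tilde\varphi\rangle\langle g,\tilde\varphi\rangle^2\varphi(r,\upsilon)$, $C_{[2]}=\langle g,\tilde\varphi\rangle^2(\int_0^\infty e^{-2\lambda_*s}\psi_s[\eta_{\mathrm f}[\varphi]](r,\upsilon)ds-\varphi(r,\upsilon)^2)$, $C_{[3]}=\varphi(r,\upsilon)\{\langle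 g^2,\tilde\varphi\rangle+\int_0^\infty e^{-\lambda_*s}\langle\tilde\varphi,\eta_{\mathrm f}[\psi_s[g]]\rangle ds\}$. Thus $\kappa_{[0]}$ is specified only up to an arbitrarily small positive additive constant, and the exponential cost bounds are to be read with this convention (polynomial factors in $\varepsilon^{-1}$ are absorbed by increasing $\kappa_{[0]}$ by an arbitrarily small fixed amount). Cost. Let $\mathcal U$ index all particles that ever exist; particle $u$ has path $(r^{(u)}_t,\upsilon^{(u)}_t)_{b_u\le t<d_u}$, birth time $b_u$, and scattering times $t^{(u)}_1<t^{(u)}_2<\cdots$. For $f,g\in L^+_\infty(D\times V)$ let $C_t[f,g]=\sum_{u}g(r^{(u)}_{b_u},\upsilon^{(u)}_{b_u})\mathbf 1_{(b_u\le t)}+\sum_u\sum_{i\ge1}f(r^{(u)}_{t^{(u)}_i},\upsilon^{(u)}_{t^{(u)}_i})\mathbf 1_{(b_u\le t,\,t^{(u)}_i\le t)}$, and $\mathrm{Cost}(k,t)=k\times\sup_{\|f\|_\infty,\|g\|_\infty\le1}C_t[f,g]$. Optimality. "In the limit as $\varepsilon\to0$" means for all sufficiently small $\varepsilon$. "Optimal choice" means the minimiser over real $k,t>0$ of the leading-order expected cost (proportional to $tk$ if $\lambda_*=0$, to $e^{\lambda_*t}k$ if $\lambda_*>0$, to $k$ if $\lambda_*<0$) subject to the corresponding upper bound above being at most $\varepsilon^2$; "$\approx$" means equality to leading order as $\varepsilon\to0$ (in (iii), $k$ is expressed in terms of the optimal $t$). *)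

theory Defs
  imports "HOL-Probability.Probability" "HOL-Library.Landau_Symbols"
begin

type_synonym vec3 = "real^3"
type_synonym config = "vec3 \<times> vec3"  \<comment> \<open>(position, velocity)\<close>

primrec Ck_on :: "nat \<Rightarrow> ('a::euclidean_space \<Rightarrow> real) \<Rightarrow> 'a set \<Rightarrow> bool" where
  "Ck_on 0 f U \<longleftrightarrow> continuous_on U f"
| "Ck_on (Suc n) f U \<longleftrightarrow> f differentiable_on U \<and>
     (\<forall>b\<in>Basis. Ck_on n (\<lambda>x. frechet_derivative f (at x) b) U)"

text \<open>Smooth boundary: near each boundary point the set is the sublevel set of a
  \<open>C\<^sup>\<infinity>\<close> function without critical points.\<close>
definition smooth_domain :: "'a::euclidean_space set \<Rightarrow> bool" where
  "smooth_domain D \<longleftrightarrow> (\<forall>z\<in>frontier D. \<exists>U (\<rho> :: 'a \<Rightarrow> real).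
     open U \<and> z \<in> U \<and> (\<forall>n. Ck_on n \<rho> U) \<and>
     (\<forall>y\<in>U. frechet_derivative \<rho> (at y) \<noteq> (\<lambda>_. 0)) \<and>
     D \<inter> U = {y\<in>U. \<rho> y < 0})"

text \<open>A velocity configuration produced at an event is a pair \<open>(n, w)\<close>: the \<open>n\<close> velocities
  \<open>w 0, \<dots>, w (n - 1)\<close>; the later entries of \<open>w\<close> carry no meaning.\<close>
type_synonym velocities = "nat \<times> (nat \<Rightarrow> vec3)"

definition velocities_space :: "velocities measure" where
  "velocities_space = count_space UNIV \<Otimes>\<^sub>M PiM UNIV (\<lambda>_. borel)"

record neutron_data =
  Dom :: "vec3 set"
  vmin :: real
  vmax :: real
  sigs :: "config \<Rightarrow> real"
  sigf :: "config \<Rightarrow> real"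
  pis :: "config \<Rightarrow> vec3 \<Rightarrow> real"
  pif :: "config \<Rightarrow> vec3 \<Rightarrow> real"
  offspring :: "config \<Rightarrow> velocities measure"
  nmax :: nat

definition Vel :: "neutron_data \<Rightarrow> vec3 set" where
  "Vel S = {v. vmin S \<le> norm v \<and> norm v \<le> vmax S}"

abbreviation phase :: "neutron_data \<Rightarrow> config set" where
  "phase S \<equiv> Dom S \<times> Vel S"

text \<open>Functions are total; only their values on \<open>D \<times> V\<close> matter, so \<open>\<parallel>f\<parallel>\<^sub>\<infinity> \<le> c\<close> reads
  \<open>\<forall>x\<in>D \<times> V. f x \<le> c\<close> for non-negative \<open>f\<close>.\<close>
definition Linf_plus :: "neutron_data \<Rightarrow> (config \<Rightarrow> real) set" where
  "Linf_plus S = {f. f \<in> borel_measurable (restrict_space borel (phase S)) \<and>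
     (\<forall>x\<in>phase S. 0 \<le> f x) \<and> (\<exists>K. \<forall>x\<in>phase S. f x \<le> K)}"

definition unit_Linf_plus :: "neutron_data \<Rightarrow> (config \<Rightarrow> real) set" where
  "unit_Linf_plus S = {f \<in> Linf_plus S. \<forall>x\<in>phase S. f x \<le> 1}"

definition inner_DV :: "neutron_data \<Rightarrow> (config \<Rightarrow> real) \<Rightarrow> (config \<Rightarrow> real) \<Rightarrow> real" where
  "inner_DV S f g = (LINT x:phase S|lborel. f x * g x)"

definition cross_sections :: "neutron_data \<Rightarrow> bool" where
  "cross_sections S \<longleftrightarrow>
     sigs S \<in> Linf_plus S \<and> sigf S \<in> Linf_plus S \<and>
     (\<forall>p\<in>{pis S, pif S}.
        case_prod p \<in> borel_measurable (restrict_space borel (phase S \<times> Vel S)) \<and>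
        (\<forall>x\<in>phase S. \<forall>v\<in>Vel S. 0 \<le> p x v) \<and>
        (\<exists>K. \<forall>x\<in>phase S. \<forall>v\<in>Vel S. p x v \<le> K)) \<and>
     (\<forall>x\<in>phase S. (\<integral>\<^sup>+v\<in>Vel S. ennreal (pis S x v) \<partial>lborel) = 1)"

definition offspring_laws :: "neutron_data \<Rightarrow> bool" where
  "offspring_laws S \<longleftrightarrow>
     offspring S \<in> restrict_space borel (phase S) \<rightarrow>\<^sub>M prob_algebra velocities_space \<and>
     1 < nmax S \<and>
     (\<forall>x\<in>phase S.
        (AE y in offspring S x. fst y \<le> nmax S \<and> (\<forall>i<fst y. snd y i \<in> Vel S)) \<and>
        (\<forall>g\<in>borel_measurable borel. (\<forall>v. 0 \<le> g v) \<and> bounded (range g) \<longrightarrow>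
           (\<integral>\<^sup>+y. (\<Sum>i<fst y. ennreal (g (snd y i))) \<partial>offspring S x)
           = (\<integral>\<^sup>+v\<in>Vel S. ennreal (g v * pif S x v) \<partial>lborel)))"

definition neutron_setting :: "neutron_data \<Rightarrow> bool" where
  "neutron_setting S \<longleftrightarrow>
     Dom S \<noteq> {} \<and> open (Dom S) \<and> smooth_domain (Dom S) \<and> bounded (Dom S) \<and> convex (Dom S) \<and>
     0 < vmin S \<and> vmin S < vmax S \<and>
     cross_sections S \<and> offspring_laws S \<and>
     (\<exists>c>0. \<forall>r\<in>Dom S. \<forall>v\<in>Vel S. \<forall>v'\<in>Vel S.
        c \<le> sigs S (r, v) * pis S (r, v) v' + sigf S (r, v) * pif S (r, v) v') \<and>
     (\<exists>z \<rho>. 0 < \<rho> \<and> closure (ball z \<rho>) \<subseteq> Dom S \<and>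
        (\<exists>c>0. \<forall>r\<in>ball z \<rho>. \<forall>v\<in>Vel S. \<forall>v'\<in>Vel S. c \<le> sigf S (r, v) * pif S (r, v) v'))"


text \<open>The life of a particle is cut at its scattering times into flights of constant velocity.
  The outcome of a flight consists of its duration, the event which ends it and the new
  velocities: none at an exit from \<open>D\<close>, one at a scatter, those of the offspring at a fission.\<close>
datatype event = Exit | Scatter | Fission

type_synonym outcome = "real \<times> event \<times> velocities"

definition outcome_space :: "outcome measure" where
  "outcome_space = borel \<Otimes>\<^sub>M count_space UNIV \<Otimes>\<^sub>M velocities_space"

text \<open>Flights are addressed by their ancestry, most recent step first: \<open>Scat # p\<close> is the flight
  of the same particle following \<open>p\<close>, and \<open>Offs j # p\<close> is the first flight of the \<open>j\<close>-th offspring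
  of the particle whose last flight is \<open>p\<close>.\<close>
datatype step = Scat | Offs nat

type_synonym address = "step list"
type_synonym history = "address \<Rightarrow> outcome"

definition history_space :: "history measure" where
  "history_space = PiM UNIV (\<lambda>_. outcome_space)"

text \<open>Starting time and starting configuration of the flight at an address, for one initial
  particle at \<open>x\<close>; \<open>None\<close> if there is no such flight.\<close>
primrec start :: "config \<Rightarrow> history \<Rightarrow> address \<Rightarrow> (real \<times> config) option" where
  "start x \<omega> [] = Some (0, x)"
| "start x \<omega> (m # p) = (case start x \<omega> p of None \<Rightarrow> None
     | Some (b, r, v) \<Rightarrow> (case \<omega> p of (s, e, n, w) \<Rightarrow>
         (case m of
            Scat \<Rightarrow> if e = Scatter then Some (b + s, r + s *\<^sub>R v, w 0) else None
          | Offs j \<Rightarrow> if e = Fission \<and> j < n then Some (b + s, r + s *\<^sub>R v, w j) else None)))"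

definition exit_time :: "neutron_data \<Rightarrow> config \<Rightarrow> real" where
  "exit_time S x = Inf {t. 0 < t \<and> fst x + t *\<^sub>R snd x \<notin> Dom S}"

definition flow :: "config \<Rightarrow> real \<Rightarrow> config" where
  "flow x s = (fst x + s *\<^sub>R snd x, snd x)"

text \<open>Probability that neither scattering nor fission has occurred up to time \<open>s\<close> of the flight.\<close>
definition no_event_prob :: "neutron_data \<Rightarrow> config \<Rightarrow> real \<Rightarrow> real" where
  "no_event_prob S x s =
     exp (- (LINT l:{0..<s}|lborel. sigs S (flow x l) + sigf S (flow x l)))"

text \<open>The expectation of \<open>F\<close> under the law of the outcome of a flight started at \<open>x\<close>: the events
  scatter and fission have rates \<open>\<sigma>\<^sub>s\<close> and \<open>\<sigma>\<^sub>f\<close> along the path until it leaves \<open>D\<close>.\<close>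
definition flight_expectation :: "neutron_data \<Rightarrow> config \<Rightarrow> (outcome \<Rightarrow> ennreal) \<Rightarrow> ennreal" where
  "flight_expectation S x F =
     (\<integral>\<^sup>+s\<in>{0<..<exit_time S x}. ennreal (no_event_prob S x s * sigs S (flow x s)) *
        (\<integral>\<^sup>+v\<in>Vel S. ennreal (pis S (flow x s) v) * F (s, Scatter, 1, \<lambda>_. v) \<partial>lborel) \<partial>lborel)
   + (\<integral>\<^sup>+s\<in>{0<..<exit_time S x}. ennreal (no_event_prob S x s * sigf S (flow x s)) *
        (\<integral>\<^sup>+y. F (s, Fission, y) \<partial>offspring S (flow x s)) \<partial>lborel)
   + ennreal (no_event_prob S x (exit_time S x)) * F (exit_time S x, Exit, 0, \<lambda>_. 0)"

definition nondescendants :: "address \<Rightarrow> address set" where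
  "nondescendants p = {q. \<nexists>s. q = s @ p}"

text \<open>\<open>P\<close> is the law of the process started from one particle at \<open>x\<close>: given all flights which do
  not descend from \<open>p\<close> (these include its ancestors, which determine \<open>start x \<omega> p\<close>), the outcome of
  the flight \<open>p\<close> has the law of a flight started at the starting configuration of \<open>p\<close>. This
  determines the joint law of all flights that exist; the coordinates of \<open>\<omega>\<close> at the other addresses
  are never used.\<close>
definition nbp_law :: "neutron_data \<Rightarrow> config \<Rightarrow> history measure \<Rightarrow> bool" where
  "nbp_law S x P \<longleftrightarrow> prob_space P \<and> sets P = sets history_space \<and>
     (\<forall>p. \<forall>A\<in>sets (PiM (nondescendants p) (\<lambda>_. outcome_space)).
       \<forall>F\<in>borel_measurable outcome_space.
        (\<integral>\<^sup>+\<omega>. (case start x \<omega> p of None \<Rightarrow> 0 | Some (b, y) \<Rightarrow> F (\<omega> p)) *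
            indicator A (restrict \<omega> (nondescendants p)) \<partial>P)
      = (\<integral>\<^sup>+\<omega>. (case start x \<omega> p of None \<Rightarrow> 0 | Some (b, y) \<Rightarrow> flight_expectation S y F) *
            indicator A (restrict \<omega> (nondescendants p)) \<partial>P))"

text \<open>A particle alive at time \<open>t\<close> is in exactly one flight, so the particles alive at time \<open>t\<close>
  are in bijection with the flights in progress.\<close>
definition in_flight :: "config \<Rightarrow> history \<Rightarrow> real \<Rightarrow> address set" where
  "in_flight x \<omega> t = {p. \<exists>b y. start x \<omega> p = Some (b, y) \<and> b \<le> t \<and> t < b + fst (\<omega> p)}"

definition conf_at :: "config \<Rightarrow> history \<Rightarrow> real \<Rightarrow> address \<Rightarrow> config" where
  "conf_at x \<omega> t p = (case the (start x \<omega> p) of (b, y) \<Rightarrow> flow y (t - b))"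

text \<open>The sum of the Dirac masses at the configurations of the particles alive at time \<open>t\<close>.\<close>
definition X :: "config \<Rightarrow> history \<Rightarrow> real \<Rightarrow> config measure" where
  "X x \<omega> t = distr (count_space (in_flight x \<omega> t)) (count_space UNIV) (conf_at x \<omega> t)"

definition pair_X :: "(config \<Rightarrow> real) \<Rightarrow> config \<Rightarrow> history \<Rightarrow> real \<Rightarrow> ennreal" where
  "pair_X g x \<omega> t = (\<integral>\<^sup>+y. ennreal (g y) \<partial>X x \<omega> t)"

text \<open>From here on, \<open>Pr x\<close> is the law of the process started from one particle at \<open>x\<close>.\<close>
definition psi :: "(config \<Rightarrow> history measure) \<Rightarrow> real \<Rightarrow> (config \<Rightarrow> real) \<Rightarrow> config \<Rightarrow> real" where
  "psi Pr t g x = enn2real (\<integral>\<^sup>+\<omega>. pair_X g x \<omega> t \<partial>Pr x)"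

definition eigen_triple ::
  "neutron_data \<Rightarrow> (config \<Rightarrow> history measure) \<Rightarrow> real \<Rightarrow> (config \<Rightarrow> real) \<Rightarrow> (config \<Rightarrow> real) \<Rightarrow> bool"
where
  "eigen_triple S Pr lam phi phit \<longleftrightarrow>
     phi \<in> Linf_plus S \<and> phit \<in> Linf_plus S \<and> (\<forall>x\<in>phase S. 0 < phi x) \<and>
     (\<forall>t\<ge>0. \<forall>x\<in>phase S. psi Pr t phi x = exp (lam * t) * phi x) \<and>
     (\<forall>t\<ge>0. \<forall>g\<in>Linf_plus S.
        inner_DV S phit (psi Pr t g) = exp (lam * t) * inner_DV S phit g) \<and>
     (\<exists>eps0>0. \<exists>K T. \<forall>t\<ge>T. \<forall>g\<in>unit_Linf_plus S. \<forall>x\<in>phase S.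
        \<bar>exp (- lam * t) * inverse (phi x) * psi Pr t g x - inner_DV S phit g\<bar>
          \<le> K * exp (- eps0 * t))"


text \<open>\<open>\<omega> i\<close> is the history of the \<open>i\<close>-th of \<open>k\<close> independent copies.\<close>
definition Psi_br :: "nat \<Rightarrow> (config \<Rightarrow> real) \<Rightarrow> real \<Rightarrow> config \<Rightarrow> (nat \<Rightarrow> history) \<Rightarrow> real" where
  "Psi_br k g t x \<omega> = (1 / real k) * (\<Sum>i<k. enn2real (pair_X g x (\<omega> i) t))"

definition sq_error :: "(config \<Rightarrow> history measure) \<Rightarrow> real \<Rightarrow> (config \<Rightarrow> real) \<Rightarrow> config
    \<Rightarrow> nat \<Rightarrow> real \<Rightarrow> ennreal" where
  "sq_error Pr lam g x k t =
     (\<integral>\<^sup>+\<omega>. ennreal ((Psi_br k g t x \<omega> powr (1 / t) - exp lam)\<^sup>2) \<partial>PiM {..<k} (\<lambda>_. Pr x))"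

text \<open>A particle is identified with the address of its first flight; the flight of the particle
  \<open>u\<close> after its \<open>i\<close>-th scattering is then \<open>replicate i Scat @ u\<close>.\<close>
definition particles :: "address set" where
  "particles = {u. u = [] \<or> (\<exists>j p. u = Offs j # p)}"

definition C_cost :: "(config \<Rightarrow> real) \<Rightarrow> (config \<Rightarrow> real) \<Rightarrow> config \<Rightarrow> history \<Rightarrow> real \<Rightarrow> ennreal" where
  "C_cost f g x \<omega> t =
     (\<integral>\<^sup>+u. (case start x \<omega> u of None \<Rightarrow> 0 | Some (b, y) \<Rightarrow> ennreal (g y) * indicator {..t} b)
        \<partial>count_space particles)
   + (\<integral>\<^sup>+u. (\<integral>\<^sup>+i.
        (case start x \<omega> u of None \<Rightarrow> 0 | Some (b, y) \<Rightarrow>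
          (case start x \<omega> (replicate i Scat @ u) of None \<Rightarrow> 0 | Some (s, z) \<Rightarrow>
             ennreal (f z) * indicator {..t} b * indicator {..t} s))
        \<partial>count_space {1..}) \<partial>count_space particles)"

definition Cost :: "neutron_data \<Rightarrow> config \<Rightarrow> history \<Rightarrow> nat \<Rightarrow> real \<Rightarrow> ennreal" where
  "Cost S x \<omega> k t =
     of_nat k * (SUP (f, g) \<in> unit_Linf_plus S \<times> unit_Linf_plus S. C_cost f g x \<omega> t)"

definition mean_Cost :: "neutron_data \<Rightarrow> (config \<Rightarrow> history measure) \<Rightarrow> config
    \<Rightarrow> nat \<Rightarrow> real \<Rightarrow> ennreal" where
  "mean_Cost S Pr x k t = (\<integral>\<^sup>+\<omega>. Cost S x \<omega> k t \<partial>Pr x)"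


definition error_bound :: "real \<Rightarrow> (nat \<Rightarrow> real) \<Rightarrow> real \<Rightarrow> real \<Rightarrow> real" where
  "error_bound lam \<kappa> t k =
     (if lam = 0 then \<kappa> 1 * t / k
      else if lam > 0 then \<kappa> 2 / k
      else \<kappa> 3 * exp (- lam * t) / k) + \<kappa> 0 / t\<^sup>2"

text \<open>The constants \<open>\<kappa> 0, \<dots>, \<kappa> 3\<close> enter through the bound they satisfy only. Explicit choices
  in terms of the eigen-triple involve an arbitrarily small additive constant, which is why
  exponential cost bounds are stated for every \<open>\<kappa>' > \<kappa> 0\<close>.\<close>
definition error_constants :: "(config \<Rightarrow> history measure) \<Rightarrow> real \<Rightarrow> (config \<Rightarrow> real) \<Rightarrow> config
    \<Rightarrow> (nat \<Rightarrow> real) \<Rightarrow> bool" where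
  "error_constants Pr lam g x \<kappa> \<longleftrightarrow> (\<forall>i\<le>3. 0 < \<kappa> i) \<and>
     (\<exists>t0 k0. \<forall>t\<ge>t0. \<forall>k\<ge>k0. sq_error Pr lam g x k t \<le> ennreal (error_bound lam \<kappa> t (real k)))"

text \<open>The expected cost to leading order, up to a constant factor.\<close>
definition cost_order :: "real \<Rightarrow> real \<Rightarrow> real \<Rightarrow> real" where
  "cost_order lam t k = (if lam = 0 then t * k else if lam > 0 then exp (lam * t) * k else k)"

definition optimal_choice :: "real \<Rightarrow> (nat \<Rightarrow> real) \<Rightarrow> real \<Rightarrow> real \<Rightarrow> real \<Rightarrow> bool" where
  "optimal_choice lam \<kappa> \<epsilon> t k \<longleftrightarrow>
     is_arg_min (\<lambda>(t, k). cost_order lam t k)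
       (\<lambda>(t, k). 0 < t \<and> 0 < k \<and> error_bound lam \<kappa> t k \<le> \<epsilon>\<^sup>2) (t, k)"

end

theory Submission
  imports Defs
begin

text \<open>The cost of one simulation is at most twice the number \<open>N\<^sub>t\<close> of flights begun by time \<open>t\<close>. As
  events happen at a bounded rate and have at most \<open>nmax\<close> offspring, \<open>E N\<^sub>t\<close> is at most
  \<open>1 + c \<integral>\<^sub>0\<^sup>t \<psi>\<^sub>u[1] du\<close>. Truncation by generation turns this inequality into an a priori exponential
  bound, hence finiteness; the spectral asymptotics \<open>\<psi>\<^sub>u[1] = O(exp (\<lambda>\<^sub>* u))\<close> then give \<open>E N\<^sub>t\<close> of order
  \<open>1 + t\<close>, \<open>exp (\<lambda>\<^sub>* t)\<close> or \<open>1\<close> according to the sign of \<open>\<lambda>\<^sub>*\<close>.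

  For the optimisation, eliminating \<open>k\<close> from the active constraint leaves the minimisation of
  \<open>t\<^sup>2 / (\<epsilon>\<^sup>2 - \<kappa>\<^sub>0 / t\<^sup>2)\<close> or of \<open>exp (\<bar>\<lambda>\<^sub>*\<bar> t) / (\<epsilon>\<^sup>2 - \<kappa>\<^sub>0 / t\<^sup>2)\<close>. In the second case the critical equation
  \<open>\<bar>\<lambda>\<^sub>*\<bar> t (\<epsilon>\<^sup>2 t\<^sup>2 - \<kappa>\<^sub>0) = 2 \<kappa>\<^sub>0\<close> has a root within \<open>1 / \<bar>\<lambda>\<^sub>*\<bar>\<close> of \<open>\<surd>\<kappa>\<^sub>0 / \<epsilon>\<close>.\<close>


section \<open>Survival along a path\<close>

text \<open>The obstacle throughout is measurability. The law of the process is given through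
  products of a function of one outcome with an indicator of flights that do not descend from it,
  and no measurability of \<open>flight_expectation S y F\<close> in \<open>y\<close> is available.
  Quantities that couple the start of a flight with its outcome are therefore estimated on countably
  many slices of starting values, with an error that vanishes with the mesh.

  The birth bound is a compensator argument: an event has density at most \<open>rate_bound\<close>
  times the survival probability, and the latter integrates to the expected duration.

  The critical equation is the vanishing of the logarithmic derivative of the reduced cost. The
  optimal \<open>k\<close> carries a factor \<open>t^3\<close>, which is what passing from
  \<open>\<kappa> 0\<close> to a larger \<open>\<kappa>'\<close> absorbs. The error bound is known
  for large \<open>t\<close> and integer \<open>k\<close> only, whereas the minimiser is real:
  \<open>k\<close> is rounded up, which lowers the bound, and for large tolerances the choice is
  frozen.\<close>

lemma constant_if_quadratic_increments:
  fixes G :: "real \<Rightarrow> real"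
  assumes "\<And>a b. a \<le> b \<Longrightarrow> \<bar>G b - G a\<bar> \<le> C * (b - a)\<^sup>2"
  shows "G a = G b"
proof -
  have bd: "\<bar>G b - G a\<bar> \<le> C * (b - a)\<^sup>2" for a b
    using assms[of a b] assms[of b a] by (cases "a \<le> b") (auto simp: power2_commute abs_minus_commute)
  \<comment> \<open>A quadratic bound on the increments makes every difference quotient
    \<open>O(h)\<close>.\<close>
  have "(G has_real_derivative 0) (at z)" for z
    unfolding DERIV_def
  proof (rule tendsto_0_le[where K=1])
    show "((\<lambda>h. C * \<bar>h\<bar>) \<longlongrightarrow> 0) (at (0::real))"
      by (auto intro!: tendsto_eq_intros)
    have "norm ((G (z + h) - G z) / h) \<le> norm (C * \<bar>h\<bar>) * 1" if "h \<noteq> 0" for h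
    proof -
      have "\<bar>G (z + h) - G z\<bar> \<le> C * \<bar>h\<bar> * \<bar>h\<bar>"
        using bd[of "z + h" z] by (simp add: power2_eq_square mult.assoc abs_mult_self_eq)
      then have "\<bar>G (z + h) - G z\<bar> / \<bar>h\<bar> \<le> C * \<bar>h\<bar>"
        using that by (simp add: pos_divide_le_eq)
      then show ?thesis by (simp add: abs_mult) (rule order_trans, assumption, simp add: mult_right_mono)
    qed
    then show "\<forall>\<^sub>F h in at 0. norm ((G (z + h) - G z) / h) \<le> norm (C * \<bar>h\<bar>) * 1"
      by (auto simp: eventually_at_filter)
  qed
  then show ?thesis using DERIV_isconst_all by blast
qed

text \<open>Integrating over the whole half-line, and not from 0, gives one formula for increments
  at all real arguments; the rates inserted later vanish at negative times.\<close>

definition cum :: "(real \<Rightarrow> real) \<Rightarrow> real \<Rightarrow> real" where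
  "cum \<sigma> s = (\<integral>l. indicator {..<s} l * \<sigma> l \<partial>lborel)"

context
  fixes \<sigma> :: "real \<Rightarrow> real" and K :: real
  assumes \<sigma>_int: "integrable lborel \<sigma>" and \<sigma>_nonneg: "\<And>l. 0 \<le> \<sigma> l" and \<sigma>_le: "\<And>l. \<sigma> l \<le> K"
begin

lemma integrable_indicator_rate: "A \<in> sets borel \<Longrightarrow> integrable lborel (\<lambda>l. indicator A l * \<sigma> l)"
  using integrable_real_mult_indicator[OF _ \<sigma>_int, of A] by (simp add: mult.commute)

lemma cum_diff:
  assumes "a \<le> b"
  shows "cum \<sigma> b - cum \<sigma> a = (\<integral>l. indicator {a..<b} l * \<sigma> l \<partial>lborel)"
proof -
  have "cum \<sigma> b - cum \<sigma> a = (\<integral>l. indicator {..<b} l * \<sigma> l - indicator {..<a} l * \<sigma> l \<partial>lborel)"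
    unfolding cum_def by (rule Bochner_Integration.integral_diff[symmetric]) (auto intro: integrable_indicator_rate)
  also have "\<dots> = (\<integral>l. indicator {a..<b} l * \<sigma> l \<partial>lborel)"
    using assms by (intro Bochner_Integration.integral_cong) (auto simp: indicator_def)
  finally show ?thesis .
qed

lemma integral_le_length:
  fixes f :: "real \<Rightarrow> real"
  assumes "a \<le> b" "integrable lborel f" "\<And>l. f l \<le> indicator {a..<b} l * B"
  shows "(\<integral>l. f l \<partial>lborel) \<le> B * (b - a)"
proof -
  have i: "integrable lborel (\<lambda>l. indicator {a..<b} l * B)"
    using assms(1) by (intro integrable_mult_left integrable_real_indicator) auto
  have "(\<integral>l. f l \<partial>lborel) \<le> (\<integral>l. indicator {a..<b} l * B \<partial>lborel)"
    by (rule integral_mono[OF assms(2) i]) (rule assms(3))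
  then show ?thesis using assms(1) by (simp add: mult.commute)
qed

lemma cum_increment:
  assumes "a \<le> b"
  shows "0 \<le> cum \<sigma> b - cum \<sigma> a" "cum \<sigma> b - cum \<sigma> a \<le> K * (b - a)"
proof -
  show "0 \<le> cum \<sigma> b - cum \<sigma> a"
    unfolding cum_diff[OF assms] by (rule Bochner_Integration.integral_nonneg) (simp add: \<sigma>_nonneg)
  show "cum \<sigma> b - cum \<sigma> a \<le> K * (b - a)"
    unfolding cum_diff[OF assms] using assms \<sigma>_le
    by (intro integral_le_length integrable_indicator_rate) (auto simp: indicator_def)
qed

lemma cum_nonneg: "0 \<le> cum \<sigma> s"
  unfolding cum_def by (rule Bochner_Integration.integral_nonneg) (simp add: \<sigma>_nonneg)

lemma borel_measurable_cum [measurable]: "cum \<sigma> \<in> borel_measurable borel"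
proof (rule borel_measurable_mono, rule monoI)
  show "cum \<sigma> a \<le> cum \<sigma> b" if "a \<le> b" for a b using cum_increment(1)[OF that] by simp
qed

lemma integrable_survival_rate:
  assumes "A \<in> sets borel"
  shows "integrable lborel (\<lambda>l. indicator A l * (exp (- cum \<sigma> l) * \<sigma> l))"
proof (rule Bochner_Integration.integrable_bound[OF \<sigma>_int])
  have [measurable]: "\<sigma> \<in> borel_measurable borel" using \<sigma>_int by (simp add: borel_measurable_integrable)
  show "(\<lambda>l. indicator A l * (exp (- cum \<sigma> l) * \<sigma> l)) \<in> borel_measurable lborel"
    using assms by measurable
  show "AE l in lborel. norm (indicator A l * (exp (- cum \<sigma> l) * \<sigma> l)) \<le> norm (\<sigma> l)"
    using \<sigma>_nonneg cum_nonneg by (auto simp: indicator_def abs_mult mult_left_le_one_le)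
qed

text \<open>The rate is only measurable, so \<open>cum\<close> need not be differentiable everywhere
  and the classical fundamental theorem does not apply. Instead the sum \<open>G\<close> of the
  integral and the survival function is shown to have increments of order \<open>(b - a)^2\<close>,
  which makes it constant.\<close>

lemma survival_integral:
  assumes "a \<le> b"
  shows "(\<integral>l. indicator {a..<b} l * (exp (- cum \<sigma> l) * \<sigma> l) \<partial>lborel) = exp (- cum \<sigma> a) - exp (- cum \<sigma> b)"
proof -
  define I where "I a b = (\<integral>l. indicator {a..<b} l * (exp (- cum \<sigma> l) * \<sigma> l) \<partial>lborel)" for a b
  define G where "G s = (\<integral>l. indicator {..<s} l * (exp (- cum \<sigma> l) * \<sigma> l) \<partial>lborel) + exp (- cum \<sigma> s)" for s
  have G_diff: "G b - G a = I a b + exp (- cum \<sigma> b) - exp (- cum \<sigma> a)" if "a \<le> b" for a b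
  proof -
    have "(\<integral>l. indicator {..<b} l * (exp (- cum \<sigma> l) * \<sigma> l) \<partial>lborel)
        - (\<integral>l. indicator {..<a} l * (exp (- cum \<sigma> l) * \<sigma> l) \<partial>lborel)
        = (\<integral>l. indicator {..<b} l * (exp (- cum \<sigma> l) * \<sigma> l) - indicator {..<a} l * (exp (- cum \<sigma> l) * \<sigma> l) \<partial>lborel)"
      by (rule Bochner_Integration.integral_diff[symmetric]) (auto intro: integrable_survival_rate)
    also have "\<dots> = I a b"
      unfolding I_def using that by (intro Bochner_Integration.integral_cong) (auto simp: indicator_def)
    finally show ?thesis by (simp add: G_def)
  qed
  have K0: "0 \<le> K" using \<sigma>_nonneg[of 0] \<sigma>_le[of 0] by linarith
  have "\<bar>G b - G a\<bar> \<le> K\<^sup>2 * (b - a)\<^sup>2" if ab: "a \<le> b" for a b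
  proof -
    define d where "d = cum \<sigma> b - cum \<sigma> a"
    have d: "0 \<le> d" "d \<le> K * (b - a)" using cum_increment[OF ab] by (auto simp: d_def)
    have dI: "(\<integral>l. indicator {a..<b} l * \<sigma> l \<partial>lborel) = d" using cum_diff[OF ab] by (simp add: d_def)
    have eb: "exp (- cum \<sigma> b) = exp (- cum \<sigma> a) * exp (- d)" by (simp add: d_def flip: exp_add)
    have i1: "integrable lborel (\<lambda>l. exp (- cum \<sigma> a) * (indicator {a..<b} l * \<sigma> l))"
      by (intro integrable_mult_right integrable_indicator_rate) simp
    have i2: "integrable lborel (\<lambda>l. indicator {a..<b} l * (exp (- cum \<sigma> l) * \<sigma> l))"
      by (rule integrable_survival_rate) simp
    have mono: "cum \<sigma> a \<le> cum \<sigma> l" "cum \<sigma> l \<le> cum \<sigma> b" if "l \<in> {a..<b}" for l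
      using cum_increment(1)[of a l] cum_increment(1)[of l b] that by auto
    \<comment> \<open>On \<open>[a, b)\<close> the survival factor lies between its two end values,
      so the integral lies between these values times the increment \<open>d\<close> of
      \<open>cum\<close>.\<close>
    have up: "I a b \<le> exp (- cum \<sigma> a) * d"
    proof -
      have "I a b \<le> (\<integral>l. exp (- cum \<sigma> a) * (indicator {a..<b} l * \<sigma> l) \<partial>lborel)"
        unfolding I_def
      proof (rule integral_mono[OF i2 i1])
        fix l show "indicator {a..<b} l * (exp (- cum \<sigma> l) * \<sigma> l) \<le> exp (- cum \<sigma> a) * (indicator {a..<b} l * \<sigma> l)"
        proof (cases "l \<in> {a..<b}")
          case True
          then show ?thesis using mult_right_mono[of "exp (- cum \<sigma> l)" "exp (- cum \<sigma> a)" "\<sigma> l"] mono(1) \<sigma>_nonneg by simp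
        qed simp
      qed
      then show ?thesis by (simp add: dI)
    qed
    have lo: "exp (- cum \<sigma> b) * d \<le> I a b"
    proof -
      have "(\<integral>l. exp (- cum \<sigma> b) * (indicator {a..<b} l * \<sigma> l) \<partial>lborel) \<le> I a b"
        unfolding I_def
      proof (rule integral_mono[OF _ i2])
        show "integrable lborel (\<lambda>l. exp (- cum \<sigma> b) * (indicator {a..<b} l * \<sigma> l))"
          by (intro integrable_mult_right integrable_indicator_rate) simp
        fix l show "exp (- cum \<sigma> b) * (indicator {a..<b} l * \<sigma> l) \<le> indicator {a..<b} l * (exp (- cum \<sigma> l) * \<sigma> l)"
        proof (cases "l \<in> {a..<b}")
          case True
          then show ?thesis using mult_right_mono[of "exp (- cum \<sigma> b)" "exp (- cum \<sigma> l)" "\<sigma> l"] mono(2) \<sigma>_nonneg by simp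
        qed simp
      qed
      then show ?thesis by (simp add: dI)
    qed
    have E: "0 < exp (- cum \<sigma> a)" "exp (- cum \<sigma> a) \<le> 1" using cum_nonneg[of a] by auto
    have l1: "1 - d \<le> exp (- d)" using exp_ge_add_one_self[of "- d"] by simp
    have l2: "exp (- d) * (1 + d) \<le> 1"
      using mult_left_mono[OF exp_ge_add_one_self[of d], of "exp (- d)"] by (simp flip: exp_add)
    have l2': "exp (- d) * d + exp (- d) - 1 \<le> 0" using l2 by (simp add: algebra_simps)
    have "G b - G a \<le> exp (- cum \<sigma> a) * (d + exp (- d) - 1)"
      unfolding G_diff[OF ab] eb using up by (simp add: algebra_simps)
    also have "\<dots> \<le> d\<^sup>2"
    proof -
      \<comment> \<open>Multiplying by \<open>1 + d\<close> replaces a Taylor expansion: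
        \<open>(1 - d + d^2) * (1 + d) = 1 + d^3\<close> dominates
        \<open>exp (- d) * (1 + d) \<le> 1\<close>.\<close>
      have "exp (- d) \<le> 1 - d + d\<^sup>2"
      proof -
        have "exp (- d) * (1 + d) \<le> (1 - d + d\<^sup>2) * (1 + d)"
        proof -
          have "(1 - d + d\<^sup>2) * (1 + d) = 1 + d^3" by (simp add: algebra_simps power2_eq_square power3_eq_cube)
          then show ?thesis using l2 zero_le_power[OF d(1), of 3] by linarith
        qed
        then show ?thesis using d(1) by (simp add: mult_le_cancel_right)
      qed
      then have "d + exp (- d) - 1 \<le> d\<^sup>2" by simp
      moreover have "0 \<le> d + exp (- d) - 1" using l1 by simp
      ultimately show ?thesis using E by (intro order_trans[OF mult_left_le_one_le]) auto
    qed
    finally have A: "G b - G a \<le> d\<^sup>2" .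
    \<comment> \<open>The lower bound uses the right end value of the survival factor together with
      \<open>exp (- d) \<ge> 1 - d\<close>, and again loses at most \<open>d^2\<close>.\<close>
    have "G b - G a \<ge> exp (- cum \<sigma> a) * (exp (- d) * d + exp (- d) - 1)"
      unfolding G_diff[OF ab] using lo eb by (simp add: algebra_simps)
    moreover have "exp (- cum \<sigma> a) * (exp (- d) * d + exp (- d) - 1) \<ge> - d\<^sup>2"
    proof -
      have "exp (- d) * (1 + d) \<ge> (1 - d) * (1 + d)" using l1 d(1) by (intro mult_right_mono) auto
      then have "- (exp (- d) * d + exp (- d) - 1) \<le> d\<^sup>2" by (simp add: algebra_simps power2_eq_square)
      moreover have "0 \<le> - (exp (- d) * d + exp (- d) - 1)" using l2' by simp
      ultimately have "exp (- cum \<sigma> a) * (- (exp (- d) * d + exp (- d) - 1)) \<le> d\<^sup>2"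
        using E by (intro order_trans[OF mult_left_le_one_le]) auto
      then show ?thesis by (simp add: algebra_simps)
    qed
    ultimately have "\<bar>G b - G a\<bar> \<le> d\<^sup>2" using A by linarith
    also have "d\<^sup>2 \<le> (K * (b - a))\<^sup>2" using d by (intro power_mono) auto
    finally show ?thesis by (simp add: power_mult_distrib)
  qed
  then have "G a = G b" by (rule constant_if_quadratic_increments)
  then show ?thesis using G_diff[OF assms] by (simp add: I_def)
qed

end

section \<open>Outcome of a single flight\<close>

locale neutron =
  fixes S :: neutron_data
  assumes setting: "neutron_setting S"
begin

lemma Dom_open: "open (Dom S)" and Dom_bounded: "bounded (Dom S)" and vmin_pos: "0 < vmin S"
  and sections: "cross_sections S" and laws: "offspring_laws S"
  using setting by (auto simp: neutron_setting_def)

lemma borel_Vel [measurable]: "Vel S \<in> sets borel"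
  unfolding Vel_def by measurable

lemma borel_Dom [measurable]: "Dom S \<in> sets borel"
  using Dom_open by simp

lemma borel_phase [measurable]: "phase S \<in> sets borel"
  unfolding borel_prod[symmetric] by (intro pair_measureI borel_Vel borel_Dom)

text \<open>Speeds are at least \<open>vmin S > 0\<close> and the domain is bounded, so every path
  leaves it. This is what gives the infimum in \<open>exit_time\<close> a meaning.\<close>

lemma exit_set_nonempty:
  assumes "y \<in> phase S"
  shows "{t. 0 < t \<and> fst y + t *\<^sub>R snd y \<notin> Dom S} \<noteq> {}"
proof -
  obtain r v where y: "y = (r, v)" by (cases y)
  have v: "0 < norm v" using assms vmin_pos by (auto simp: y Vel_def)
  obtain B where B: "\<And>z. z \<in> Dom S \<Longrightarrow> norm z \<le> B" using Dom_bounded unfolding bounded_iff by auto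
  have r: "norm r \<le> B" using assms B by (auto simp: y)
  have B0: "0 \<le> B" using r norm_ge_zero[of r] by linarith
  define t where "t = (B + norm r + 1) / norm v"
  have t: "0 < t" using v B0 by (simp add: t_def add_nonneg_pos)
  have "norm (t *\<^sub>R v) = B + norm r + 1" using v t B0 by (simp add: t_def abs_of_nonneg)
  moreover have "norm (t *\<^sub>R v) \<le> norm (r + t *\<^sub>R v) + norm r"
    using norm_triangle_ineq4[of "r + t *\<^sub>R v" r] by simp
  ultimately have "norm (r + t *\<^sub>R v) > B" by linarith
  then have "r + t *\<^sub>R v \<notin> Dom S" using B by force
  then show ?thesis using t by (auto simp: y)
qed

lemma exit_time_nonneg: "y \<in> phase S \<Longrightarrow> 0 \<le> exit_time S y"
  unfolding exit_time_def by (rule cInf_greatest[OF exit_set_nonempty]) auto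

lemma exit_time_le:
  assumes "0 < s" "fst y + s *\<^sub>R snd y \<notin> Dom S"
  shows "exit_time S y \<le> s"
  unfolding exit_time_def using assms by (intro cInf_lower bdd_belowI[of _ 0]) auto

lemma flow_in_phase:
  assumes "y \<in> phase S" "0 \<le> s" "s < exit_time S y"
  shows "flow y s \<in> phase S"
proof (cases "s = 0")
  case False
  then have "fst y + s *\<^sub>R snd y \<in> Dom S" using exit_time_le[of s y] assms by force
  then show ?thesis using assms(1) by (auto simp: flow_def)
qed (use assms(1) in \<open>simp add: flow_def\<close>)

section \<open>Rates and survival along the path of a flight\<close>

lemma rates_bounded: "\<exists>K>0. \<forall>y\<in>phase S. sigs S y + sigf S y \<le> K"
proof -
  have "sigs S \<in> Linf_plus S" "sigf S \<in> Linf_plus S" using sections by (auto simp: cross_sections_def)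
  then obtain K1 K2 where "\<And>y. y \<in> phase S \<Longrightarrow> sigs S y \<le> K1" "\<And>y. y \<in> phase S \<Longrightarrow> sigf S y \<le> K2"
    unfolding Linf_plus_def by blast
  then have "\<forall>y\<in>phase S. sigs S y + sigf S y \<le> max 1 (K1 + K2)" by (force simp: max_def)
  then show ?thesis by (intro exI[of _ "max 1 (K1 + K2)"]) auto
qed

definition rate_bound :: real where
  "rate_bound = (SOME K. 0 < K \<and> (\<forall>y\<in>phase S. sigs S y + sigf S y \<le> K))"

lemma rate_bound: "0 < rate_bound" "y \<in> phase S \<Longrightarrow> sigs S y + sigf S y \<le> rate_bound"
  using someI_ex[OF rates_bounded[unfolded Bex_def]] unfolding rate_bound_def by auto

lemma sig_nonneg: "y \<in> phase S \<Longrightarrow> 0 \<le> sigs S y" "y \<in> phase S \<Longrightarrow> 0 \<le> sigf S y"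
  using sections unfolding cross_sections_def Linf_plus_def by auto

text \<open>Elements of \<open>Linf_plus S\<close> are measurable on the phase space, with arbitrary
  values elsewhere. The indicator of the flight interval removes those values, since the path stays
  in the phase space before the exit time.\<close>

lemma borel_measurable_along_flow:
  assumes "f \<in> Linf_plus S" and y: "y \<in> phase S"
  shows "(\<lambda>s. indicator {0..<exit_time S y} s * f (flow y s)) \<in> borel_measurable borel"
proof -
  have "(\<lambda>z. indicator (phase S) z *\<^sub>R f z) \<in> borel_measurable borel"
    using assms(1) borel_phase unfolding Linf_plus_def
    by (subst (asm) borel_measurable_restrict_space_iff) auto
  moreover have "flow y \<in> borel_measurable borel"
    unfolding flow_def by (intro borel_measurable_continuous_onI continuous_intros)
  ultimately have [measurable]: "(\<lambda>s. indicator (phase S) (flow y s) *\<^sub>R f (flow y s)) \<in> borel_measurable borel"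
    by (rule measurable_compose[rotated])
  have "(\<lambda>s. indicator {0..<exit_time S y} s * (indicator (phase S) (flow y s) *\<^sub>R f (flow y s))) \<in> borel_measurable borel"
    by measurable
  also have "(\<lambda>s. indicator {0..<exit_time S y} s * (indicator (phase S) (flow y s) *\<^sub>R f (flow y s)))
      = (\<lambda>s. indicator {0..<exit_time S y} s * f (flow y s))"
    using flow_in_phase[OF y] by (auto simp: indicator_def fun_eq_iff simp del: mem_Sigma_iff)
  finally show ?thesis .
qed

text \<open>Cutting the total rate off outside the flight interval makes it integrable, non-negative
  and bounded on the whole line, as the results on \<open>cum\<close> require.\<close>

definition path_rate :: "config \<Rightarrow> real \<Rightarrow> real" where
  "path_rate y s = indicator {0..<exit_time S y} s * (sigs S (flow y s) + sigf S (flow y s))"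

lemma path_rate:
  assumes y: "y \<in> phase S"
  shows "integrable lborel (path_rate y)" "0 \<le> path_rate y s" "path_rate y s \<le> rate_bound"
proof -
  have ae: "0 \<le> path_rate y s \<and> path_rate y s \<le> indicator {0..<exit_time S y} s * rate_bound" for s
    using flow_in_phase[OF y, of s] rate_bound sig_nonneg unfolding path_rate_def
    by (auto simp: indicator_def simp del: mem_Sigma_iff)
  show "0 \<le> path_rate y s" "path_rate y s \<le> rate_bound"
    using ae[of s] rate_bound(1) by (cases "s \<in> {0..<exit_time S y}"; simp)+
  have "sigs S \<in> Linf_plus S" "sigf S \<in> Linf_plus S" using sections by (auto simp: cross_sections_def)
  note [measurable] = this[THEN borel_measurable_along_flow, OF y]
  have "path_rate y = (\<lambda>s. indicator {0..<exit_time S y} s * sigs S (flow y s) + indicator {0..<exit_time S y} s * sigf S (flow y s))"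
    by (simp add: path_rate_def fun_eq_iff distrib_left)
  then have [measurable]: "path_rate y \<in> borel_measurable borel" by simp
  have "integrable lborel (\<lambda>s. indicator {0..<exit_time S y} s * rate_bound)"
    using exit_time_nonneg[OF y] by (intro integrable_mult_left integrable_real_indicator) auto
  then show "integrable lborel (path_rate y)"
    by (rule Bochner_Integration.integrable_bound) (use ae in \<open>auto intro: order_trans[OF _ abs_ge_self]\<close>)
qed

definition surv :: "config \<Rightarrow> real \<Rightarrow> real" where
  "surv y s = exp (- cum (path_rate y) s)"

lemma surv_bounds: "0 < surv y s" "y \<in> phase S \<Longrightarrow> surv y s \<le> 1"
  using cum_nonneg[OF path_rate, of y s] by (auto simp: surv_def)

lemma borel_measurable_surv [measurable]: "y \<in> phase S \<Longrightarrow> surv y \<in> borel_measurable borel"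
  unfolding surv_def[abs_def] using borel_measurable_cum[OF path_rate, of y] by simp

lemma no_event_prob_eq_surv:
  assumes "s \<le> exit_time S y"
  shows "no_event_prob S y s = surv y s"
proof -
  have "(LINT l:{0..<s}|lborel. sigs S (flow y l) + sigf S (flow y l)) = cum (path_rate y) s"
    unfolding set_lebesgue_integral_def cum_def path_rate_def
    using assms by (intro Bochner_Integration.integral_cong) (auto simp: indicator_def)
  then show ?thesis by (simp add: no_event_prob_def surv_def)
qed

text \<open>Density of the time of the scatter or fission that ends the flight. The remaining mass
  \<open>surv y (exit_time S y)\<close> belongs to an exit without event.\<close>

definition path_hazard :: "config \<Rightarrow> real \<Rightarrow> ennreal" where
  "path_hazard y s = ennreal (surv y s * path_rate y s) * indicator {0<..<exit_time S y} s"

lemma borel_measurable_path_rate [measurable]: "y \<in> phase S \<Longrightarrow> path_rate y \<in> borel_measurable borel"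
  using path_rate(1) by (auto dest: borel_measurable_integrable)

lemma borel_measurable_path_hazard [measurable]: "y \<in> phase S \<Longrightarrow> path_hazard y \<in> borel_measurable borel"
  unfolding path_hazard_def by measurable

lemma flight_events_integral:
  assumes y: "y \<in> phase S" and [measurable]: "G \<in> borel_measurable borel"
  shows "(\<integral>\<^sup>+s\<in>{0<..<exit_time S y}. ennreal (no_event_prob S y s * sigs S (flow y s)) * G s \<partial>lborel)
    + (\<integral>\<^sup>+s\<in>{0<..<exit_time S y}. ennreal (no_event_prob S y s * sigf S (flow y s)) * G s \<partial>lborel)
    = (\<integral>\<^sup>+s. path_hazard y s * G s \<partial>lborel)" (is "?l1 + ?l2 = _")
proof -
  have "sigs S \<in> Linf_plus S" "sigf S \<in> Linf_plus S" using sections by (auto simp: cross_sections_def)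
  note m[measurable] = this[THEN borel_measurable_along_flow, OF y]
  define H where "H \<sigma> s = ennreal (surv y s * (indicator {0..<exit_time S y} s * \<sigma> (flow y s))) * G s * indicator {0<..<exit_time S y} s"
    for \<sigma> :: "config \<Rightarrow> real" and s
  have l: "(\<integral>\<^sup>+s\<in>{0<..<exit_time S y}. ennreal (no_event_prob S y s * \<sigma> (flow y s)) * G s \<partial>lborel) = (\<integral>\<^sup>+s. H \<sigma> s \<partial>lborel)" for \<sigma>
    by (rule nn_integral_cong) (auto simp: H_def indicator_def no_event_prob_eq_surv)
  have Hm: "H (sigs S) \<in> borel_measurable borel" "H (sigf S) \<in> borel_measurable borel"
    unfolding H_def using y by measurable
  have "?l1 + ?l2 = (\<integral>\<^sup>+s. H (sigs S) s + H (sigf S) s \<partial>lborel)"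
    unfolding l using Hm by (intro nn_integral_add[symmetric]) auto
  also have "\<dots> = (\<integral>\<^sup>+s. path_hazard y s * G s \<partial>lborel)"
  proof (rule nn_integral_cong)
    fix s
    show "H (sigs S) s + H (sigf S) s = path_hazard y s * G s"
    proof (cases "s \<in> {0<..<exit_time S y}")
      case True
      then have "flow y s \<in> phase S" using flow_in_phase[OF y] by auto
      then have "0 \<le> sigs S (flow y s)" "0 \<le> sigf S (flow y s)" using sig_nonneg by auto
      then show ?thesis using True surv_bounds(1)[of y s]
        by (simp add: H_def path_hazard_def path_rate_def distrib_left flip: distrib_right ennreal_plus)
    qed (auto simp: H_def path_hazard_def)
  qed
  finally show ?thesis .
qed

section \<open>Expectations over the outcome of a flight\<close>

lemma pis_integral:
  assumes z: "z \<in> phase S"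
  shows "(\<integral>\<^sup>+v\<in>Vel S. ennreal (pis S z v) * c \<partial>lborel) = c"
proof -
  have "case_prod (pis S) \<in> borel_measurable (restrict_space borel (phase S \<times> Vel S))"
    using sections by (auto simp: cross_sections_def)
  moreover have "phase S \<times> Vel S \<in> sets borel"
    unfolding borel_prod[symmetric, where 'a="vec3 \<times> vec3"] by (intro pair_measureI borel_Vel borel_phase)
  ultimately have "(\<lambda>p. indicator (phase S \<times> Vel S) p *\<^sub>R case_prod (pis S) p) \<in> borel_measurable borel"
    by (subst (asm) borel_measurable_restrict_space_iff) auto
  then have "(\<lambda>v. indicator (phase S \<times> Vel S) (z, v) *\<^sub>R case_prod (pis S) (z, v)) \<in> borel_measurable borel"
    by (rule measurable_compose[rotated]) (intro borel_measurable_continuous_onI continuous_intros)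
  also have "(\<lambda>v. indicator (phase S \<times> Vel S) (z, v) *\<^sub>R case_prod (pis S) (z, v)) = (\<lambda>v. indicator (Vel S) v * pis S z v)"
    using z by (auto simp: indicator_def fun_eq_iff)
  finally have [measurable]: "(\<lambda>v. indicator (Vel S) v * pis S z v) \<in> borel_measurable borel" .
  have "(\<integral>\<^sup>+v\<in>Vel S. ennreal (pis S z v) * c \<partial>lborel) = (\<integral>\<^sup>+v. ennreal (indicator (Vel S) v * pis S z v) * c \<partial>lborel)"
    by (rule nn_integral_cong) (auto simp: indicator_def)
  also have "\<dots> = (\<integral>\<^sup>+v. ennreal (indicator (Vel S) v * pis S z v) \<partial>lborel) * c"
    by (rule nn_integral_multc) measurable
  also have "(\<integral>\<^sup>+v. ennreal (indicator (Vel S) v * pis S z v) \<partial>lborel) = (\<integral>\<^sup>+v\<in>Vel S. ennreal (pis S z v) \<partial>lborel)"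
    by (rule nn_integral_cong) (auto simp: indicator_def)
  also have "\<dots> = 1" using sections z by (auto simp: cross_sections_def)
  finally show ?thesis by simp
qed

lemma prob_space_offspring:
  assumes "z \<in> phase S"
  shows "prob_space (offspring S z)"
proof -
  have "offspring S \<in> restrict_space borel (phase S) \<rightarrow>\<^sub>M prob_algebra velocities_space"
    using laws unfolding offspring_laws_def by blast
  then have "offspring S z \<in> space (prob_algebra velocities_space)"
    by (rule measurable_space) (use assms in \<open>simp add: space_restrict_space\<close>)
  then show ?thesis by (simp add: space_prob_algebra)
qed

lemma offspring_AE:
  assumes "z \<in> phase S"
  shows "AE w in offspring S z. fst w \<le> nmax S \<and> (\<forall>i<fst w. snd w i \<in> Vel S)"
  using conjunct2[OF conjunct2[OF laws[unfolded offspring_laws_def]], THEN bspec, OF assms, THEN conjunct1] .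

definition admissible :: "event \<Rightarrow> velocities \<Rightarrow> bool" where
  "admissible e y \<longleftrightarrow> (case e of Exit \<Rightarrow> True | Scatter \<Rightarrow> fst y = 1 \<and> snd y 0 \<in> Vel S
     | Fission \<Rightarrow> fst y \<le> nmax S \<and> (\<forall>i<fst y. snd y i \<in> Vel S))"

text \<open>The marks of an event are integrated out: scattering kernel and offspring law are
  probability measures concentrated on admissible velocities, so a bound that depends on the
  duration alone survives. Only monotonicity of the integral in \<open>F\<close> enters; the exit
  term vanishes by assumption.\<close>

lemma flight_expectation_le:
  assumes y: "y \<in> phase S" and G[measurable]: "G \<in> borel_measurable borel"
    and event: "\<And>s e w. 0 < s \<Longrightarrow> s < exit_time S y \<Longrightarrow> e \<noteq> Exit \<Longrightarrow> admissible e w \<Longrightarrow> F (s, e, w) \<le> G s"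
    and exit: "F (exit_time S y, Exit, 0, \<lambda>_. 0) = 0"
  shows "flight_expectation S y F \<le> (\<integral>\<^sup>+s. path_hazard y s * G s \<partial>lborel)"
proof -
  have "flight_expectation S y F \<le>
     (\<integral>\<^sup>+s\<in>{0<..<exit_time S y}. ennreal (no_event_prob S y s * sigs S (flow y s)) * G s \<partial>lborel)
    + (\<integral>\<^sup>+s\<in>{0<..<exit_time S y}. ennreal (no_event_prob S y s * sigf S (flow y s)) * G s \<partial>lborel)"
    unfolding flight_expectation_def exit mult_zero_right add_0_right
  proof (intro add_mono nn_integral_mono)
    fix s
    have z: "flow y s \<in> phase S" if "s \<in> {0<..<exit_time S y}" using that flow_in_phase[OF y] by auto
    show "ennreal (no_event_prob S y s * sigs S (flow y s)) *
          (\<integral>\<^sup>+v\<in>Vel S. ennreal (pis S (flow y s) v) * F (s, Scatter, 1, \<lambda>_. v) \<partial>lborel) * indicator {0<..<exit_time S y} s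
        \<le> ennreal (no_event_prob S y s * sigs S (flow y s)) * G s * indicator {0<..<exit_time S y} s"
    proof (cases "s \<in> {0<..<exit_time S y}")
      case True
      have "(\<integral>\<^sup>+v\<in>Vel S. ennreal (pis S (flow y s) v) * F (s, Scatter, 1, \<lambda>_. v) \<partial>lborel)
          \<le> (\<integral>\<^sup>+v\<in>Vel S. ennreal (pis S (flow y s) v) * G s \<partial>lborel)"
        using True event[of s Scatter]
        by (intro nn_integral_mono) (auto simp: indicator_def admissible_def intro!: mult_left_mono)
      then show ?thesis unfolding pis_integral[OF z[OF True]] by (intro mult_right_mono mult_left_mono) auto
    qed simp
    show "ennreal (no_event_prob S y s * sigf S (flow y s)) *
          (\<integral>\<^sup>+w. F (s, Fission, w) \<partial>offspring S (flow y s)) * indicator {0<..<exit_time S y} s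
        \<le> ennreal (no_event_prob S y s * sigf S (flow y s)) * G s * indicator {0<..<exit_time S y} s"
    proof (cases "s \<in> {0<..<exit_time S y}")
      case True
      interpret O: prob_space "offspring S (flow y s)" by (rule prob_space_offspring[OF z[OF True]])
      have "AE w in offspring S (flow y s). F (s, Fission, w) \<le> G s"
      proof -
        have "AE w in offspring S (flow y s). fst w \<le> nmax S \<and> (\<forall>i<fst w. snd w i \<in> Vel S)"
          by (rule offspring_AE[OF z[OF True]])
        then show ?thesis
        proof eventually_elim
          case (elim w)
          then have "admissible Fission w" by (simp add: admissible_def)
          with True show ?case by (intro event) auto
        qed
      qed
      then have "(\<integral>\<^sup>+w. F (s, Fission, w) \<partial>offspring S (flow y s)) \<le> (\<integral>\<^sup>+w. G s \<partial>offspring S (flow y s))"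
        by (rule nn_integral_mono_AE)
      then have "(\<integral>\<^sup>+w. F (s, Fission, w) \<partial>offspring S (flow y s)) \<le> G s" by (simp add: O.emeasure_space_1)
      then show ?thesis by (intro mult_right_mono mult_left_mono) auto
    qed simp
  qed
  then show ?thesis unfolding flight_events_integral[OF y G] .
qed

lemma flight_expectation_duration:
  assumes y: "y \<in> phase S" and G[measurable]: "G \<in> borel_measurable borel"
  shows "flight_expectation S y (\<lambda>w. G (fst w))
    = (\<integral>\<^sup>+s. path_hazard y s * G s \<partial>lborel) + ennreal (surv y (exit_time S y)) * G (exit_time S y)"
proof -
  have z: "flow y s \<in> phase S" if "s \<in> {0<..<exit_time S y}" for s using that flow_in_phase[OF y] by auto
  have "(\<integral>\<^sup>+s\<in>{0<..<exit_time S y}. ennreal (no_event_prob S y s * sigs S (flow y s)) *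
        (\<integral>\<^sup>+v\<in>Vel S. ennreal (pis S (flow y s) v) * G s \<partial>lborel) \<partial>lborel)
      = (\<integral>\<^sup>+s\<in>{0<..<exit_time S y}. ennreal (no_event_prob S y s * sigs S (flow y s)) * G s \<partial>lborel)"
    using pis_integral[OF z] by (intro nn_integral_cong) (auto simp: indicator_def)
  moreover have "(\<integral>\<^sup>+s\<in>{0<..<exit_time S y}. ennreal (no_event_prob S y s * sigf S (flow y s)) *
        (\<integral>\<^sup>+w. G s \<partial>offspring S (flow y s)) \<partial>lborel)
      = (\<integral>\<^sup>+s\<in>{0<..<exit_time S y}. ennreal (no_event_prob S y s * sigf S (flow y s)) * G s \<partial>lborel)"
    using prob_space.emeasure_space_1[OF prob_space_offspring[OF z]]
    by (intro nn_integral_cong) (auto simp: indicator_def)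
  ultimately show ?thesis
    unfolding flight_expectation_def
    by (simp add: flight_events_integral[OF y G] no_event_prob_eq_surv)
qed

text \<open>A flight that is undisturbed up to time \<open>r\<close> ends either by a later event or
  by an exit without event.\<close>

lemma surv_split:
  assumes y: "y \<in> phase S" and r: "0 < r" "r < exit_time S y"
  shows "ennreal (surv y r) = (\<integral>\<^sup>+s. path_hazard y s * indicator {r..} s \<partial>lborel) + ennreal (surv y (exit_time S y))"
proof -
  note pr = path_rate[OF y]
  have i: "integrable lborel (\<lambda>l. indicator {r..<exit_time S y} l * (surv y l * path_rate y l))"
    unfolding surv_def by (rule integrable_survival_rate[OF pr]) simp
  have I: "(\<integral>l. indicator {r..<exit_time S y} l * (surv y l * path_rate y l) \<partial>lborel) = surv y r - surv y (exit_time S y)"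
    unfolding surv_def by (rule survival_integral[OF pr]) (use r in simp)
  have nn: "0 \<le> surv y l * path_rate y l" for l using pr(2) surv_bounds(1)[of y l] by simp
  have "(\<integral>\<^sup>+s. path_hazard y s * indicator {r..} s \<partial>lborel)
      = (\<integral>\<^sup>+s. ennreal (indicator {r..<exit_time S y} s * (surv y s * path_rate y s)) \<partial>lborel)"
    using r by (intro nn_integral_cong) (auto simp: path_hazard_def indicator_def)
  also have "\<dots> = ennreal (surv y r - surv y (exit_time S y))"
    unfolding I[symmetric] by (rule nn_integral_eq_integral[OF i]) (use nn in simp)
  finally have e: "(\<integral>\<^sup>+s. path_hazard y s * indicator {r..} s \<partial>lborel) = ennreal (surv y r - surv y (exit_time S y))" .
  have "0 \<le> surv y r - surv y (exit_time S y)"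
    unfolding I[symmetric] using nn by (intro Bochner_Integration.integral_nonneg) simp
  then show ?thesis unfolding e using surv_bounds(1)[of y "exit_time S y"] by (simp flip: ennreal_plus)
qed

text \<open>Integration by parts: \<open>\<integral>\<^sub>0\<^sup>a P(s > r) dr = E[min s a]\<close> for the duration \<open>s\<close> of a flight.\<close>
lemma survival_integral_le_min_duration:
  assumes y: "y \<in> phase S"
  shows "(\<integral>\<^sup>+r. ennreal (surv y r) * indicator {0<..<exit_time S y} r * indicator {..a} r \<partial>lborel)
    \<le> flight_expectation S y (\<lambda>w. ennreal (min (fst w) a))"
proof -
  define e where "e = exit_time S y"
  define J where "J r = (indicator {0<..<e} r * indicator {..a} r :: ennreal)" for r :: real
  have [measurable]: "J \<in> borel_measurable borel" unfolding J_def by measurable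
  note [measurable] = borel_measurable_path_hazard[OF y] borel_measurable_surv[OF y]
  have "(\<lambda>p. indicator {p. fst p \<le> snd p} p :: ennreal) \<in> borel_measurable (lborel \<Otimes>\<^sub>M lborel :: (real \<times> real) measure)"
    by measurable
  then have [measurable]: "(\<lambda>p. indicator {..snd p} (fst p) :: ennreal) \<in> borel_measurable (lborel \<Otimes>\<^sub>M lborel :: (real \<times> real) measure)"
    by (simp add: indicator_def)
  \<comment> \<open>The relevant \<open>r\<close> lie in \<open>[0, min s a]\<close>. A negative
    \<open>a\<close> is harmless, as \<open>ennreal\<close> sends negative numbers to 0.\<close>
  have Jle: "(\<integral>\<^sup>+r. J r * indicator {..s} r \<partial>lborel) \<le> ennreal (min s a)" for s
  proof -
    have "(\<integral>\<^sup>+r. J r * indicator {..s} r \<partial>lborel) \<le> (\<integral>\<^sup>+r. indicator {0..min s a} r \<partial>lborel)"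
      by (intro nn_integral_mono) (auto simp: J_def indicator_def)
    also have "\<dots> \<le> ennreal (min s a)" by (cases "0 \<le> min s a") auto
    finally show ?thesis .
  qed
  \<comment> \<open>\<open>surv_split\<close> writes the tail as an integral over the duration
    \<open>s\<close>; after the two integrals are exchanged, each \<open>s\<close> is weighted by
    the length bounded in \<open>Jle\<close>.\<close>
  have "(\<integral>\<^sup>+r. ennreal (surv y r) * indicator {0<..<e} r * indicator {..a} r \<partial>lborel)
      = (\<integral>\<^sup>+r. (\<integral>\<^sup>+s. path_hazard y s * (J r * indicator {..s} r) \<partial>lborel) + ennreal (surv y e) * (J r * indicator {..e} r) \<partial>lborel)"
  proof (rule nn_integral_cong)
    fix r
    show "ennreal (surv y r) * indicator {0<..<e} r * indicator {..a} r
        = (\<integral>\<^sup>+s. path_hazard y s * (J r * indicator {..s} r) \<partial>lborel) + ennreal (surv y e) * (J r * indicator {..e} r)"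
    proof (cases "0 < r \<and> r < e \<and> r \<le> a")
      case True
      then have "ennreal (surv y r) = (\<integral>\<^sup>+s. path_hazard y s * indicator {r..} s \<partial>lborel) + ennreal (surv y e)"
        unfolding e_def by (intro surv_split[OF y]) auto
      moreover have "(\<integral>\<^sup>+s. path_hazard y s * indicator {r..} s \<partial>lborel) = (\<integral>\<^sup>+s. path_hazard y s * (J r * indicator {..s} r) \<partial>lborel)"
        using True by (intro nn_integral_cong) (auto simp: J_def indicator_def)
      ultimately show ?thesis using True by (simp add: J_def)
    qed (auto simp: J_def indicator_def)
  qed
  also have "\<dots> = (\<integral>\<^sup>+r. (\<integral>\<^sup>+s. path_hazard y s * (J r * indicator {..s} r) \<partial>lborel) \<partial>lborel)
      + (\<integral>\<^sup>+r. ennreal (surv y e) * (J r * indicator {..e} r) \<partial>lborel)"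
    by (rule nn_integral_add) (use y in measurable)
  also have "(\<integral>\<^sup>+r. (\<integral>\<^sup>+s. path_hazard y s * (J r * indicator {..s} r) \<partial>lborel) \<partial>lborel)
      = (\<integral>\<^sup>+s. (\<integral>\<^sup>+r. path_hazard y s * (J r * indicator {..s} r) \<partial>lborel) \<partial>lborel)"
    using y by (intro lborel_pair.Fubini'[symmetric]) measurable
  also have "\<dots> = (\<integral>\<^sup>+s. path_hazard y s * (\<integral>\<^sup>+r. J r * indicator {..s} r \<partial>lborel) \<partial>lborel)"
    by (intro nn_integral_cong nn_integral_cmult) measurable
  also have "(\<integral>\<^sup>+r. ennreal (surv y e) * (J r * indicator {..e} r) \<partial>lborel)
      = ennreal (surv y e) * (\<integral>\<^sup>+r. J r * indicator {..e} r \<partial>lborel)"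
    by (rule nn_integral_cmult) measurable
  also have "(\<integral>\<^sup>+s. path_hazard y s * (\<integral>\<^sup>+r. J r * indicator {..s} r \<partial>lborel) \<partial>lborel)
        + ennreal (surv y e) * (\<integral>\<^sup>+r. J r * indicator {..e} r \<partial>lborel)
      \<le> (\<integral>\<^sup>+s. path_hazard y s * ennreal (min s a) \<partial>lborel) + ennreal (surv y e) * ennreal (min e a)"
    by (intro add_mono nn_integral_mono mult_left_mono Jle) auto
  also have "\<dots> = flight_expectation S y (\<lambda>w. ennreal (min (fst w) a))"
    unfolding e_def by (rule flight_expectation_duration[OF y, symmetric]) measurable
  finally show ?thesis unfolding e_def .
qed

end

section \<open>Starting configurations\<close>

lemma flow_convex:
  assumes "convex D" "r \<in> D" "r + t *\<^sub>R v \<in> D" "0 \<le> s" "s \<le> t"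
  shows "r + s *\<^sub>R v \<in> (D :: 'a::real_vector set)"
proof (cases "t = 0")
  case False
  then have "(1 - s / t) *\<^sub>R r + (s / t) *\<^sub>R (r + t *\<^sub>R v) \<in> D"
    using assms by (intro convexD) auto
  also have "(1 - s / t) *\<^sub>R r + (s / t) *\<^sub>R (r + t *\<^sub>R v) = r + s *\<^sub>R v"
    using False by (simp add: algebra_simps)
  finally show ?thesis .
qed (use assms in auto)

fun births :: "event \<Rightarrow> velocities \<Rightarrow> nat" where
  "births Exit w = 0"
| "births Scatter w = 1"
| "births Fission w = fst w"

fun spawns :: "step \<Rightarrow> outcome \<Rightarrow> bool" where
  "spawns Scat (s, e, n, w) \<longleftrightarrow> e = Scatter"
| "spawns (Offs j) (s, e, n, w) \<longleftrightarrow> e = Fission \<and> j < n"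

text \<open>Position of the starting velocity in the outcome of the parent flight; a scatter stores
  its single new velocity at index 0.\<close>

fun child :: "step \<Rightarrow> nat" where
  "child Scat = 0"
| "child (Offs j) = j"

text \<open>Separating the start of a flight from the question whether the flight exists turns both
  into measurable maps on ordinary spaces, without a sigma-algebra on options. The value at a
  missing flight is a mere default.\<close>

definition start0 :: "config \<Rightarrow> history \<Rightarrow> address \<Rightarrow> real \<times> config" where
  "start0 x \<omega> p = (case start x \<omega> p of None \<Rightarrow> (0, 0, 0) | Some z \<Rightarrow> z)"

definition child_start :: "real \<times> config \<Rightarrow> outcome \<Rightarrow> nat \<Rightarrow> real \<times> config" where
  "child_start z y j = (fst z + fst y, fst (snd z) + fst y *\<^sub>R snd (snd z), snd (snd (snd y)) j)"

lemma start_Cons: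
  "start x \<omega> (m # p) = (if start x \<omega> p \<noteq> None \<and> spawns m (\<omega> p)
     then Some (child_start (start0 x \<omega> p) (\<omega> p) (child m)) else None)"
  by (cases m) (auto simp: start0_def child_start_def split: option.splits prod.splits)

text \<open>The start of a flight is computed from the outcomes of its proper ancestors alone. These
  are nondescendants, so a condition on the start is one that \<open>nbp_law\<close> can
  test.\<close>

lemma start_restrict:
  assumes "\<And>s q. p = s @ q \<Longrightarrow> s \<noteq> [] \<Longrightarrow> q \<in> I"
  shows "start x (restrict \<omega> I) p = start x \<omega> p"
  using assms
proof (induction p)
  case (Cons m p)
  have "start x (restrict \<omega> I) p = start x \<omega> p"
    by (rule Cons.IH) (use Cons.prems[of "m # _"] in auto)
  moreover from this have "start0 x (restrict \<omega> I) p = start0 x \<omega> p" by (simp only: start0_def)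
  moreover have "restrict \<omega> I p = \<omega> p" using Cons.prems[of "[m]" p] by simp
  ultimately show ?case by (simp only: start_Cons)
qed simp

lemma ancestor_nondescendant: "p = s @ q \<Longrightarrow> s \<noteq> [] \<Longrightarrow> q \<in> nondescendants p"
  by (auto simp: nondescendants_def)

lemma measurable_outcome_components [measurable]:
  "fst \<in> outcome_space \<rightarrow>\<^sub>M borel"
  "(\<lambda>y. fst (snd y)) \<in> outcome_space \<rightarrow>\<^sub>M count_space UNIV"
  "(\<lambda>y. fst (snd (snd y))) \<in> outcome_space \<rightarrow>\<^sub>M count_space UNIV"
  "(\<lambda>y. snd (snd (snd y)) j) \<in> outcome_space \<rightarrow>\<^sub>M borel"
  unfolding outcome_space_def velocities_space_def by measurable

lemma space_outcome [simp]: "space outcome_space = UNIV"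
  by (simp add: outcome_space_def velocities_space_def space_pair_measure space_PiM)

lemma measurable_spawns [measurable]: "Measurable.pred outcome_space (spawns m)"
proof (cases m)
  case Scat
  have "spawns m = (\<lambda>y. fst (snd y) = Scatter)" by (auto simp: Scat fun_eq_iff)
  then show ?thesis by simp
next
  case (Offs j)
  have "spawns m = (\<lambda>y. fst (snd y) = Fission \<and> j < fst (snd (snd y)))" by (auto simp: Offs fun_eq_iff)
  then show ?thesis by simp
qed

text \<open>The index set is kept general: all addresses for statements under \<open>P\<close>, and
  the nondescendants of \<open>p\<close> for conditioning the outcome of \<open>p\<close> on its
  start.\<close>

lemma measurable_start:
  assumes "\<And>s q. p = s @ q \<Longrightarrow> s \<noteq> [] \<Longrightarrow> q \<in> I"
  shows "Measurable.pred (PiM I (\<lambda>_. outcome_space)) (\<lambda>\<omega>. start x \<omega> p \<noteq> None)"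
    and "(\<lambda>\<omega>. start0 x \<omega> p) \<in> PiM I (\<lambda>_. outcome_space) \<rightarrow>\<^sub>M borel"
proof -
  have "Measurable.pred (PiM I (\<lambda>_. outcome_space)) (\<lambda>\<omega>. start x \<omega> p \<noteq> None) \<and>
    (\<lambda>\<omega>. start0 x \<omega> p) \<in> PiM I (\<lambda>_. outcome_space) \<rightarrow>\<^sub>M borel"
    using assms
  proof (induction p)
    case Nil
    show ?case by (simp add: start0_def)
  next
    case (Cons m p)
    have IH: "Measurable.pred (PiM I (\<lambda>_. outcome_space)) (\<lambda>\<omega>. start x \<omega> p \<noteq> None)"
        "(\<lambda>\<omega>. start0 x \<omega> p) \<in> PiM I (\<lambda>_. outcome_space) \<rightarrow>\<^sub>M borel"
      using Cons.IH Cons.prems[of "m # _"] by auto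
    note [measurable] = IH
    have "p \<in> I" using Cons.prems[of "[m]" p] by simp
    then have [measurable]: "(\<lambda>\<omega>. \<omega> p) \<in> PiM I (\<lambda>_. outcome_space) \<rightarrow>\<^sub>M outcome_space"
      by (rule measurable_component_singleton)
    have [measurable]: "(\<lambda>\<omega>. child_start (start0 x \<omega> p) (\<omega> p) j) \<in> PiM I (\<lambda>_. outcome_space) \<rightarrow>\<^sub>M borel" for j
      using IH(2) unfolding child_start_def borel_prod[symmetric] by measurable
    have "(\<lambda>\<omega>. start0 x \<omega> (m # p)) = (\<lambda>\<omega>. if start x \<omega> p \<noteq> None \<and> spawns m (\<omega> p)
        then child_start (start0 x \<omega> p) (\<omega> p) (child m) else (0, 0, 0))"
      by (auto simp: start0_def[of _ _ "m # p"] start_Cons fun_eq_iff simp del: start.simps(2))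
    moreover have "(\<lambda>\<omega>. start x \<omega> (m # p) \<noteq> None) = (\<lambda>\<omega>. start x \<omega> p \<noteq> None \<and> spawns m (\<omega> p))"
      by (simp add: start_Cons fun_eq_iff del: start.simps(2) not_None_eq)
    moreover have "Measurable.pred (PiM I (\<lambda>_. outcome_space)) (\<lambda>\<omega>. start x \<omega> p \<noteq> None \<and> spawns m (\<omega> p))"
      by measurable
    moreover have "(\<lambda>\<omega>. if start x \<omega> p \<noteq> None \<and> spawns m (\<omega> p)
        then child_start (start0 x \<omega> p) (\<omega> p) (child m) else (0, 0, 0)) \<in> PiM I (\<lambda>_. outcome_space) \<rightarrow>\<^sub>M borel"
      by measurable
    ultimately show ?case by (simp only: simp_thms)
  qed
  then show "Measurable.pred (PiM I (\<lambda>_. outcome_space)) (\<lambda>\<omega>. start x \<omega> p \<noteq> None)"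
    and "(\<lambda>\<omega>. start0 x \<omega> p) \<in> PiM I (\<lambda>_. outcome_space) \<rightarrow>\<^sub>M borel" by auto
qed

definition at_start :: "config \<Rightarrow> history \<Rightarrow> address \<Rightarrow> (real \<times> config \<Rightarrow> ennreal) \<Rightarrow> ennreal" where
  "at_start x \<omega> p f = (if start x \<omega> p = None then 0 else f (start0 x \<omega> p))"

lemma at_start_eq: "at_start x \<omega> p f = (case start x \<omega> p of None \<Rightarrow> 0 | Some z \<Rightarrow> f z)"
  by (auto simp: at_start_def start0_def split: option.splits)

section \<open>Estimates for the outcome of one flight\<close>

context neutron
begin

text \<open>Events have strictly positive duration because their integrals run over the open
  interval from 0 to the exit time; for an exit, non-negativity suffices.\<close>

definition good_outcome :: "outcome \<Rightarrow> bool" where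
  "good_outcome y \<longleftrightarrow> 0 \<le> fst y \<and> (fst (snd y) \<noteq> Exit \<longrightarrow> 0 < fst y) \<and> admissible (fst (snd y)) (snd (snd y))"

lemma flight_expectation_bad_outcome:
  assumes y: "y \<in> phase S"
  shows "flight_expectation S y (indicator {w. \<not> good_outcome w}) = 0"
proof -
  have "flight_expectation S y (indicator {w. \<not> good_outcome w}) \<le> (\<integral>\<^sup>+s. path_hazard y s * 0 \<partial>lborel)"
    using exit_time_nonneg[OF y]
    by (intro flight_expectation_le[OF y]) (auto simp: good_outcome_def indicator_def admissible_def[of Exit])
  then show ?thesis by simp
qed

text \<open>An event after \<open>a\<close> must fall between \<open>a\<close> and the exit time,
  hence into an interval of length at most \<open>b - a\<close>, where its density is at most
  \<open>rate_bound\<close>.\<close>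

lemma flight_expectation_late_event:
  assumes y: "y \<in> phase S" and e: "exit_time S y \<le> b" and ab: "a \<le> b"
  shows "flight_expectation S y (indicator {w. fst (snd w) \<noteq> Exit \<and> a < fst w}) \<le> ennreal (rate_bound * (b - a))"
proof -
  have "flight_expectation S y (indicator {w. fst (snd w) \<noteq> Exit \<and> a < fst w})
      \<le> (\<integral>\<^sup>+s. path_hazard y s * indicator {a<..} s \<partial>lborel)"
    by (intro flight_expectation_le[OF y]) (auto simp: indicator_def)
  also have "\<dots> \<le> (\<integral>\<^sup>+s. ennreal rate_bound * indicator {a..b} s \<partial>lborel)"
  proof (rule nn_integral_mono)
    fix s
    have "surv y s * path_rate y s \<le> 1 * rate_bound"
      using surv_bounds[of y s] path_rate(2,3)[OF y, of s] y by (intro mult_mono) auto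
    then show "path_hazard y s * indicator {a<..} s \<le> ennreal rate_bound * indicator {a..b} s"
      using e by (auto simp: path_hazard_def indicator_def intro!: ennreal_leI)
  qed
  also have "\<dots> = ennreal (rate_bound * (b - a))"
    using ab rate_bound(1) by (simp add: nn_integral_cmult_indicator ennreal_mult)
  finally show ?thesis .
qed

text \<open>Events have total rate at most \<open>rate_bound\<close>, and each begins at most
  \<open>nmax S\<close> flights; a scatter begins one, which is covered by
  \<open>nmax S > 1\<close>.\<close>

definition birth_rate :: real where
  "birth_rate = real (nmax S) * rate_bound"

lemma nmax_gt_1: "1 < nmax S"
  using laws by (auto simp: offspring_laws_def)

lemma birth_rate_pos: "0 < birth_rate"
  using nmax_gt_1 rate_bound(1) by (simp add: birth_rate_def)

text \<open>The event density is at most \<open>rate_bound\<close> times the survival probability,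
  whose integral up to \<open>a\<close> is bounded by the expected duration capped at
  \<open>a\<close>. Both sides are expectations of functions of the outcome, the form in which
  \<open>law_mono\<close> can use them.\<close>

lemma flight_expectation_births:
  assumes y: "y \<in> phase S"
  shows "flight_expectation S y (\<lambda>w. of_nat (births (fst (snd w)) (snd (snd w))) * indicator {..a} (fst w))
    \<le> flight_expectation S y (\<lambda>w. ennreal birth_rate * ennreal (min (fst w) a))"
proof -
  note [measurable] = borel_measurable_path_hazard[OF y] borel_measurable_surv[OF y]
  have births: "births e w \<le> nmax S" if "admissible e w" for e w
    using that nmax_gt_1 by (cases e) (auto simp: admissible_def)
  have "flight_expectation S y (\<lambda>w. of_nat (births (fst (snd w)) (snd (snd w))) * indicator {..a} (fst w))
      \<le> (\<integral>\<^sup>+s. path_hazard y s * (of_nat (nmax S) * indicator {..a} s) \<partial>lborel)"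
    by (intro flight_expectation_le[OF y]) (auto simp: indicator_def births)
  also have "\<dots> \<le> (\<integral>\<^sup>+s. ennreal birth_rate * (ennreal (surv y s) * indicator {0<..<exit_time S y} s * indicator {..a} s) \<partial>lborel)"
  proof (rule nn_integral_mono)
    fix s
    have "surv y s * path_rate y s * real (nmax S) \<le> birth_rate * surv y s"
      using surv_bounds(1)[of y s] mult_left_mono[OF mult_left_mono[OF path_rate(3)[OF y, of s], of "real (nmax S)"], of "surv y s"]
      by (simp add: birth_rate_def ac_simps)
    then have "ennreal (surv y s * path_rate y s) * of_nat (nmax S) \<le> ennreal birth_rate * ennreal (surv y s)"
      using surv_bounds(1)[of y s] path_rate(2)[OF y, of s] birth_rate_pos
      by (simp add: ennreal_of_nat_eq_real_of_nat ennreal_leI flip: ennreal_mult)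
    then show "path_hazard y s * (of_nat (nmax S) * indicator {..a} s)
        \<le> ennreal birth_rate * (ennreal (surv y s) * indicator {0<..<exit_time S y} s * indicator {..a} s)"
      by (auto simp: path_hazard_def indicator_def)
  qed
  also have "\<dots> = ennreal birth_rate * (\<integral>\<^sup>+s. ennreal (surv y s) * indicator {0<..<exit_time S y} s * indicator {..a} s \<partial>lborel)"
    by (rule nn_integral_cmult) measurable
  also have "\<dots> \<le> ennreal birth_rate * flight_expectation S y (\<lambda>w. ennreal (min (fst w) a))"
    by (intro mult_left_mono survival_integral_le_min_duration[OF y]) auto
  also have "\<dots> = flight_expectation S y (\<lambda>w. ennreal birth_rate * ennreal (min (fst w) a))"
    by (simp add: flight_expectation_duration[OF y, of "\<lambda>s. ennreal (min s a)"]
        flight_expectation_duration[OF y, of "\<lambda>s. ennreal birth_rate * ennreal (min s a)"]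
        distrib_left nn_integral_cmult[symmetric] mult.left_commute)
  finally show ?thesis .
qed

end

section \<open>Consequences of the law of the process\<close>

locale neutron_process = neutron +
  fixes P :: "history measure" and x :: config
  assumes law: "nbp_law S x P" and x: "x \<in> phase S"
begin

sublocale prob_space P
  using law by (simp add: nbp_law_def)

lemma sets_P [measurable_cong]: "sets P = sets (PiM UNIV (\<lambda>_. outcome_space))"
  using law by (simp add: nbp_law_def history_space_def)

lemma space_P [simp]: "space P = UNIV"
  using sets_eq_imp_space_eq[OF sets_P] by (simp add: space_PiM)

lemma measurable_history [measurable]:
  "Measurable.pred P (\<lambda>\<omega>. start x \<omega> p = None)"
  "(\<lambda>\<omega>. start0 x \<omega> p) \<in> P \<rightarrow>\<^sub>M borel"
  "(\<lambda>\<omega>. \<omega> p) \<in> P \<rightarrow>\<^sub>M outcome_space"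
proof -
  have "Measurable.pred P (\<lambda>\<omega>. start x \<omega> p \<noteq> None)"
    using measurable_start(1)[of p UNIV x] by (simp add: measurable_cong_sets[OF sets_P refl])
  then have "Measurable.pred P (\<lambda>\<omega>. \<not> start x \<omega> p \<noteq> None)" by (rule pred_intros_logic)
  then show "Measurable.pred P (\<lambda>\<omega>. start x \<omega> p = None)" by (simp del: not_None_eq)
  show "(\<lambda>\<omega>. start0 x \<omega> p) \<in> P \<rightarrow>\<^sub>M borel"
    using measurable_start(2)[of p UNIV x] by (simp add: measurable_cong_sets[OF sets_P refl])
  show "(\<lambda>\<omega>. \<omega> p) \<in> P \<rightarrow>\<^sub>M outcome_space"
    by (subst measurable_cong_sets[OF sets_P refl]) (rule measurable_component_singleton, simp)
qed

lemma measurable_start_time [measurable]: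
  "(\<lambda>\<omega>. fst (start0 x \<omega> p)) \<in> P \<rightarrow>\<^sub>M borel"
  using measurable_history(2)[of p] unfolding borel_prod[symmetric] by measurable

lemma borel_measurable_at_start [measurable (raw)]:
  assumes "(\<lambda>\<omega>. f \<omega> (start0 x \<omega> p)) \<in> borel_measurable P"
  shows "(\<lambda>\<omega>. at_start x \<omega> p (f \<omega>)) \<in> borel_measurable P"
  unfolding at_start_def using assms by measurable

text \<open>The start is a function of the nondescendant coordinates, which turns a condition
  \<open>R\<close> on it into a set \<open>A\<close> of restricted histories to be inserted into
  \<open>nbp_law\<close>.\<close>

lemma law_at_start:
  assumes F: "F \<in> borel_measurable outcome_space" and R: "R \<in> sets borel"
  shows "(\<integral>\<^sup>+\<omega>. at_start x \<omega> p (\<lambda>z. F (\<omega> p) * indicator R z) \<partial>P)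
    = (\<integral>\<^sup>+\<omega>. at_start x \<omega> p (\<lambda>z. flight_expectation S (snd z) F * indicator R z) \<partial>P)"
proof -
  let ?N = "nondescendants p"
  let ?M = "PiM ?N (\<lambda>_. outcome_space)"
  define A where "A = {\<rho> \<in> space ?M. start0 x \<rho> p \<in> R}"
  have [measurable]: "(\<lambda>\<rho>. start0 x \<rho> p) \<in> ?M \<rightarrow>\<^sub>M borel"
    by (rule measurable_start(2)) (rule ancestor_nondescendant)
  have A: "A \<in> sets ?M" unfolding A_def using R by measurable
  have rst: "start x (restrict \<omega> ?N) p = start x \<omega> p" for \<omega>
    by (rule start_restrict) (rule ancestor_nondescendant)
  have ind: "indicator A (restrict \<omega> ?N) = (indicator R (start0 x \<omega> p) :: ennreal)" for \<omega>
    by (simp add: A_def indicator_def start0_def rst space_PiM)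
  have "(\<integral>\<^sup>+\<omega>. (case start x \<omega> p of None \<Rightarrow> 0 | Some (b, y) \<Rightarrow> F (\<omega> p)) * indicator A (restrict \<omega> ?N) \<partial>P)
      = (\<integral>\<^sup>+\<omega>. (case start x \<omega> p of None \<Rightarrow> 0 | Some (b, y) \<Rightarrow> flight_expectation S y F) * indicator A (restrict \<omega> ?N) \<partial>P)"
    using law A F by (auto simp: nbp_law_def)
  moreover have "(case start x \<omega> p of None \<Rightarrow> 0 | Some (b, y) \<Rightarrow> F (\<omega> p)) * indicator A (restrict \<omega> ?N)
      = at_start x \<omega> p (\<lambda>z. F (\<omega> p) * indicator R z)" for \<omega>
    by (auto simp: ind at_start_eq start0_def split: option.splits)
  moreover have "(case start x \<omega> p of None \<Rightarrow> 0 | Some (b, y) \<Rightarrow> flight_expectation S y F) * indicator A (restrict \<omega> ?N)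
      = at_start x \<omega> p (\<lambda>z. flight_expectation S (snd z) F * indicator R z)" for \<omega>
    by (auto simp: ind at_start_eq start0_def split: option.splits)
  ultimately show ?thesis by simp
qed

text \<open>Estimates for \<open>flight_expectation\<close> need a start in the phase space, but a
  history may formally contain others; they have to be excluded almost surely.\<close>

definition valid_start :: "history \<Rightarrow> address \<Rightarrow> bool" where
  "valid_start \<omega> p \<longleftrightarrow> start x \<omega> p \<noteq> None \<longrightarrow> 0 \<le> fst (start0 x \<omega> p) \<and> snd (start0 x \<omega> p) \<in> phase S"

text \<open>On a slice \<open>R\<close> of starts the two test functions are the same for all
  starts, so a comparison of flight expectations that is uniform on the slice passes to the process.
  Integrals are compared by monotonicity alone, which avoids measurability of the flight expectation
  in the start.\<close>

lemma law_mono: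
  assumes valid: "AE \<omega> in P. valid_start \<omega> p"
    and F: "F \<in> borel_measurable outcome_space" "F' \<in> borel_measurable outcome_space" and R: "R \<in> sets borel"
    and le: "\<And>b y. (b, y) \<in> R \<Longrightarrow> y \<in> phase S \<Longrightarrow> flight_expectation S y F \<le> flight_expectation S y F'"
  shows "(\<integral>\<^sup>+\<omega>. at_start x \<omega> p (\<lambda>z. F (\<omega> p) * indicator R z) \<partial>P)
    \<le> (\<integral>\<^sup>+\<omega>. at_start x \<omega> p (\<lambda>z. F' (\<omega> p) * indicator R z) \<partial>P)"
  unfolding law_at_start[OF F(1) R] law_at_start[OF F(2) R]
proof (rule nn_integral_mono_AE)
  show "AE \<omega> in P. at_start x \<omega> p (\<lambda>z. flight_expectation S (snd z) F * indicator R z)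
      \<le> at_start x \<omega> p (\<lambda>z. flight_expectation S (snd z) F' * indicator R z)"
    using valid
  proof eventually_elim
    case (elim \<omega>)
    then show ?case using le[of "fst (start0 x \<omega> p)" "snd (start0 x \<omega> p)"]
      by (auto simp: at_start_def valid_start_def indicator_def simp del: mem_Sigma_iff)
  qed
qed

text \<open>Keeping the indicator of the slice on the right lets the bounds for disjoint slices add
  up to at most \<open>c\<close>.\<close>

lemma law_le_const:
  assumes valid: "AE \<omega> in P. valid_start \<omega> p"
    and F: "F \<in> borel_measurable outcome_space" and R: "R \<in> sets borel"
    and le: "\<And>b y. (b, y) \<in> R \<Longrightarrow> y \<in> phase S \<Longrightarrow> flight_expectation S y F \<le> c"
  shows "(\<integral>\<^sup>+\<omega>. at_start x \<omega> p (\<lambda>z. F (\<omega> p) * indicator R z) \<partial>P)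
    \<le> (\<integral>\<^sup>+\<omega>. c * indicator R (start0 x \<omega> p) \<partial>P)"
  unfolding law_at_start[OF F R]
proof (rule nn_integral_mono_AE)
  show "AE \<omega> in P. at_start x \<omega> p (\<lambda>z. flight_expectation S (snd z) F * indicator R z)
      \<le> c * indicator R (start0 x \<omega> p)"
    using valid
  proof eventually_elim
    case (elim \<omega>)
    then show ?case using le[of "fst (start0 x \<omega> p)" "snd (start0 x \<omega> p)"]
      by (auto simp: at_start_def valid_start_def indicator_def simp del: mem_Sigma_iff)
  qed
qed

lemma measurable_good_outcome [measurable]: "Measurable.pred outcome_space good_outcome"
proof -
  have "good_outcome = (\<lambda>y. 0 \<le> fst y \<and> (fst (snd y) \<noteq> Exit \<longrightarrow> 0 < fst y) \<and>
      (fst (snd y) = Scatter \<longrightarrow> fst (snd (snd y)) = 1 \<and> snd (snd (snd y)) 0 \<in> Vel S) \<and>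
      (fst (snd y) = Fission \<longrightarrow> fst (snd (snd y)) \<le> nmax S \<and> (\<forall>i. i < fst (snd (snd y)) \<longrightarrow> snd (snd (snd y)) i \<in> Vel S)))"
    by (auto simp: good_outcome_def admissible_def fun_eq_iff split: event.splits)
  also have "Measurable.pred outcome_space \<dots>" by measurable
  finally show ?thesis .
qed

lemma AE_good_outcome:
  assumes valid: "AE \<omega> in P. valid_start \<omega> p"
  shows "AE \<omega> in P. start x \<omega> p \<noteq> None \<longrightarrow> good_outcome (\<omega> p)"
proof -
  have F: "indicator {w. \<not> good_outcome w} \<in> borel_measurable outcome_space"
    by measurable
  have "(\<integral>\<^sup>+\<omega>. at_start x \<omega> p (\<lambda>z. indicator {w. \<not> good_outcome w} (\<omega> p) * indicator UNIV z) \<partial>P)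
      \<le> (\<integral>\<^sup>+\<omega>. 0 * indicator UNIV (start0 x \<omega> p) \<partial>P)"
    by (rule law_le_const[OF valid F]) (auto simp: flight_expectation_bad_outcome)
  then have "(\<integral>\<^sup>+\<omega>. at_start x \<omega> p (\<lambda>z. indicator {w. \<not> good_outcome w} (\<omega> p) * indicator UNIV z) \<partial>P) = 0"
    by simp
  then have "AE \<omega> in P. at_start x \<omega> p (\<lambda>z. indicator {w. \<not> good_outcome w} (\<omega> p) * indicator UNIV z) = 0"
    using F by (subst (asm) nn_integral_0_iff_AE) measurable
  then show ?thesis
    by eventually_elim (auto simp: at_start_def indicator_def split: if_splits)
qed

text \<open>An event at or after the exit time is excluded by slicing according to the step of a grid of
  mesh \<open>h\<close> in which the straight path leaves the domain: an event that late falls into the slice,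
  which has probability \<open>O(h)\<close>. In this way only products of functions of the start and
  of the outcome of a flight occur.\<close>
lemma AE_event_inside:
  assumes valid: "AE \<omega> in P. valid_start \<omega> p"
  shows "AE \<omega> in P. start x \<omega> p \<noteq> None \<longrightarrow> fst (snd (\<omega> p)) \<noteq> Exit \<longrightarrow> 0 < fst (\<omega> p) \<longrightarrow>
    fst (snd (start0 x \<omega> p)) + fst (\<omega> p) *\<^sub>R snd (snd (start0 x \<omega> p)) \<in> Dom S"
proof -
  define B where "B = {\<omega>. start x \<omega> p \<noteq> None \<and> fst (snd (\<omega> p)) \<noteq> Exit \<and> 0 < fst (\<omega> p) \<and>
    fst (snd (start0 x \<omega> p)) + fst (\<omega> p) *\<^sub>R snd (snd (start0 x \<omega> p)) \<notin> Dom S}"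
  have [measurable]: "(\<lambda>\<omega>. fst (snd (start0 x \<omega> p))) \<in> borel_measurable P" "(\<lambda>\<omega>. snd (snd (start0 x \<omega> p))) \<in> borel_measurable P"
    using measurable_history(2)[of p] unfolding borel_prod[symmetric] by measurable
  have "B = {\<omega> \<in> space P. \<not> start x \<omega> p = None \<and> fst (snd (\<omega> p)) \<noteq> Exit \<and> 0 < fst (\<omega> p) \<and>
    fst (snd (start0 x \<omega> p)) + fst (\<omega> p) *\<^sub>R snd (snd (start0 x \<omega> p)) \<notin> Dom S}"
    by (simp add: B_def)
  also have "\<dots> \<in> sets P" by measurable
  finally have B: "B \<in> sets P" .
  have bound: "emeasure P B \<le> ennreal (rate_bound * h)" if h: "0 < h" for h
  proof -
    \<comment> \<open>\<open>A i\<close> collects the starts whose path is outside the domain for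
      the first time, as seen on the grid, at grid point \<open>i + 1\<close>; \<open>F i\<close>
      marks an event later than grid time \<open>i * h\<close>.\<close>
    define A where "A i = {z :: real \<times> config. (\<forall>j\<le>i. fst (snd z) + (real j * h) *\<^sub>R snd (snd z) \<in> Dom S) \<and>
        fst (snd z) + (real (Suc i) * h) *\<^sub>R snd (snd z) \<notin> Dom S}" for i :: nat
    define F where "F i = (indicator {w. fst (snd w) \<noteq> Exit \<and> real i * h < fst w} :: outcome \<Rightarrow> ennreal)" for i :: nat
    have [measurable]: "(\<lambda>z::real \<times> config. fst (snd z) + c *\<^sub>R snd (snd z)) \<in> borel \<rightarrow>\<^sub>M borel" for c
      by (intro borel_measurable_continuous_onI continuous_intros)
    have A_sets: "A i \<in> sets borel" for i unfolding A_def by measurable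
    have F_meas: "F i \<in> borel_measurable outcome_space" for i unfolding F_def by measurable
    note [measurable] = A_sets F_meas
    have disj: "i = j" if "z \<in> A i" "z \<in> A j" for z i j
    proof (rule ccontr)
      assume "i \<noteq> j"
      then consider "Suc i \<le> j" | "Suc j \<le> i" by linarith
      then show False using that by cases (auto simp: A_def)
    qed
    have "emeasure P B = (\<integral>\<^sup>+\<omega>. indicator B \<omega> \<partial>P)" using B by simp
    also have "\<dots> \<le> (\<integral>\<^sup>+\<omega>. (\<Sum>i. at_start x \<omega> p (\<lambda>z. F i (\<omega> p) * indicator (A i) z)) \<partial>P)"
    proof (rule nn_integral_mono_AE)
      show "AE \<omega> in P. indicator B \<omega> \<le> (\<Sum>i. at_start x \<omega> p (\<lambda>z. F i (\<omega> p) * indicator (A i) z))"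
        using valid
      proof eventually_elim
        case (elim \<omega>)
        show ?case
        proof (cases "\<omega> \<in> B")
          case True
          obtain b r v where z: "start0 x \<omega> p = (b, r, v)" by (cases "start0 x \<omega> p") auto
          define s where "s = fst (\<omega> p)"
          have ex: "start x \<omega> p \<noteq> None" and ev: "fst (snd (\<omega> p)) \<noteq> Exit" and s: "0 < s" "r + s *\<^sub>R v \<notin> Dom S"
            using True by (auto simp: B_def z s_def)
          have r: "r \<in> Dom S" using elim ex by (auto simp: valid_start_def z)
          have conv: "convex (Dom S)" using setting by (simp add: neutron_setting_def)
          \<comment> \<open>The first grid point not before \<open>s\<close>. By convexity a path
            that is outside at time \<open>s\<close> is still outside there.\<close>
          define k where "k = nat \<lceil>s / h\<rceil>"
          have k1: "1 \<le> k" using s(1) h by (simp add: k_def Suc_le_eq)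
          have ks: "s \<le> real k * h" and ks': "real (k - 1) * h < s"
          proof -
            have "s / h \<le> real k" unfolding k_def by (simp add: real_nat_ceiling_ge)
            then show "s \<le> real k * h" using h by (simp add: field_simps)
            have c0: "0 < \<lceil>s / h\<rceil>" using s(1) h by simp
            have "real (k - 1) = of_int \<lceil>s / h\<rceil> - 1" unfolding k_def using c0 k1 by (simp add: of_nat_diff k_def)
            then have "real (k - 1) < s / h" by linarith
            then show "real (k - 1) * h < s" using h by (simp add: field_simps)
          qed
          have out: "r + (real k * h) *\<^sub>R v \<notin> Dom S"
            using flow_convex[OF conv r _ _ ks] s by auto
          \<comment> \<open>The first exit seen on the grid is no later than grid point
            \<open>k\<close>, so \<open>n * h\<close> precedes \<open>s\<close> and the event counts
            as late in slice \<open>n\<close>.\<close>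
          define n where "n = (LEAST n. r + (real (Suc n) * h) *\<^sub>R v \<notin> Dom S)"
          have n1: "r + (real (Suc n) * h) *\<^sub>R v \<notin> Dom S"
            unfolding n_def by (rule LeastI[of _ "k - 1"]) (use out k1 in simp)
          have n2: "n \<le> k - 1" unfolding n_def by (rule Least_le) (use out k1 in simp)
          have n3: "r + (real j * h) *\<^sub>R v \<in> Dom S" if "j \<le> n" for j
          proof (cases j)
            case (Suc i)
            then have "i < n" using that by simp
            then show ?thesis using not_less_Least[of i "\<lambda>n. r + (real (Suc n) * h) *\<^sub>R v \<notin> Dom S"] Suc by (auto simp: n_def)
          qed (use r in simp)
          have "real n * h \<le> real (k - 1) * h" using n2 h by (intro mult_right_mono) auto
          then have "real n * h < s" using ks' by simp
          then have "at_start x \<omega> p (\<lambda>z. F n (\<omega> p) * indicator (A n) z) = 1"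
            using ex ev n1 n3 by (simp add: at_start_def F_def A_def z s_def)
          moreover have "at_start x \<omega> p (\<lambda>z. F n (\<omega> p) * indicator (A n) z)
              \<le> (\<Sum>i. at_start x \<omega> p (\<lambda>z. F i (\<omega> p) * indicator (A i) z))"
            using sum_le_suminf[of "\<lambda>i. at_start x \<omega> p (\<lambda>z. F i (\<omega> p) * indicator (A i) z)" "{n}"] by simp
          ultimately show ?thesis using True by simp
        qed simp
      qed
    qed
    also have "\<dots> = (\<Sum>i. \<integral>\<^sup>+\<omega>. at_start x \<omega> p (\<lambda>z. F i (\<omega> p) * indicator (A i) z) \<partial>P)"
      by (rule nn_integral_suminf) measurable
    also have "\<dots> \<le> (\<Sum>i. \<integral>\<^sup>+\<omega>. ennreal (rate_bound * h) * indicator (A i) (start0 x \<omega> p) \<partial>P)"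
    proof (intro suminf_le law_le_const[OF valid])
      fix i b y assume z: "(b, y) \<in> A i" and y: "y \<in> phase S"
      \<comment> \<open>Grid point \<open>i + 1\<close> lies outside and so bounds the exit time,
        which leaves a late event a window of length \<open>h\<close>.\<close>
      have "exit_time S y \<le> real (Suc i) * h"
        using z h by (intro exit_time_le) (auto simp: A_def)
      then have "flight_expectation S y (F i) \<le> ennreal (rate_bound * (real (Suc i) * h - real i * h))"
        unfolding F_def using h by (intro flight_expectation_late_event[OF y]) auto
      then show "flight_expectation S y (F i) \<le> ennreal (rate_bound * h)" by (simp add: algebra_simps)
    qed auto
    also have "\<dots> = (\<integral>\<^sup>+\<omega>. (\<Sum>i. ennreal (rate_bound * h) * indicator (A i) (start0 x \<omega> p)) \<partial>P)"
      by (rule nn_integral_suminf[symmetric]) measurable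
    \<comment> \<open>The slices are disjoint, so at most one of them contributes for each
      history.\<close>
    also have "\<dots> \<le> (\<integral>\<^sup>+\<omega>. ennreal (rate_bound * h) \<partial>P)"
    proof (rule nn_integral_mono)
      fix \<omega>
      have "disjoint_family A" using disj by (auto simp: disjoint_family_on_def)
      then show "(\<Sum>i. ennreal (rate_bound * h) * indicator (A i) (start0 x \<omega> p)) \<le> ennreal (rate_bound * h)"
        by (cases "\<exists>i. start0 x \<omega> p \<in> A i") (auto simp: suminf_cmult_indicator[where f = "\<lambda>_. ennreal (rate_bound * h)"] simp del: ennreal_suminf_cmult)
    qed
    also have "\<dots> = ennreal (rate_bound * h)" using emeasure_space_1 by simp
    finally show ?thesis .
  qed
  have "emeasure P B \<le> 0"
  proof (rule ennreal_le_epsilon)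
    fix e :: real assume "0 < e"
    then show "emeasure P B \<le> 0 + ennreal e" using bound[of "e / rate_bound"] rate_bound(1) by simp
  qed
  then have "AE \<omega> in P. \<omega> \<notin> B" using B by (intro AE_not_in) (simp add: null_sets_def)
  then show ?thesis by eventually_elim (auto simp: B_def)
qed

text \<open>Induction along the ancestry: an event takes place inside the domain and hands on
  velocities from \<open>Vel S\<close>, so validity passes to each child. Validity of the parent is
  in turn the hypothesis under which these two facts are available.\<close>

lemma AE_valid_start: "AE \<omega> in P. valid_start \<omega> p"
proof (induction p)
  case Nil
  then show ?case using x by (simp add: valid_start_def start0_def)
next
  case (Cons m p)
  show ?case using Cons AE_good_outcome[OF Cons] AE_event_inside[OF Cons]
  proof eventually_elim
    case (elim \<omega>)
    show ?case unfolding valid_start_def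
    proof
      assume s: "start x \<omega> (m # p) \<noteq> None"
      then have ex: "start x \<omega> p \<noteq> None" and sp: "spawns m (\<omega> p)" and
        st: "start0 x \<omega> (m # p) = child_start (start0 x \<omega> p) (\<omega> p) (child m)"
        unfolding start0_def[of x \<omega> "m # p"] by (auto simp: start_Cons simp del: start.simps(2) split: if_splits)
      obtain du ev n w where o: "\<omega> p = (du, ev, n, w)" by (cases "\<omega> p") auto
      have g: "good_outcome (\<omega> p)" using elim ex by blast
      have ev: "ev \<noteq> Exit" and w: "w (child m) \<in> Vel S"
        using sp g by (cases m; auto simp: o good_outcome_def admissible_def)+
      then have du: "0 < du" using g by (auto simp: o good_outcome_def)
      show "0 \<le> fst (start0 x \<omega> (m # p)) \<and> snd (start0 x \<omega> (m # p)) \<in> phase S"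
        using elim ex ev du w by (auto simp: st child_start_def o valid_start_def)
    qed
  qed
qed

end

section \<open>Births and lifetimes\<close>

text \<open>Addresses form a tree: each one other than the root is a child of exactly one
  address.\<close>

lemma nn_integral_address_Cons:
  fixes f :: "address \<Rightarrow> ennreal"
  shows "(\<integral>\<^sup>+p. f p \<partial>count_space UNIV) = f [] + (\<integral>\<^sup>+p. (\<integral>\<^sup>+m. f (m # p) \<partial>count_space UNIV) \<partial>count_space UNIV)"
proof -
  let ?C = "\<lambda>(m, p). m # p :: address"
  have "(\<integral>\<^sup>+p. f p \<partial>count_space UNIV) = (\<integral>\<^sup>+p. f p * indicator {[]} p + f p * indicator (range ?C) p \<partial>count_space UNIV)"
  proof (rule nn_integral_cong)
    fix p show "f p = f p * indicator {[]} p + f p * indicator (range ?C) p"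
      by (cases p) (auto simp: indicator_def image_iff)
  qed
  also have "\<dots> = (\<integral>\<^sup>+p. f p * indicator {[]} p \<partial>count_space UNIV) + (\<integral>\<^sup>+p. f p * indicator (range ?C) p \<partial>count_space UNIV)"
    by (rule nn_integral_add) auto
  also have "(\<integral>\<^sup>+p. f p * indicator {[]} p \<partial>count_space UNIV) = f []"
    by (subst nn_integral_indicator_singleton) auto
  also have "(\<integral>\<^sup>+p. f p * indicator (range ?C) p \<partial>count_space UNIV) = (\<integral>\<^sup>+p. f p \<partial>count_space (range ?C))"
    by (simp add: nn_integral_count_space_indicator)
  also have "\<dots> = (\<integral>\<^sup>+z. f (?C z) \<partial>count_space UNIV)"
    by (rule nn_integral_bij_count_space[symmetric]) (auto simp: bij_betw_def inj_on_def)
  also have "\<dots> = (\<integral>\<^sup>+p. (\<integral>\<^sup>+m. f (m # p) \<partial>count_space UNIV) \<partial>count_space UNIV)"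
    by (subst nn_integral_snd_count_space[symmetric]) simp
  finally show ?thesis .
qed

lemma countable_addresses: "countable (UNIV :: address set)"
proof -
  have "(UNIV :: step set) = insert Scat (range Offs)"
    using step.exhaust by blast
  moreover have "countable (insert Scat (range Offs))" by simp
  ultimately have "countable (UNIV :: step set)" by (simp only:)
  then show ?thesis using countable_lists[of "UNIV :: step set"] by simp
qed

definition started :: "config \<Rightarrow> history \<Rightarrow> address \<Rightarrow> real \<Rightarrow> bool" where
  "started x \<omega> p t \<longleftrightarrow> start x \<omega> p \<noteq> None \<and> fst (start0 x \<omega> p) \<le> t"

lemma in_flight_iff:
  "p \<in> in_flight x \<omega> u \<longleftrightarrow> start x \<omega> p \<noteq> None \<and> fst (start0 x \<omega> p) \<le> u \<and> u < fst (start0 x \<omega> p) + fst (\<omega> p)"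
  by (auto simp: in_flight_def start0_def)

lemma count_spawns:
  "(\<integral>\<^sup>+m. indicator {m. spawns m y} m \<partial>count_space UNIV) = of_nat (births (fst (snd y)) (snd (snd y)))"
proof -
  obtain s e n w where y: "y = (s, e, n, w)" by (cases y) auto
  have "{m. spawns m y} = (case e of Exit \<Rightarrow> {} | Scatter \<Rightarrow> {Scat} | Fission \<Rightarrow> Offs ` {..<n})"
  proof (intro set_eqI)
    fix m show "m \<in> {m. spawns m y} \<longleftrightarrow> m \<in> (case e of Exit \<Rightarrow> {} | Scatter \<Rightarrow> {Scat} | Fission \<Rightarrow> Offs ` {..<n})"
      by (cases m; cases e) (auto simp: y)
  qed
  moreover have "card (Offs ` {..<n}) = n" by (subst card_image) (auto simp: inj_on_def)
  ultimately show ?thesis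
    by (cases e) (auto simp: y)
qed

text \<open>All children of a flight begin at the moment it ends, so by time \<open>t\<close> either
  all of them count or none.\<close>

lemma count_children:
  "(\<integral>\<^sup>+m. indicator {m. started x \<omega> (m # p) t} m \<partial>count_space UNIV)
    = at_start x \<omega> p (\<lambda>z. of_nat (births (fst (snd (\<omega> p))) (snd (snd (\<omega> p)))) * indicator {..t} (fst z + fst (\<omega> p)))"
proof (cases "start x \<omega> p \<noteq> None \<and> fst (start0 x \<omega> p) + fst (\<omega> p) \<le> t")
  case True
  then have "started x \<omega> (m # p) t \<longleftrightarrow> spawns m (\<omega> p)" for m
    by (auto simp: started_def start0_def[of x \<omega> "m # p"] start_Cons child_start_def simp del: start.simps(2))
  then show ?thesis using True by (simp add: count_spawns at_start_def del: not_None_eq)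
next
  case False
  then have "\<not> started x \<omega> (m # p) t" for m
    by (auto simp: started_def start0_def[of x \<omega> "m # p"] start_Cons child_start_def simp del: start.simps(2))
  then show ?thesis using False by (auto simp: at_start_def)
qed

context neutron_process
begin

lemma measurable_births [measurable]:
  "(\<lambda>y. of_nat (births (fst (snd y)) (snd (snd y))) :: ennreal) \<in> borel_measurable outcome_space"
proof -
  have "(\<lambda>y :: outcome. of_nat (births (fst (snd y)) (snd (snd y))) :: ennreal)
      = (\<lambda>y. if fst (snd y) = Scatter then 1 else if fst (snd y) = Fission then of_nat (fst (snd (snd y))) else 0)"
  proof
    fix y :: outcome
    show "(of_nat (births (fst (snd y)) (snd (snd y))) :: ennreal) = (if fst (snd y) = Scatter then 1 else if fst (snd y) = Fission then of_nat (fst (snd (snd y))) else 0)"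
      by (cases "fst (snd y)") auto
  qed
  also have "\<dots> \<in> borel_measurable outcome_space" by measurable
  finally show ?thesis .
qed

text \<open>The starting time is sliced into cells of length \<open>h\<close>, on each of which it is replaced by the
  left end point; the error vanishes with \<open>h\<close>.\<close>
lemma expected_children_le_lifetime:
  "(\<integral>\<^sup>+\<omega>. (\<integral>\<^sup>+m. indicator {m. started x \<omega> (m # p) t} m \<partial>count_space UNIV) \<partial>P)
    \<le> ennreal birth_rate * (\<integral>\<^sup>+\<omega>. at_start x \<omega> p (\<lambda>z. ennreal (min (fst (\<omega> p)) (t - fst z))) \<partial>P)"
  (is "?L \<le> ennreal birth_rate * ?R")
proof -
  define \<beta> where "\<beta> y = (of_nat (births (fst (snd y)) (snd (snd y))) :: ennreal)" for y :: outcome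
  have [measurable]: "\<beta> \<in> borel_measurable outcome_space" unfolding \<beta>_def by measurable
  have bound: "?L \<le> ennreal birth_rate * ?R + ennreal (birth_rate * h)" if h: "0 < h" for h
  proof -
    define C where "C i = {z :: real \<times> config. real i * h \<le> fst z \<and> fst z < real (Suc i) * h}" for i
    \<comment> \<open>Time left until \<open>t\<close> after the left end of cell \<open>i\<close>.
      On the cell it is at least the true remaining time, so no birth is lost, and exceeds it by at
      most \<open>h\<close>.\<close>
    define a where "a i = t - real i * h" for i
    define F where "F i y = \<beta> y * indicator {..a i} (fst y)" for i and y :: outcome
    define F' where "F' i y = ennreal birth_rate * ennreal (min (fst y) (a i))" for i and y :: outcome
    have [measurable]: "(fst :: real \<times> config \<Rightarrow> real) \<in> borel_measurable borel"
      by (intro borel_measurable_continuous_onI continuous_intros)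
    have C_sets: "C i \<in> sets borel" for i unfolding C_def by measurable
    have F_meas: "F i \<in> borel_measurable outcome_space" "F' i \<in> borel_measurable outcome_space" for i
      unfolding F_def F'_def by measurable
    note [measurable] = C_sets F_meas
    have disj: "disjoint_family C"
    proof (unfold disjoint_family_on_def, safe)
      fix i j z assume "(i::nat) \<noteq> j" and z: "z \<in> C i" "z \<in> C j"
      have "i < Suc j" "j < Suc i"
      proof -
        have "real i * h < real (Suc j) * h" "real j * h < real (Suc i) * h" using z by (auto simp: C_def)
        then show "i < Suc j" "j < Suc i" using h by (auto simp del: of_nat_Suc)
      qed
      then show "z \<in> {}" using \<open>i \<noteq> j\<close> by simp
    qed
    have cell: "\<exists>i. z \<in> C i" if "0 \<le> fst z" for z
    proof
      have "real (nat \<lfloor>fst z / h\<rfloor>) = of_int \<lfloor>fst z / h\<rfloor>" using that h by (simp add: of_nat_nat)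
      then have "real (nat \<lfloor>fst z / h\<rfloor>) \<le> fst z / h" "fst z / h < real (nat \<lfloor>fst z / h\<rfloor>) + 1" by linarith+
      then show "z \<in> C (nat \<lfloor>fst z / h\<rfloor>)" using h by (auto simp: C_def field_simps)
    qed
    have "?L = (\<integral>\<^sup>+\<omega>. at_start x \<omega> p (\<lambda>z. \<beta> (\<omega> p) * indicator {..t} (fst z + fst (\<omega> p))) \<partial>P)"
      by (simp add: count_children \<beta>_def)
    also have "\<dots> \<le> (\<integral>\<^sup>+\<omega>. (\<Sum>i. at_start x \<omega> p (\<lambda>z. F i (\<omega> p) * indicator (C i) z)) \<partial>P)"
    proof (rule nn_integral_mono_AE)
      show "AE \<omega> in P. at_start x \<omega> p (\<lambda>z. \<beta> (\<omega> p) * indicator {..t} (fst z + fst (\<omega> p)))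
          \<le> (\<Sum>i. at_start x \<omega> p (\<lambda>z. F i (\<omega> p) * indicator (C i) z))"
        using AE_valid_start[of p]
      proof eventually_elim
        case (elim \<omega>)
        show ?case
        proof (cases "start x \<omega> p = None")
          case False
          then obtain i where i: "start0 x \<omega> p \<in> C i" using elim cell unfolding valid_start_def by blast
          have "\<beta> (\<omega> p) * indicator {..t} (fst (start0 x \<omega> p) + fst (\<omega> p)) \<le> F i (\<omega> p)"
            using i by (auto simp: F_def C_def a_def indicator_def)
          also have "\<dots> = (\<Sum>i. F i (\<omega> p) * indicator (C i) (start0 x \<omega> p))"
            by (rule suminf_cmult_indicator[OF disj i, symmetric])
          finally show ?thesis using False by (simp add: at_start_def del: not_None_eq)
        qed (simp add: at_start_def)
      qed
    qed
    also have "\<dots> = (\<Sum>i. \<integral>\<^sup>+\<omega>. at_start x \<omega> p (\<lambda>z. F i (\<omega> p) * indicator (C i) z) \<partial>P)"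
      by (rule nn_integral_suminf) measurable
    \<comment> \<open>Each cell has one fixed cap \<open>a i\<close>, so births and capped durations
      are compared there through \<open>law_mono\<close>.\<close>
    also have "\<dots> \<le> (\<Sum>i. \<integral>\<^sup>+\<omega>. at_start x \<omega> p (\<lambda>z. F' i (\<omega> p) * indicator (C i) z) \<partial>P)"
      unfolding F_def F'_def \<beta>_def using F_meas
      by (intro suminf_le law_mono[OF AE_valid_start] flight_expectation_births C_sets)
        (auto simp: F_def[abs_def] F'_def[abs_def] \<beta>_def)
    also have "\<dots> = (\<integral>\<^sup>+\<omega>. (\<Sum>i. at_start x \<omega> p (\<lambda>z. F' i (\<omega> p) * indicator (C i) z)) \<partial>P)"
      by (rule nn_integral_suminf[symmetric]) measurable
    also have "\<dots> \<le> (\<integral>\<^sup>+\<omega>. ennreal birth_rate * at_start x \<omega> p (\<lambda>z. ennreal (min (fst (\<omega> p)) (t - fst z))) + ennreal (birth_rate * h) \<partial>P)"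
    proof (rule nn_integral_mono_AE)
      show "AE \<omega> in P. (\<Sum>i. at_start x \<omega> p (\<lambda>z. F' i (\<omega> p) * indicator (C i) z))
        \<le> ennreal birth_rate * at_start x \<omega> p (\<lambda>z. ennreal (min (fst (\<omega> p)) (t - fst z))) + ennreal (birth_rate * h)"
        using AE_valid_start[of p]
      proof eventually_elim
        case (elim \<omega>)
        show ?case
        proof (cases "start x \<omega> p = None")
          case False
          then obtain i where i: "start0 x \<omega> p \<in> C i" using elim cell unfolding valid_start_def by blast
          define b where "b = fst (start0 x \<omega> p)"
          have "(\<Sum>i. F' i (\<omega> p) * indicator (C i) (start0 x \<omega> p)) = F' i (\<omega> p)"
            by (rule suminf_cmult_indicator[OF disj i])
          also have "\<dots> \<le> ennreal birth_rate * (ennreal (min (fst (\<omega> p)) (t - b)) + ennreal h)"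
          proof -
            \<comment> \<open>The maximum with 0 makes explicit the truncation performed by
              \<open>ennreal\<close>, so that splitting off \<open>h\<close> is legitimate even when
              the minimum is negative.\<close>
            have "ennreal (min (fst (\<omega> p)) (a i)) \<le> ennreal (max 0 (min (fst (\<omega> p)) (t - b)) + h)"
              using i h by (intro ennreal_leI) (auto simp: C_def a_def b_def algebra_simps)
            also have "\<dots> = ennreal (max 0 (min (fst (\<omega> p)) (t - b))) + ennreal h" using h by (intro ennreal_plus) auto
            also have "ennreal (max 0 (min (fst (\<omega> p)) (t - b))) = ennreal (min (fst (\<omega> p)) (t - b))"
              by (cases "0 \<le> min (fst (\<omega> p)) (t - b)") (auto simp: max_absorb1 max_absorb2 ennreal_neg)
            finally show ?thesis unfolding F'_def by (rule mult_left_mono) simp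
          qed
          finally show ?thesis using False h birth_rate_pos
            by (simp add: at_start_def b_def distrib_left ennreal_mult del: not_None_eq)
        qed (simp add: at_start_def)
      qed
    qed
    also have "\<dots> = ennreal birth_rate * ?R + ennreal (birth_rate * h)"
      using emeasure_space_1 by (subst nn_integral_add) (auto simp: nn_integral_cmult)
    finally show ?thesis .
  qed
  show ?thesis
  proof (rule ennreal_le_epsilon)
    fix e :: real assume "0 < e"
    then show "?L \<le> ennreal birth_rate * ?R + ennreal e"
      using bound[of "e / birth_rate"] birth_rate_pos by simp
  qed
qed

lemma measurable_in_flight [measurable]:
  "Measurable.pred (lborel \<Otimes>\<^sub>M P) (\<lambda>z. p \<in> in_flight x (snd z) (fst z))"
  "Measurable.pred P (\<lambda>\<omega>. p \<in> in_flight x \<omega> u)"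
  unfolding in_flight_iff by measurable

lemma measurable_started [measurable]:
  "Measurable.pred P (\<lambda>\<omega>. started x \<omega> p t)"
  unfolding started_def by measurable

text \<open>The part of a flight within \<open>[0, t]\<close> has as its duration the measure of the
  times \<open>u\<close> at which the flight is in progress; exchanging expectation and time
  integral then gives the bound.\<close>

lemma expected_children_le:
  "(\<integral>\<^sup>+\<omega>. (\<integral>\<^sup>+m. indicator {m. started x \<omega> (m # p) t} m \<partial>count_space UNIV) \<partial>P)
    \<le> ennreal birth_rate * (\<integral>\<^sup>+u\<in>{0..t}. (\<integral>\<^sup>+\<omega>. indicator (in_flight x \<omega> u) p \<partial>P) \<partial>lborel)"
proof -
  have m: "(\<lambda>(u, \<omega>). indicator (in_flight x \<omega> u) p * indicator {0..t} u :: ennreal) \<in> borel_measurable (lborel \<Otimes>\<^sub>M P)"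
  proof -
    have "(\<lambda>z. indicator {z. p \<in> in_flight x (snd z) (fst z)} z * indicator {0..t} (fst z) :: ennreal) \<in> borel_measurable (lborel \<Otimes>\<^sub>M P)"
      by measurable
    then show ?thesis by (simp add: case_prod_beta indicator_def)
  qed
  interpret LP: pair_sigma_finite lborel P ..
  have "(\<integral>\<^sup>+\<omega>. at_start x \<omega> p (\<lambda>z. ennreal (min (fst (\<omega> p)) (t - fst z))) \<partial>P)
      \<le> (\<integral>\<^sup>+\<omega>. (\<integral>\<^sup>+u. indicator (in_flight x \<omega> u) p * indicator {0..t} u \<partial>lborel) \<partial>P)"
  proof (rule nn_integral_mono_AE)
    show "AE \<omega> in P. at_start x \<omega> p (\<lambda>z. ennreal (min (fst (\<omega> p)) (t - fst z)))
        \<le> (\<integral>\<^sup>+u. indicator (in_flight x \<omega> u) p * indicator {0..t} u \<partial>lborel)"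
      using AE_valid_start[of p]
    proof eventually_elim
      case (elim \<omega>)
      show ?case
      proof (cases "start x \<omega> p = None")
        case False
        define b s where "b = fst (start0 x \<omega> p)" and "s = fst (\<omega> p)"
        have b: "0 \<le> b" using elim False by (simp add: valid_start_def b_def)
        \<comment> \<open>The flight is in progress on a half-open interval beginning at
          \<open>b \<ge> 0\<close>; cutting it at \<open>t\<close> keeps it inside
          \<open>[0, t]\<close>.\<close>
        have "ennreal (min s (t - b)) \<le> (\<integral>\<^sup>+u. indicator {b..<min (b + s) t} u \<partial>lborel)"
        proof (cases "b \<le> min (b + s) t")
          case True
          then have "(\<integral>\<^sup>+u. indicator {b..<min (b + s) t} u \<partial>lborel) = ennreal (min (b + s) t - b)" by simp
          also have "min (b + s) t - b = min s (t - b)" by (simp add: min_def)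
          finally show ?thesis by simp
        qed (auto simp: min_def ennreal_neg)
        also have "\<dots> \<le> (\<integral>\<^sup>+u. indicator (in_flight x \<omega> u) p * indicator {0..t} u \<partial>lborel)"
          using b False by (intro nn_integral_mono) (auto simp: indicator_def in_flight_iff b_def s_def)
        finally show ?thesis using False by (simp add: at_start_def b_def s_def del: not_None_eq)
      qed (simp add: at_start_def)
    qed
  qed
  also have "\<dots> = (\<integral>\<^sup>+u. (\<integral>\<^sup>+\<omega>. indicator (in_flight x \<omega> u) p * indicator {0..t} u \<partial>P) \<partial>lborel)"
    by (rule LP.Fubini'[OF m])
  also have "\<dots> = (\<integral>\<^sup>+u\<in>{0..t}. (\<integral>\<^sup>+\<omega>. indicator (in_flight x \<omega> u) p \<partial>P) \<partial>lborel)"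
    by (intro nn_integral_cong nn_integral_multc) (auto simp: indicator_def)
  finally show ?thesis
    using expected_children_le_lifetime[of p t] by (meson mult_left_mono order_trans zero_le)
qed

end

section \<open>Expected number of flights\<close>

lemma nn_integral_exponential:
  fixes a t :: real
  assumes "a \<noteq> 0" "0 \<le> t"
  shows "(\<integral>\<^sup>+u\<in>{0..t}. ennreal (exp (a * u)) \<partial>lborel) = ennreal ((exp (a * t) - 1) / a)"
proof -
  have "(\<integral>\<^sup>+u\<in>{0..t}. ennreal (exp (a * u)) \<partial>lborel) = ennreal (exp (a * t) / a - exp (a * 0) / a)"
    using assms by (intro nn_integral_FTC_Icc) (auto intro!: derivative_eq_intros simp: has_real_derivative_iff_has_vector_derivative[symmetric])
  then show ?thesis by (simp add: diff_divide_distrib)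
qed

lemma borel_measurable_nn_integral_addresses:
  fixes f :: "address \<Rightarrow> 'a \<Rightarrow> ennreal"
  assumes "\<And>p. f p \<in> borel_measurable M"
  shows "(\<lambda>\<omega>. \<integral>\<^sup>+p. f p \<omega> \<partial>count_space UNIV) \<in> borel_measurable M"
proof -
  have "bij_betw (from_nat_into UNIV) UNIV (UNIV :: address set)"
    by (rule bij_betw_from_nat_into[OF countable_addresses infinite_UNIV_listI])
  then have "(\<integral>\<^sup>+p. f p \<omega> \<partial>count_space UNIV) = (\<Sum>n. f (from_nat_into UNIV n) \<omega>)" for \<omega>
    using nn_integral_bij_count_space[symmetric, of "from_nat_into UNIV" UNIV UNIV "\<lambda>p. f p \<omega>"]
    by (simp add: nn_integral_count_space_nat)
  then show ?thesis using assms by simp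
qed

lemma nn_integral_count_space_le_UNIV:
  assumes "\<And>i. f i \<le> g i"
  shows "(\<integral>\<^sup>+i. f i \<partial>count_space A) \<le> (\<integral>\<^sup>+i. g i \<partial>count_space UNIV)"
proof -
  have "(\<integral>\<^sup>+i. f i \<partial>count_space A) = (\<integral>\<^sup>+i. f i * indicator A i \<partial>count_space UNIV)"
    by (rule nn_integral_count_space_indicator) (simp add: NO_MATCH_def)
  also have "\<dots> \<le> (\<integral>\<^sup>+i. g i \<partial>count_space UNIV)"
    using assms by (intro nn_integral_mono) (simp add: indicator_def)
  finally show ?thesis .
qed

section \<open>Counting flights and a pathwise bound on the cost\<close>

definition alive :: "config \<Rightarrow> history \<Rightarrow> real \<Rightarrow> ennreal" where
  "alive x \<omega> u = (\<integral>\<^sup>+p. indicator (in_flight x \<omega> u) p \<partial>count_space UNIV)"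

definition flights :: "config \<Rightarrow> history \<Rightarrow> real \<Rightarrow> ennreal" where
  "flights x \<omega> t = (\<integral>\<^sup>+p. indicator {p. started x \<omega> p t} p \<partial>count_space UNIV)"

text \<open>Links the count of flights in progress with \<open>psi Pr t (\<lambda>_. 1)\<close>, to
  which the spectral asymptotics apply.\<close>

lemma pair_X_1: "pair_X (\<lambda>_. 1) x \<omega> t = alive x \<omega> t"
proof -
  have "pair_X (\<lambda>_. 1) x \<omega> t = (\<integral>\<^sup>+p. 1 \<partial>count_space (in_flight x \<omega> t))"
    unfolding pair_X_def X_def by (subst nn_integral_distr) auto
  also have "\<dots> = (\<integral>\<^sup>+p. 1 * indicator (in_flight x \<omega> t) p \<partial>count_space UNIV)"
    by (rule nn_integral_count_space_indicator) simp
  finally show ?thesis by (simp add: alive_def)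
qed

lemma alive_le_flights: "alive x \<omega> u \<le> flights x \<omega> u"
  unfolding alive_def flights_def
  by (intro nn_integral_mono) (auto simp: indicator_def in_flight_iff started_def)

text \<open>A particle address is the root or begins with an \<open>Offs\<close> step, so the
  leading block of \<open>Scat\<close> steps and the particle can be read off from the address of a
  flight.\<close>

lemma inj_replicate_Scat: "inj_on (\<lambda>(u, i :: nat). replicate i Scat @ u) (particles \<times> UNIV)"
proof -
  have eq: "i = k \<and> u = w" if "replicate i Scat @ u = replicate k Scat @ w" "u \<in> particles" "w \<in> particles" for i k u w
    using that
  proof (induction i arbitrary: k)
    case 0
    then show ?case by (cases k) (auto simp: particles_def)
  next
    case (Suc i)
    then show ?case by (cases k) (auto simp: particles_def)
  qed
  show ?thesis
  proof (rule inj_onI)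
    fix z z' :: "address \<times> nat"
    assume "z \<in> particles \<times> UNIV" "z' \<in> particles \<times> UNIV"
      and "(case z of (u, i) \<Rightarrow> replicate i Scat @ u) = (case z' of (u, i) \<Rightarrow> replicate i Scat @ u)"
    then show "z = z'" using eq[of "snd z" "fst z" "snd z'" "fst z'"] by (simp add: case_prod_beta mem_Times_iff prod_eq_iff)
  qed
qed

text \<open>Births are counted at the first flights of particles and scatterings at their later
  flights, distinct pairs of particle and index giving distinct flights; each of the two sums is
  therefore at most the number of flights begun. Valid starts ensure that \<open>f\<close> and
  \<open>g\<close> are at most 1 where they are evaluated.\<close>

lemma C_cost_le_flights:
  assumes valid: "\<And>p. start x \<omega> p \<noteq> None \<Longrightarrow> snd (start0 x \<omega> p) \<in> phase S"
    and fg: "f \<in> unit_Linf_plus S" "g \<in> unit_Linf_plus S"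
  shows "C_cost f g x \<omega> t \<le> 2 * flights x \<omega> t"
proof -
  define H where "H p = (indicator {p. started x \<omega> p t} p :: ennreal)" for p
  let ?j = "\<lambda>(u, i :: nat). replicate i Scat @ u"
  have start_le: "ennreal (h (snd z)) * indicator {..t} (fst z) \<le> H p" if "start x \<omega> p = Some z" "h \<in> unit_Linf_plus S" for h p z
  proof -
    have z: "z = start0 x \<omega> p" using that(1) by (simp add: start0_def)
    have "h (snd z) \<le> 1" using valid[of p] that unfolding z by (auto simp: unit_Linf_plus_def simp del: mem_Sigma_iff)
    then have "ennreal (h (snd z)) \<le> 1" by (simp add: ennreal_le_1)
    moreover have "H p = (if fst (start0 x \<omega> p) \<le> t then 1 else 0)" using that(1) by (simp add: H_def started_def indicator_def del: not_None_eq)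
    ultimately show ?thesis unfolding z by (simp add: indicator_def)
  qed
  have "(\<integral>\<^sup>+u. (case start x \<omega> u of None \<Rightarrow> 0 | Some (b, y) \<Rightarrow> ennreal (g y) * indicator {..t} b) \<partial>count_space particles)
      \<le> (\<integral>\<^sup>+u. H u \<partial>count_space particles)"
    using start_le[OF _ fg(2)] by (intro nn_integral_mono) (force split: option.splits)
  also have "\<dots> \<le> (\<integral>\<^sup>+u. H u \<partial>count_space UNIV)"
    by (rule nn_integral_count_space_le_UNIV) simp
  finally have 1: "(\<integral>\<^sup>+u. (case start x \<omega> u of None \<Rightarrow> 0 | Some (b, y) \<Rightarrow> ennreal (g y) * indicator {..t} b) \<partial>count_space particles)
      \<le> flights x \<omega> t" by (simp add: flights_def H_def)
  have scat: "(case start x \<omega> u of None \<Rightarrow> 0 | Some (b, y) \<Rightarrow>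
          (case start x \<omega> (replicate i Scat @ u) of None \<Rightarrow> 0 | Some (s, z) \<Rightarrow>
             ennreal (f z) * indicator {..t} b * indicator {..t} s)) \<le> H (?j (u, i))" for u i
  proof -
    have "(case start x \<omega> u of None \<Rightarrow> 0 | Some (b, y) \<Rightarrow>
          (case start x \<omega> (replicate i Scat @ u) of None \<Rightarrow> 0 | Some (s, z) \<Rightarrow>
             ennreal (f z) * indicator {..t} b * indicator {..t} s))
        \<le> (case start x \<omega> (replicate i Scat @ u) of None \<Rightarrow> 0 | Some (s, z) \<Rightarrow> ennreal (f z) * indicator {..t} s)"
      by (auto split: option.splits simp: indicator_def)
    also have "\<dots> \<le> H (?j (u, i))"
      using start_le[OF _ fg(1), of "replicate i Scat @ u"] by (force split: option.splits)
    finally show ?thesis .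
  qed
  have "(\<integral>\<^sup>+u. (\<integral>\<^sup>+i. (case start x \<omega> u of None \<Rightarrow> 0 | Some (b, y) \<Rightarrow>
          (case start x \<omega> (replicate i Scat @ u) of None \<Rightarrow> 0 | Some (s, z) \<Rightarrow>
             ennreal (f z) * indicator {..t} b * indicator {..t} s)) \<partial>count_space {1..}) \<partial>count_space particles)
      \<le> (\<integral>\<^sup>+u. (\<integral>\<^sup>+i. H (?j (u, i)) \<partial>count_space UNIV) \<partial>count_space particles)"
  proof (rule nn_integral_mono)
    fix u
    show "(\<integral>\<^sup>+i. (case start x \<omega> u of None \<Rightarrow> 0 | Some (b, y) \<Rightarrow>
          (case start x \<omega> (replicate i Scat @ u) of None \<Rightarrow> 0 | Some (s, z) \<Rightarrow>
             ennreal (f z) * indicator {..t} b * indicator {..t} s)) \<partial>count_space {1..})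
       \<le> (\<integral>\<^sup>+i. H (?j (u, i)) \<partial>count_space UNIV)"
      by (rule nn_integral_count_space_le_UNIV) (rule scat)
  qed
  also have "\<dots> = (\<integral>\<^sup>+u. (\<integral>\<^sup>+i. H (?j (u, i)) \<partial>count_space UNIV) * indicator particles u \<partial>count_space UNIV)"
    by (rule nn_integral_count_space_indicator) (simp add: NO_MATCH_def)
  also have "\<dots> = (\<integral>\<^sup>+u. (\<integral>\<^sup>+i. H (?j (u, i)) * indicator (particles \<times> UNIV) (u, i) \<partial>count_space UNIV) \<partial>count_space UNIV)"
    by (intro nn_integral_cong) (simp add: indicator_def)
  also have "\<dots> = (\<integral>\<^sup>+z. H (?j z) * indicator (particles \<times> UNIV) z \<partial>count_space UNIV)"
    by (rule nn_integral_fst_count_space)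
  also have "\<dots> = (\<integral>\<^sup>+z. H (?j z) \<partial>count_space (particles \<times> UNIV))"
    by (rule nn_integral_count_space_indicator[symmetric]) (simp add: NO_MATCH_def)
  also have "\<dots> = (\<integral>\<^sup>+p. H p \<partial>count_space (?j ` (particles \<times> UNIV)))"
    by (rule nn_integral_bij_count_space) (simp add: bij_betw_def inj_replicate_Scat)
  also have "\<dots> \<le> (\<integral>\<^sup>+u. H u \<partial>count_space UNIV)"
    by (rule nn_integral_count_space_le_UNIV) simp
  finally show ?thesis unfolding C_cost_def
    using add_mono[OF 1] by (simp add: flights_def H_def mult_2)
qed

section \<open>Integral inequality and a priori bound\<close>

context neutron_process
begin

text \<open>The set \<open>L\<close> restricts the parents: all addresses give the inequality for
  the full count, addresses of bounded length the step from one generation to the next, and the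
  empty set the initial flight alone.\<close>

lemma expected_flights_le:
  "(\<integral>\<^sup>+\<omega>. (\<integral>\<^sup>+p. indicator {p. started x \<omega> p t} p * indicator (insert [] {m # p | m p. p \<in> L}) p \<partial>count_space UNIV) \<partial>P)
    \<le> 1 + ennreal birth_rate *
      (\<integral>\<^sup>+u\<in>{0..t}. (\<integral>\<^sup>+\<omega>. (\<integral>\<^sup>+p. indicator (in_flight x \<omega> u) p * indicator L p \<partial>count_space UNIV) \<partial>P) \<partial>lborel)"
proof -
  define I where "I p = (\<lambda>u. \<integral>\<^sup>+\<omega>. indicator (in_flight x \<omega> u) p \<partial>P)" for p
  have I_meas [measurable]: "I p \<in> borel_measurable borel" for p
  proof -
    have "(\<lambda>z. indicator {z. p \<in> in_flight x (snd z) (fst z)} z :: ennreal) \<in> borel_measurable (lborel \<Otimes>\<^sub>M P)"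
      by measurable
    then have "(\<lambda>(u, \<omega>). indicator (in_flight x \<omega> u) p :: ennreal) \<in> borel_measurable (lborel \<Otimes>\<^sub>M P)"
      by (simp add: case_prod_beta indicator_def)
    from borel_measurable_nn_integral[OF this] show ?thesis by (simp add: I_def)
  qed
  have ind_meas: "(\<lambda>\<omega>. indicator {p. started x \<omega> p t} p :: ennreal) \<in> borel_measurable P" for p
  proof -
    have "(\<lambda>\<omega>. indicator {\<omega>. started x \<omega> p t} \<omega> :: ennreal) \<in> borel_measurable P" by measurable
    then show ?thesis by (simp add: indicator_def)
  qed
  have fl_meas: "(\<lambda>\<omega>. indicator (in_flight x \<omega> u) p :: ennreal) \<in> borel_measurable P" for p u
  proof -
    have "(\<lambda>\<omega>. indicator {\<omega>. p \<in> in_flight x \<omega> u} \<omega> :: ennreal) \<in> borel_measurable P" by measurable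
    then show ?thesis by (simp add: indicator_def)
  qed
  define K where "K \<omega> p = (\<integral>\<^sup>+m. indicator {m. started x \<omega> (m # p) t} m \<partial>count_space (UNIV :: step set))" for \<omega> p
  have K_meas: "(\<lambda>\<omega>. K \<omega> p) \<in> borel_measurable P" for p
    unfolding K_def count_children by measurable
  have "(\<integral>\<^sup>+p. indicator {p. started x \<omega> p t} p * indicator (insert [] {m # p | m p. p \<in> L}) p \<partial>count_space UNIV)
      \<le> 1 + (\<integral>\<^sup>+p. K \<omega> p * indicator L p \<partial>count_space UNIV)" for \<omega>
  proof (subst nn_integral_address_Cons, rule add_mono)
    show "(\<integral>\<^sup>+p. (\<integral>\<^sup>+m. indicator {p. started x \<omega> p t} (m # p) * indicator (insert [] {m # p | m p. p \<in> L}) (m # p) \<partial>count_space UNIV) \<partial>count_space UNIV)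
        \<le> (\<integral>\<^sup>+p. K \<omega> p * indicator L p \<partial>count_space UNIV)"
    proof (rule nn_integral_mono)
      fix p :: address
      have "(\<integral>\<^sup>+m. indicator {p. started x \<omega> p t} (m # p) * indicator (insert [] {m # p | m p. p \<in> L}) (m # p) \<partial>count_space UNIV)
          = (\<integral>\<^sup>+m. indicator {m. started x \<omega> (m # p) t} m * indicator L p \<partial>count_space UNIV)"
        by (intro nn_integral_cong) (simp add: indicator_def)
      also have "\<dots> = K \<omega> p * indicator L p" unfolding K_def by (rule nn_integral_multc) simp
      finally show "(\<integral>\<^sup>+m. indicator {p. started x \<omega> p t} (m # p) * indicator (insert [] {m # p | m p. p \<in> L}) (m # p) \<partial>count_space UNIV)
          \<le> K \<omega> p * indicator L p" by simp
    qed
  qed (simp add: indicator_def)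
  then have "(\<integral>\<^sup>+\<omega>. (\<integral>\<^sup>+p. indicator {p. started x \<omega> p t} p * indicator (insert [] {m # p | m p. p \<in> L}) p \<partial>count_space UNIV) \<partial>P)
      \<le> (\<integral>\<^sup>+\<omega>. 1 + (\<integral>\<^sup>+p. K \<omega> p * indicator L p \<partial>count_space UNIV) \<partial>P)"
    by (intro nn_integral_mono)
  also have "\<dots> = 1 + (\<integral>\<^sup>+\<omega>. (\<integral>\<^sup>+p. K \<omega> p * indicator L p \<partial>count_space UNIV) \<partial>P)"
    using emeasure_space_1 K_meas
    by (subst nn_integral_add)
      (auto intro!: borel_measurable_nn_integral_addresses)
  \<comment> \<open>Terms are non-negative and addresses countable, so the sum commutes with the
    expectation and, further below, with the time integral.\<close>
  also have "(\<integral>\<^sup>+\<omega>. (\<integral>\<^sup>+p. K \<omega> p * indicator L p \<partial>count_space UNIV) \<partial>P)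
      = (\<integral>\<^sup>+p. (\<integral>\<^sup>+\<omega>. K \<omega> p * indicator L p \<partial>P) \<partial>count_space UNIV)"
    using K_meas by (intro nn_integral_count_space_nn_integral countable_addresses) simp
  also have "\<dots> \<le> (\<integral>\<^sup>+p. ennreal birth_rate * (\<integral>\<^sup>+u. I p u * indicator L p * indicator {0..t} u \<partial>lborel) \<partial>count_space UNIV)"
  proof (rule nn_integral_mono)
    fix p :: address
    have "(\<integral>\<^sup>+\<omega>. K \<omega> p * indicator L p \<partial>P) = (\<integral>\<^sup>+\<omega>. K \<omega> p \<partial>P) * indicator L p"
      by (rule nn_integral_multc[OF K_meas])
    also have "\<dots> \<le> ennreal birth_rate * (\<integral>\<^sup>+u. I p u * indicator {0..t} u \<partial>lborel) * indicator L p"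
      unfolding K_def I_def by (intro mult_right_mono expected_children_le) simp
    also have "\<dots> = ennreal birth_rate * (\<integral>\<^sup>+u. I p u * indicator L p * indicator {0..t} u \<partial>lborel)"
      by (simp add: indicator_def)
    finally show "(\<integral>\<^sup>+\<omega>. K \<omega> p * indicator L p \<partial>P) \<le> ennreal birth_rate * (\<integral>\<^sup>+u. I p u * indicator L p * indicator {0..t} u \<partial>lborel)" .
  qed
  also have "\<dots> = ennreal birth_rate * (\<integral>\<^sup>+p. (\<integral>\<^sup>+u. I p u * indicator L p * indicator {0..t} u \<partial>lborel) \<partial>count_space UNIV)"
    by (rule nn_integral_cmult) simp
  also have "(\<integral>\<^sup>+p. (\<integral>\<^sup>+u. I p u * indicator L p * indicator {0..t} u \<partial>lborel) \<partial>count_space UNIV)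
      = (\<integral>\<^sup>+u. (\<integral>\<^sup>+p. I p u * indicator L p * indicator {0..t} u \<partial>count_space UNIV) \<partial>lborel)"
    by (intro nn_integral_count_space_nn_integral[symmetric] countable_addresses) measurable
  also have "\<dots> = (\<integral>\<^sup>+u\<in>{0..t}. (\<integral>\<^sup>+\<omega>. (\<integral>\<^sup>+p. indicator (in_flight x \<omega> u) p * indicator L p \<partial>count_space UNIV) \<partial>P) \<partial>lborel)"
  proof (rule nn_integral_cong)
    fix u
    have "(\<integral>\<^sup>+p. I p u * indicator L p * indicator {0..t} u \<partial>count_space UNIV)
        = (\<integral>\<^sup>+p. I p u * indicator L p \<partial>count_space UNIV) * indicator {0..t} u"
      by (rule nn_integral_multc) simp
    also have "(\<integral>\<^sup>+p. I p u * indicator L p \<partial>count_space UNIV)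
        = (\<integral>\<^sup>+p. (\<integral>\<^sup>+\<omega>. indicator (in_flight x \<omega> u) p * indicator L p \<partial>P) \<partial>count_space UNIV)"
      unfolding I_def by (intro nn_integral_cong nn_integral_multc[symmetric] fl_meas)
    also have "\<dots> = (\<integral>\<^sup>+\<omega>. (\<integral>\<^sup>+p. indicator (in_flight x \<omega> u) p * indicator L p \<partial>count_space UNIV) \<partial>P)"
      using fl_meas by (intro nn_integral_count_space_nn_integral[symmetric] countable_addresses) simp
    finally show "(\<integral>\<^sup>+p. I p u * indicator L p * indicator {0..t} u \<partial>count_space UNIV)
        = (\<integral>\<^sup>+\<omega>. (\<integral>\<^sup>+p. indicator (in_flight x \<omega> u) p * indicator L p \<partial>count_space UNIV) \<partial>P) * indicator {0..t} u" .
  qed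
  finally show ?thesis by (simp add: add_left_mono)
qed

lemma expected_flights_le_integral_alive:
  "(\<integral>\<^sup>+\<omega>. flights x \<omega> t \<partial>P) \<le> 1 + ennreal birth_rate * (\<integral>\<^sup>+u\<in>{0..t}. (\<integral>\<^sup>+\<omega>. alive x \<omega> u \<partial>P) \<partial>lborel)"
proof -
  have "insert [] {m # p | m p. p \<in> (UNIV :: address set)} = UNIV"
    using neq_Nil_conv by auto
  then show ?thesis using expected_flights_le[of t UNIV] by (simp add: flights_def alive_def)
qed

text \<open>With \<open>c = birth_rate\<close>, the function \<open>exp (c * t)\<close> equals 1
  plus \<open>c\<close> times its own integral over \<open>[0, t]\<close>. Each generation level
  thus hands the same bound to the next, and monotone convergence removes the truncation.\<close>

lemma expected_flights_exp_bound:
  assumes "0 \<le> t"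
  shows "(\<integral>\<^sup>+\<omega>. flights x \<omega> t \<partial>P) \<le> ennreal (exp (birth_rate * t))"
proof -
  define T where "T n t \<omega> = (\<integral>\<^sup>+p. indicator {p. started x \<omega> p t} p * indicator {p. length p \<le> n} p \<partial>count_space UNIV)" for n t \<omega>
  have T_meas: "T n t \<in> borel_measurable P" for n t
    unfolding T_def
  proof (rule borel_measurable_nn_integral_addresses)
    fix p :: address
    have "(\<lambda>\<omega>. indicator {\<omega>. started x \<omega> p t} \<omega> * indicator {p. length p \<le> n} p :: ennreal) \<in> borel_measurable P"
      by measurable
    then show "(\<lambda>\<omega>. indicator {p. started x \<omega> p t} p * indicator {p. length p \<le> n} p :: ennreal) \<in> borel_measurable P"
      by (simp add: indicator_def)
  qed
  have T_le: "(\<integral>\<^sup>+\<omega>. T n t \<omega> \<partial>P) \<le> ennreal (exp (birth_rate * t))" if "0 \<le> t" for n t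
    using that
  proof (induction n arbitrary: t)
    case 0
    have "insert [] {m # p | m p. p \<in> {}} = {p :: address. length p \<le> 0}" by auto
    then have "(\<integral>\<^sup>+\<omega>. T 0 t \<omega> \<partial>P) \<le> 1" using expected_flights_le[of t "{}"] by (simp add: T_def)
    also have "1 \<le> ennreal (exp (birth_rate * t))" using 0 birth_rate_pos by (simp add: one_le_exp_iff flip: ennreal_1)
    finally show ?case .
  next
    case (Suc n)
    have c: "0 < birth_rate" by (rule birth_rate_pos)
    have "insert [] {m # p | m p. p \<in> {p :: address. length p \<le> n}} = {p. length p \<le> Suc n}"
    proof (rule set_eqI)
      fix q :: address show "q \<in> insert [] {m # p | m p. p \<in> {p :: address. length p \<le> n}} \<longleftrightarrow> q \<in> {p. length p \<le> Suc n}"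
        by (cases q) auto
    qed
    then have "(\<integral>\<^sup>+\<omega>. T (Suc n) t \<omega> \<partial>P) \<le> 1 + ennreal birth_rate *
        (\<integral>\<^sup>+u\<in>{0..t}. (\<integral>\<^sup>+\<omega>. (\<integral>\<^sup>+p. indicator (in_flight x \<omega> u) p * indicator {p. length p \<le> n} p \<partial>count_space UNIV) \<partial>P) \<partial>lborel)"
      using expected_flights_le[of t "{p. length p \<le> n}"] by (simp add: T_def)
    also have "\<dots> \<le> 1 + ennreal birth_rate * (\<integral>\<^sup>+u\<in>{0..t}. ennreal (exp (birth_rate * u)) \<partial>lborel)"
    proof (intro add_left_mono mult_left_mono nn_integral_mono)
      fix u
      \<comment> \<open>A flight in progress at time \<open>u\<close> has begun by \<open>u\<close>,
        which closes the recursion within one truncation level.\<close>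
      have "(\<integral>\<^sup>+\<omega>. (\<integral>\<^sup>+p. indicator (in_flight x \<omega> u) p * indicator {p. length p \<le> n} p \<partial>count_space UNIV) \<partial>P)
          \<le> (\<integral>\<^sup>+\<omega>. T n u \<omega> \<partial>P)"
        unfolding T_def by (intro nn_integral_mono) (auto simp: indicator_def in_flight_iff started_def)
      also have "\<dots> \<le> ennreal (exp (birth_rate * u))" if "0 \<le> u" using Suc.IH[OF that] .
      finally show "(\<integral>\<^sup>+\<omega>. (\<integral>\<^sup>+p. indicator (in_flight x \<omega> u) p * indicator {p. length p \<le> n} p \<partial>count_space UNIV) \<partial>P) * indicator {0..t} u
          \<le> ennreal (exp (birth_rate * u)) * indicator {0..t} u"
        by (auto simp: indicator_def)
    qed auto
    also have "\<dots> = 1 + ennreal birth_rate * ennreal ((exp (birth_rate * t) - 1) / birth_rate)"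
      using c Suc.prems by (subst nn_integral_exponential) auto
    also have "\<dots> = ennreal 1 + ennreal (exp (birth_rate * t) - 1)"
      using c Suc.prems by (simp flip: ennreal_mult)
    also have "\<dots> = ennreal (exp (birth_rate * t))"
      using c Suc.prems by (subst ennreal_plus[symmetric]) auto
    finally show ?case .
  qed
  have "flights x \<omega> t = (SUP n. T n t \<omega>)" for \<omega>
  proof -
    have "flights x \<omega> t = (\<integral>\<^sup>+p. (SUP n. indicator {p. started x \<omega> p t} p * indicator {p. length p \<le> n} p) \<partial>count_space UNIV)"
      unfolding flights_def
    proof (rule nn_integral_cong)
      fix p :: address
      have "indicator {p. started x \<omega> p t} p \<le> (SUP n. indicator {p. started x \<omega> p t} p * indicator {p. length p \<le> n} p :: ennreal)"
        by (rule SUP_upper2[of "length p"]) auto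
      moreover have "(SUP n. indicator {p. started x \<omega> p t} p * indicator {p. length p \<le> n} p :: ennreal) \<le> indicator {p. started x \<omega> p t} p"
        by (rule SUP_least) (auto simp: indicator_def)
      ultimately show "indicator {p. started x \<omega> p t} p = (SUP n. indicator {p. started x \<omega> p t} p * indicator {p. length p \<le> n} p :: ennreal)"
        by (rule antisym)
    qed
    also have "\<dots> = (SUP n. T n t \<omega>)"
      unfolding T_def by (rule nn_integral_monotone_convergence_SUP) (auto simp: incseq_def le_fun_def indicator_def)
    finally show ?thesis .
  qed
  then have "(\<integral>\<^sup>+\<omega>. flights x \<omega> t \<partial>P) = (\<integral>\<^sup>+\<omega>. (SUP n. T n t \<omega>) \<partial>P)" by simp
  also have "\<dots> = (SUP n. \<integral>\<^sup>+\<omega>. T n t \<omega> \<partial>P)"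
  proof (rule nn_integral_monotone_convergence_SUP[OF _ T_meas])
    show "incseq (\<lambda>n. T n t)"
      unfolding T_def incseq_def le_fun_def by (auto intro!: nn_integral_mono simp: indicator_def)
  qed
  also have "\<dots> \<le> ennreal (exp (birth_rate * t))" by (rule SUP_least) (rule T_le[OF assms])
  finally show ?thesis .
qed

lemma borel_measurable_flights: "(\<lambda>\<omega>. flights x \<omega> t) \<in> borel_measurable P"
  unfolding flights_def
proof (rule borel_measurable_nn_integral_addresses)
  fix p :: address
  have "(\<lambda>\<omega>. indicator {\<omega>. started x \<omega> p t} \<omega> :: ennreal) \<in> borel_measurable P" by measurable
  then show "(\<lambda>\<omega>. indicator {p. started x \<omega> p t} p :: ennreal) \<in> borel_measurable P" by (simp add: indicator_def)
qed

text \<open>The supremum in \<open>Cost\<close> runs over an uncountable family of test functions.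
  The bound holds on one almost sure event common to all of them, so that it suffices to integrate
  the measurable count of flights.\<close>

lemma AE_Cost_le_flights: "AE \<omega> in P. Cost S x \<omega> k t \<le> of_nat k * (2 * flights x \<omega> t)"
proof -
  have "AE \<omega> in P. \<forall>p. valid_start \<omega> p"
    using AE_ball_countable'[where I = UNIV and M = P and P = "\<lambda>p \<omega>. valid_start \<omega> p"]
      AE_valid_start countable_addresses by simp
  then show ?thesis
  proof eventually_elim
    case (elim \<omega>)
    show ?case unfolding Cost_def
    proof (intro mult_left_mono SUP_least)
      fix fg assume "fg \<in> unit_Linf_plus S \<times> unit_Linf_plus S"
      then show "(case fg of (f, g) \<Rightarrow> C_cost f g x \<omega> t) \<le> 2 * flights x \<omega> t"
        using elim by (cases fg) (auto simp: valid_start_def simp del: mem_Sigma_iff intro!: C_cost_le_flights)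
    qed simp
  qed
qed

end

lemma one_in_unit_Linf_plus: "(\<lambda>_. 1) \<in> unit_Linf_plus S"
  by (auto simp: unit_Linf_plus_def Linf_plus_def)

section \<open>Growth of the expected cost from the spectral asymptotics\<close>

context neutron_process
begin

text \<open>\<open>psi\<close> is real-valued and reports an infinite expectation as 0, so the
  asymptotics yield a bound only once the expectation is known to be finite. They concern large
  times; the a priori bound covers the initial interval.\<close>

lemma expected_alive_exponential:
  assumes eig: "eigen_triple S Pr lam phi phit" and P: "Pr x = P"
  shows "\<exists>C>0. \<forall>u\<ge>0. (\<integral>\<^sup>+\<omega>. alive x \<omega> u \<partial>P) \<le> ennreal (C * exp (lam * u))"
proof -
  have phi: "0 < phi x" using eig x by (auto simp: eigen_triple_def simp del: mem_Sigma_iff)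
  obtain eps K T where eps: "0 < eps" and conv: "\<And>t. t \<ge> T \<Longrightarrow>
      \<bar>exp (- lam * t) * inverse (phi x) * psi Pr t (\<lambda>_. 1) x - inner_DV S phit (\<lambda>_. 1)\<bar> \<le> K * exp (- eps * t)"
    using eig x one_in_unit_Linf_plus[of S] unfolding eigen_triple_def by blast
  have fin: "(\<integral>\<^sup>+\<omega>. alive x \<omega> u \<partial>P) \<le> ennreal (exp (birth_rate * u))" if "0 \<le> u" for u
    using expected_flights_exp_bound[OF that] by (meson alive_le_flights nn_integral_mono order_trans)
  define I where "I = inner_DV S phit (\<lambda>_. 1)"
  define C1 where "C1 = phi x * (\<bar>I\<bar> + \<bar>K\<bar>)"
  define T' where "T' = max 0 T"
  \<comment> \<open>The first factor bounds the growth up to \<open>T'\<close>, the second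
    compensates for \<open>exp (lam * u)\<close> being small when \<open>lam < 0\<close>.\<close>
  define C2 where "C2 = exp (birth_rate * T') * exp (\<bar>lam\<bar> * T')"
  have C: "0 \<le> C1" "0 < C2" using phi by (auto simp: C1_def C2_def)
  have "(\<integral>\<^sup>+\<omega>. alive x \<omega> u \<partial>P) \<le> ennreal ((C1 + C2) * exp (lam * u))" if u: "0 \<le> u" for u
  proof (cases "T \<le> u")
    case True
    define q where "q = psi Pr u (\<lambda>_. 1) x"
    have "exp (- lam * u) * inverse (phi x) * q \<le> I + K * exp (- eps * u)"
      using conv[OF True] unfolding I_def q_def by linarith
    also have "K * exp (- eps * u) \<le> \<bar>K\<bar> * 1" using eps u by (intro mult_mono) auto
    finally have "exp (- lam * u) * inverse (phi x) * q \<le> \<bar>I\<bar> + \<bar>K\<bar>" by linarith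
    then have "(exp (lam * u) * phi x) * (exp (- lam * u) * inverse (phi x) * q) \<le> (exp (lam * u) * phi x) * (\<bar>I\<bar> + \<bar>K\<bar>)"
      using phi by (intro mult_left_mono) auto
    moreover have "(exp (lam * u) * phi x) * (exp (- lam * u) * inverse (phi x) * q) = q"
      using phi by (simp add: exp_minus field_simps)
    ultimately have "q \<le> (exp (lam * u) * phi x) * (\<bar>I\<bar> + \<bar>K\<bar>)" by (simp only:)
    then have "q \<le> C1 * exp (lam * u)" by (simp only: C1_def ac_simps)
    also have "\<dots> \<le> (C1 + C2) * exp (lam * u)" using C by (intro mult_right_mono) auto
    finally have q: "q \<le> (C1 + C2) * exp (lam * u)" .
    have "(\<integral>\<^sup>+\<omega>. alive x \<omega> u \<partial>P) < \<top>" using fin[OF u] by (rule le_less_trans) simp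
    then have "(\<integral>\<^sup>+\<omega>. alive x \<omega> u \<partial>P) = ennreal q"
      unfolding q_def psi_def P pair_X_1 by simp
    then show ?thesis using q by (simp add: ennreal_leI)
  next
    case False
    then have u': "u \<le> T'" by (simp add: T'_def)
    have "birth_rate * u \<le> birth_rate * T'" using u' birth_rate_pos by simp
    moreover have "- (lam * u) \<le> \<bar>lam\<bar> * T'"
      using mult_mono[of "\<bar>lam\<bar>" "\<bar>lam\<bar>" u T'] u u' abs_ge_minus_self[of "lam * u"] by (simp add: abs_mult)
    ultimately have "exp (birth_rate * u) \<le> C2 * exp (lam * u)"
      unfolding C2_def by (simp flip: exp_add)
    also have "\<dots> \<le> (C1 + C2) * exp (lam * u)" using C by (intro mult_right_mono) auto
    finally show ?thesis using fin[OF u] by (meson ennreal_leI order_trans)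
  qed
  then show ?thesis using C by (intro exI[of _ "C1 + C2"]) auto
qed

lemma mean_Cost_le:
  assumes eig: "eigen_triple S Pr lam phi phit" and P: "Pr x = P"
  shows "\<exists>C>0. \<forall>k t. 0 \<le> t \<longrightarrow> mean_Cost S Pr x k t
    \<le> ennreal (C * real k * (if lam = 0 then 1 + t else if lam > 0 then exp (lam * t) else 1))"
proof -
  obtain C where C: "0 < C" and al: "\<And>u. 0 \<le> u \<Longrightarrow> (\<integral>\<^sup>+\<omega>. alive x \<omega> u \<partial>P) \<le> ennreal (C * exp (lam * u))"
    using expected_alive_exponential[OF eig P] by blast
  define g where "g t = (if lam = 0 then 1 + t else if lam > 0 then exp (lam * t) else 1)" for t
  \<comment> \<open>The integral of \<open>exp (lam * u)\<close> over \<open>[0, t]\<close>.\<close>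
  define J where "J t = (if lam = 0 then t else (exp (lam * t) - 1) / lam)" for t
  define c where "c = birth_rate * C"
  \<comment> \<open>The summand \<open>1 + c\<close> covers the initial flight and the linear growth
    at \<open>lam = 0\<close>; \<open>c / \<bar>lam\<bar>\<close> covers the integrated exponential
    otherwise.\<close>
  define D where "D = 1 + c + (if lam = 0 then 0 else c / \<bar>lam\<bar>)"
  have c: "0 < c" using C birth_rate_pos by (simp add: c_def)
  have D: "0 < D" using c by (simp add: D_def add_pos_nonneg)
  have J0: "0 \<le> J t" if "0 \<le> t" for t
  proof -
    consider "lam = 0" | "lam > 0" | "lam < 0" by linarith
    then show ?thesis
      using that by cases (auto simp: J_def divide_nonpos_neg mult_nonpos_nonneg)
  qed
  have JD: "1 + c * J t \<le> D * g t" if t: "0 \<le> t" for t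
  proof -
    consider "lam = 0" | "lam > 0" | "lam < 0" by linarith
    then show ?thesis
    proof cases
      case 1
      then show ?thesis using c t by (simp add: J_def g_def D_def algebra_simps)
    next
      case 2
      have e: "1 \<le> exp (lam * t)" using 2 t by simp
      have "c * J t \<le> c / lam * exp (lam * t)" using 2 c by (simp add: J_def field_simps)
      moreover have "1 * 1 \<le> (1 + c) * exp (lam * t)" using e c by (intro mult_mono) auto
      moreover have "D * g t = (1 + c) * exp (lam * t) + c / lam * exp (lam * t)" using 2 by (simp add: D_def g_def distrib_right)
      ultimately show ?thesis by linarith
    next
      case 3
      have "J t \<le> 1 / \<bar>lam\<bar>" using 3 by (simp add: J_def field_simps mult_nonpos_nonneg)
      then have "c * J t \<le> c * (1 / \<bar>lam\<bar>)" using c by (intro mult_left_mono) auto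
      then show ?thesis using 3 c by (simp add: D_def g_def)
    qed
  qed
  have "mean_Cost S Pr x k t \<le> ennreal (2 * D * real k * g t)" if t: "0 \<le> t" for k t
  proof -
    have "(\<integral>\<^sup>+u\<in>{0..t}. (\<integral>\<^sup>+\<omega>. alive x \<omega> u \<partial>P) \<partial>lborel) \<le> (\<integral>\<^sup>+u. ennreal C * (ennreal (exp (lam * u)) * indicator {0..t} u) \<partial>lborel)"
      using al C by (intro nn_integral_mono) (auto simp: indicator_def ennreal_mult)
    also have "\<dots> = ennreal C * (\<integral>\<^sup>+u\<in>{0..t}. ennreal (exp (lam * u)) \<partial>lborel)"
      by (rule nn_integral_cmult) measurable
    also have "(\<integral>\<^sup>+u\<in>{0..t}. ennreal (exp (lam * u)) \<partial>lborel) = ennreal (J t)"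
      using t nn_integral_exponential[of lam t] by (cases "lam = 0") (auto simp: J_def)
    finally have I: "(\<integral>\<^sup>+u\<in>{0..t}. (\<integral>\<^sup>+\<omega>. alive x \<omega> u \<partial>P) \<partial>lborel) \<le> ennreal (C * J t)"
      using C J0[OF t] by (simp add: ennreal_mult)
    have "(\<integral>\<^sup>+\<omega>. flights x \<omega> t \<partial>P) \<le> 1 + ennreal birth_rate * ennreal (C * J t)"
      using I by (intro order_trans[OF expected_flights_le_integral_alive] add_left_mono mult_left_mono) auto
    also have "\<dots> = ennreal (1 + c * J t)"
      using birth_rate_pos C J0[OF t] by (simp add: c_def mult.assoc flip: ennreal_mult)
    also have "\<dots> \<le> ennreal (D * g t)" by (rule ennreal_leI[OF JD[OF t]])
    finally have F: "(\<integral>\<^sup>+\<omega>. flights x \<omega> t \<partial>P) \<le> ennreal (D * g t)" .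
    have g0: "0 \<le> g t" using t by (auto simp: g_def)
    have "mean_Cost S Pr x k t \<le> (\<integral>\<^sup>+\<omega>. of_nat k * (2 * flights x \<omega> t) \<partial>P)"
      unfolding mean_Cost_def P by (rule nn_integral_mono_AE[OF AE_Cost_le_flights])
    also have "\<dots> = of_nat k * (2 * (\<integral>\<^sup>+\<omega>. flights x \<omega> t \<partial>P))"
      using borel_measurable_flights by (simp add: nn_integral_cmult)
    also have "\<dots> \<le> of_nat k * (2 * ennreal (D * g t))" using F by (intro mult_left_mono) auto
    also have "\<dots> = ennreal (2 * D * real k * g t)"
      using D g0 by (simp add: ennreal_of_nat_eq_real_of_nat ennreal_mult ac_simps flip: ennreal_numeral)
    finally show ?thesis .
  qed
  then show ?thesis using D by (intro exI[of _ "2 * D"]) (auto simp: g_def)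
qed

end

section \<open>Optimisation\<close>

text \<open>Together with \<open>cost_weight\<close> this isolates the dependence on
  \<open>k\<close>: the error bound is a variance term inversely proportional to \<open>k\<close>
  plus the bias \<open>\<kappa> 0 / t^2\<close>, and the cost is proportional to
  \<open>k\<close>.\<close>

definition variance_factor :: "real \<Rightarrow> (nat \<Rightarrow> real) \<Rightarrow> real \<Rightarrow> real" where
  "variance_factor lam \<kappa> t =
     (if lam = 0 then \<kappa> 1 * t else if lam > 0 then \<kappa> 2 else \<kappa> 3 * exp (- lam * t))"

definition cost_weight :: "real \<Rightarrow> real \<Rightarrow> real" where
  "cost_weight lam t = (if lam = 0 then t else if lam > 0 then exp (lam * t) else 1)"

lemma error_bound_eq: "error_bound lam \<kappa> t k = variance_factor lam \<kappa> t / k + \<kappa> 0 / t\<^sup>2"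
  by (simp add: error_bound_def variance_factor_def)

lemma cost_order_eq: "cost_order lam t k = cost_weight lam t * k"
  by (simp add: cost_order_def cost_weight_def)

text \<open>For fixed \<open>t\<close> the constraint is active at the optimal \<open>k\<close>, which leaves a minimisation over
  \<open>t\<close> alone.\<close>
lemma optimal_choice_iff:
  fixes \<kappa> :: "nat \<Rightarrow> real" and lam \<epsilon> c :: real
  defines "\<delta> \<equiv> \<lambda>t. \<epsilon>\<^sup>2 - \<kappa> 0 / t\<^sup>2"
    and "J \<equiv> \<lambda>t. cost_weight lam t * variance_factor lam \<kappa> t / (\<epsilon>\<^sup>2 - \<kappa> 0 / t\<^sup>2)"
  assumes pos: "\<And>i. i \<le> 3 \<Longrightarrow> 0 < \<kappa> i"
    and c: "0 < c" "0 < \<delta> c"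
    and min: "\<And>t. 0 < t \<Longrightarrow> 0 < \<delta> t \<Longrightarrow> t \<noteq> c \<Longrightarrow> J c < J t"
  shows "optimal_choice lam \<kappa> \<epsilon> t k \<longleftrightarrow> t = c \<and> k = variance_factor lam \<kappa> c / \<delta> c"
proof -
  define A where "A = variance_factor lam \<kappa>"
  define W where "W = cost_weight lam"
  define feas where "feas t k \<longleftrightarrow> 0 < t \<and> 0 < k \<and> error_bound lam \<kappa> t k \<le> \<epsilon>\<^sup>2" for t k
  have A: "0 < A t" if "0 < t" for t
    using pos[of 1] pos[of 2] pos[of 3] that by (auto simp: A_def variance_factor_def)
  have W: "0 < W t" if "0 < t" for t
    using that by (auto simp: W_def cost_weight_def)
  have feas_iff: "feas t k \<longleftrightarrow> 0 < t \<and> 0 < \<delta> t \<and> A t / \<delta> t \<le> k" for t k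
  proof (cases "0 < t")
    case True
    \<comment> \<open>A time is usable only if the bias leaves room, \<open>\<delta> t > 0\<close>;
      the room then bounds \<open>k\<close> from below.\<close>
    have "0 < k \<and> A t / k + \<kappa> 0 / t\<^sup>2 \<le> \<epsilon>\<^sup>2 \<longleftrightarrow> 0 < \<delta> t \<and> A t / \<delta> t \<le> k"
    proof safe
      assume k: "0 < k" and le: "A t / k + \<kappa> 0 / t\<^sup>2 \<le> \<epsilon>\<^sup>2"
      have "0 < A t / k" using k A[OF True] by simp
      then show d: "0 < \<delta> t" using le unfolding \<delta>_def by linarith
      have "A t / k \<le> \<delta> t" using le unfolding \<delta>_def by linarith
      then show "A t / \<delta> t \<le> k" using k d by (simp add: field_simps)
    next
      assume d: "0 < \<delta> t" and le: "A t / \<delta> t \<le> k"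
      have "0 < A t / \<delta> t" using d A[OF True] by simp
      then show k: "0 < k" using le by linarith
      have "A t / k \<le> \<delta> t" using k d le by (simp add: field_simps)
      then show "A t / k + \<kappa> 0 / t\<^sup>2 \<le> \<epsilon>\<^sup>2" unfolding \<delta>_def by linarith
    qed
    then show ?thesis using True by (simp add: feas_def error_bound_eq A_def)
  qed (simp add: feas_def)
  have J_eq: "J t = W t * (A t / \<delta> t)" for t by (simp add: J_def A_def W_def \<delta>_def)
  have opt: "optimal_choice lam \<kappa> \<epsilon> t k \<longleftrightarrow>
      feas t k \<and> (\<forall>t' k'. feas t' k' \<longrightarrow> W t * k \<le> W t' * k')" for t k
    unfolding optimal_choice_def is_arg_min_def feas_def cost_order_eq W_def
    by (simp add: split_paired_all not_less) (meson not_less)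
  have lower: "J c \<le> W t * k" if "feas t k" for t k
  proof -
    have "J t \<le> W t * k"
      using that W[of t] unfolding feas_iff J_eq by (intro mult_left_mono) auto
    moreover have "J c \<le> J t" using min[of t] that by (cases "t = c") (auto simp: feas_iff)
    ultimately show ?thesis by linarith
  qed
  have fc: "feas c (A c / \<delta> c)" using c by (simp add: feas_iff)
  show ?thesis unfolding A_def[symmetric]
  proof
    assume "t = c \<and> k = A c / \<delta> c"
    then show "optimal_choice lam \<kappa> \<epsilon> t k" using lower fc by (simp add: opt J_eq)
  next
    assume "optimal_choice lam \<kappa> \<epsilon> t k"
    then have f: "feas t k" and "W t * k \<le> W c * (A c / \<delta> c)" using fc unfolding opt by blast+
    then have le: "W t * k \<le> J c" by (simp add: J_eq)
    have t: "0 < t" "0 < \<delta> t" "A t / \<delta> t \<le> k" using f by (auto simp: feas_iff)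
    have Jt: "J t \<le> W t * k" unfolding J_eq using t W[of t] by (intro mult_left_mono) auto
    \<comment> \<open>Strictness of the minimum over times forces the time, after which
      \<open>k\<close> is squeezed onto the active constraint.\<close>
    then have tc: "t = c" using min[of t] t le by linarith
    then have "W c * k \<le> W c * (A c / \<delta> c)" using le by (simp add: J_eq)
    then have "k \<le> A c / \<delta> c" using W[OF c(1)] by (metis mult_le_cancel_left_pos)
    then show "t = c \<and> k = A c / \<delta> c" using t tc by simp
  qed
qed

text \<open>The reduced cost is a multiple of
  \<open>t^2 / (\<epsilon>^2 - \<kappa> 0 / t^2)\<close>, minimal where \<open>t^2\<close> is twice
  the threshold \<open>\<kappa> 0 / \<epsilon>^2\<close>; strictness comes down to
  \<open>(s^2 - c^2)^2 > 0\<close>.\<close>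

lemma optimal_choice_critical:
  fixes \<kappa> :: "nat \<Rightarrow> real"
  assumes pos: "\<And>i. i \<le> 3 \<Longrightarrow> 0 < \<kappa> i" and e: "0 < \<epsilon>"
  shows "optimal_choice 0 \<kappa> \<epsilon> t k \<longleftrightarrow>
    t = sqrt (2 * \<kappa> 0) * inverse \<epsilon> \<and> k = \<kappa> 1 * inverse (\<kappa> 0) * t ^ 3"
proof -
  define c where "c = sqrt (2 * \<kappa> 0) * inverse \<epsilon>"
  have k0: "0 < \<kappa> 0" and k1: "0 < \<kappa> 1" using pos by auto
  have c0: "0 < c" using k0 e by (simp add: c_def)
  have c2: "c\<^sup>2 = 2 * \<kappa> 0 / \<epsilon>\<^sup>2" using k0 e by (simp add: c_def field_simps power_mult_distrib)
  have dc: "\<epsilon>\<^sup>2 - \<kappa> 0 / c\<^sup>2 = \<epsilon>\<^sup>2 / 2" unfolding c2 using k0 e by (simp add: field_simps)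
  have ke: "\<kappa> 0 = \<epsilon>\<^sup>2 * c\<^sup>2 / 2" unfolding c2 using e by simp
  have min: "c * (\<kappa> 1 * c) / (\<epsilon>\<^sup>2 - \<kappa> 0 / c\<^sup>2) < s * (\<kappa> 1 * s) / (\<epsilon>\<^sup>2 - \<kappa> 0 / s\<^sup>2)"
    if s: "0 < s" "0 < \<epsilon>\<^sup>2 - \<kappa> 0 / s\<^sup>2" "s \<noteq> c" for s
  proof -
    have "s\<^sup>2 \<noteq> c\<^sup>2" using s c0 by simp
    then have "0 < (s\<^sup>2 - c\<^sup>2)\<^sup>2" by simp
    then have "2 * c\<^sup>2 * s\<^sup>2 < s\<^sup>2 * s\<^sup>2 + c\<^sup>2 * c\<^sup>2" by (simp add: power2_eq_square algebra_simps)
    then have "2 * c\<^sup>2 * (s\<^sup>2 - c\<^sup>2 / 2) < s\<^sup>2 * s\<^sup>2" by (simp add: algebra_simps)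
    then have "2 * c\<^sup>2 * (s\<^sup>2 - c\<^sup>2 / 2) / s\<^sup>2 < s\<^sup>2" using s by (simp add: divide_less_eq)
    moreover have "2 * c\<^sup>2 * (s\<^sup>2 - c\<^sup>2 / 2) / s\<^sup>2 = 2 * c\<^sup>2 * (1 - c\<^sup>2 / (2 * s\<^sup>2))"
      using s by (simp add: field_simps)
    ultimately have m: "2 * c\<^sup>2 * (1 - c\<^sup>2 / (2 * s\<^sup>2)) < s\<^sup>2" by simp
    have d: "\<epsilon>\<^sup>2 - \<kappa> 0 / s\<^sup>2 = \<epsilon>\<^sup>2 * (1 - c\<^sup>2 / (2 * s\<^sup>2))" unfolding ke using s by (simp add: field_simps)
    have d0: "0 < 1 - c\<^sup>2 / (2 * s\<^sup>2)" using s(2) e unfolding d by (simp add: zero_less_mult_iff)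
    have "2 * c\<^sup>2 < s\<^sup>2 / (1 - c\<^sup>2 / (2 * s\<^sup>2))" using m d0 by (simp add: pos_less_divide_eq)
    then have "\<kappa> 1 / \<epsilon>\<^sup>2 * (2 * c\<^sup>2) < \<kappa> 1 / \<epsilon>\<^sup>2 * (s\<^sup>2 / (1 - c\<^sup>2 / (2 * s\<^sup>2)))"
      using k1 e by (intro mult_strict_left_mono) auto
    moreover have "\<kappa> 1 / \<epsilon>\<^sup>2 * (2 * c\<^sup>2) = c * (\<kappa> 1 * c) / (\<epsilon>\<^sup>2 - \<kappa> 0 / c\<^sup>2)"
      unfolding dc by (simp add: power2_eq_square)
    moreover have "\<kappa> 1 / \<epsilon>\<^sup>2 * (s\<^sup>2 / (1 - c\<^sup>2 / (2 * s\<^sup>2))) = s * (\<kappa> 1 * s) / (\<epsilon>\<^sup>2 - \<kappa> 0 / s\<^sup>2)"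
      unfolding d by (simp add: power2_eq_square)
    ultimately show ?thesis by simp
  qed
  have "optimal_choice 0 \<kappa> \<epsilon> t k \<longleftrightarrow> t = c \<and> k = variance_factor 0 \<kappa> c / (\<epsilon>\<^sup>2 - \<kappa> 0 / c\<^sup>2)"
    using pos c0 e min by (intro optimal_choice_iff) (auto simp: dc variance_factor_def cost_weight_def)
  also have "variance_factor 0 \<kappa> c / (\<epsilon>\<^sup>2 - \<kappa> 0 / c\<^sup>2) = \<kappa> 1 * inverse (\<kappa> 0) * c ^ 3"
    unfolding variance_factor_def dc using e c0 by (simp add: ke field_simps power2_eq_square power3_eq_cube)
  finally show ?thesis unfolding c_def by auto
qed

text \<open>The equation states that the logarithmic derivative of
  \<open>exp (\<alpha> * t) / (\<epsilon>^2 - \<kappa>0 / t^2)\<close> vanishes. Its left side is 0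
  at the lower end of the interval.\<close>

lemma optimal_time_exists:
  fixes \<alpha> \<kappa>0 \<epsilon> :: real
  assumes "0 < \<alpha>" "0 < \<kappa>0" "0 < \<epsilon>"
  shows "\<exists>t. sqrt \<kappa>0 / \<epsilon> \<le> t \<and> t \<le> sqrt \<kappa>0 / \<epsilon> + 1 / \<alpha> \<and> \<alpha> * t * (\<epsilon>\<^sup>2 * t\<^sup>2 - \<kappa>0) = 2 * \<kappa>0"
proof (rule IVT')
  let ?a = "sqrt \<kappa>0 / \<epsilon>"
  let ?b = "?a + 1 / \<alpha>"
  have a: "\<epsilon>\<^sup>2 * ?a\<^sup>2 = \<kappa>0" using assms by (simp add: field_simps)
  show "\<alpha> * ?a * (\<epsilon>\<^sup>2 * ?a\<^sup>2 - \<kappa>0) \<le> 2 * \<kappa>0" unfolding a using assms by simp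
  have "\<epsilon>\<^sup>2 * ?b\<^sup>2 - \<kappa>0 = (\<epsilon> / \<alpha>) * (2 * sqrt \<kappa>0 + \<epsilon> / \<alpha>)"
    using assms by (simp add: power2_eq_square field_simps)
  \<comment> \<open>Keeping only \<open>sqrt \<kappa>0 / \<epsilon>\<close> from \<open>?b\<close>
    and \<open>2 * sqrt \<kappa>0\<close> from the last bracket already gives exactly
    \<open>2 * \<kappa>0\<close>, which is why a margin of \<open>1 / \<alpha>\<close> is
    enough.\<close>
  moreover have "2 * \<kappa>0 \<le> \<alpha> * ?b * ((\<epsilon> / \<alpha>) * (2 * sqrt \<kappa>0 + \<epsilon> / \<alpha>))"
  proof -
    have "\<alpha> * ?a * ((\<epsilon> / \<alpha>) * (2 * sqrt \<kappa>0)) = 2 * \<kappa>0" using assms by simp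
    moreover have "\<alpha> * ?a * ((\<epsilon> / \<alpha>) * (2 * sqrt \<kappa>0)) \<le> \<alpha> * ?b * ((\<epsilon> / \<alpha>) * (2 * sqrt \<kappa>0 + \<epsilon> / \<alpha>))"
      using assms by (intro mult_mono) auto
    ultimately show ?thesis by simp
  qed
  ultimately show "2 * \<kappa>0 \<le> \<alpha> * ?b * (\<epsilon>\<^sup>2 * ?b\<^sup>2 - \<kappa>0)" by simp
  show "?a \<le> ?b" using assms by simp
  show "continuous_on {?a..?b} (\<lambda>t. \<alpha> * t * (\<epsilon>\<^sup>2 * t\<^sup>2 - \<kappa>0))" by (intro continuous_intros)
qed

lemma critical_denominator:
  fixes \<alpha> \<kappa>0 \<epsilon> c :: real
  assumes "0 < \<alpha>" "0 < \<kappa>0" and c: "0 < c" "\<alpha> * c * (\<epsilon>\<^sup>2 * c\<^sup>2 - \<kappa>0) = 2 * \<kappa>0"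
  shows "\<epsilon>\<^sup>2 - \<kappa>0 / c\<^sup>2 = 2 * \<kappa>0 / (\<alpha> * c ^ 3)"
proof -
  have "\<epsilon>\<^sup>2 * c\<^sup>2 - \<kappa>0 = 2 * \<kappa>0 / (\<alpha> * c)" using assms by (simp add: eq_divide_eq ac_simps)
  moreover have "\<epsilon>\<^sup>2 - \<kappa>0 / c\<^sup>2 = (\<epsilon>\<^sup>2 * c\<^sup>2 - \<kappa>0) / c\<^sup>2" using c by (simp add: field_simps)
  ultimately show ?thesis by (simp add: power2_eq_square power3_eq_cube)
qed

text \<open>The denominator \<open>\<epsilon>\<^sup>2 - \<kappa>0 / s\<^sup>2\<close> is concave in \<open>s\<close> and lies below its tangent at the critical
  point \<open>c\<close>, which is a multiple of \<open>1 + \<alpha> (s - c)\<close>.\<close>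
lemma exponential_cost_strict_min:
  fixes \<alpha> \<kappa>0 \<epsilon> c s :: real
  assumes pos: "0 < \<alpha>" "0 < \<kappa>0" "0 < \<epsilon>" and c: "0 < c" "\<alpha> * c * (\<epsilon>\<^sup>2 * c\<^sup>2 - \<kappa>0) = 2 * \<kappa>0"
    and s: "0 < s" "0 < \<epsilon>\<^sup>2 - \<kappa>0 / s\<^sup>2" "s \<noteq> c"
  shows "exp (\<alpha> * c) / (\<epsilon>\<^sup>2 - \<kappa>0 / c\<^sup>2) < exp (\<alpha> * s) / (\<epsilon>\<^sup>2 - \<kappa>0 / s\<^sup>2)"
proof -
  define \<delta> where "\<delta> t = \<epsilon>\<^sup>2 - \<kappa>0 / t\<^sup>2" for t
  have dc: "\<delta> c = 2 * \<kappa>0 / (\<alpha> * c ^ 3)"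
    unfolding \<delta>_def by (rule critical_denominator[OF pos(1,2) c])
  have dc0: "0 < \<delta> c" unfolding dc using pos c by simp
  have tangent: "\<delta> s \<le> \<delta> c * (1 + \<alpha> * (s - c))"
  proof -
    \<comment> \<open>Expanded, this says that the convex function \<open>1 / s^2\<close> lies above
      its tangent at \<open>c\<close>, which is \<open>(3 * c - 2 * s) / c^3\<close>.\<close>
    have "0 \<le> (s - c)\<^sup>2 * (2 * s + c)" using s c by simp
    then have "3 * c * s\<^sup>2 - 2 * s ^ 3 \<le> c ^ 3" by (simp add: power2_eq_square power3_eq_cube algebra_simps)
    then have "(3 * c - 2 * s) * s\<^sup>2 \<le> c ^ 3" by (simp add: power2_eq_square power3_eq_cube algebra_simps)
    then have "(3 * c - 2 * s) / c ^ 3 \<le> 1 / s\<^sup>2" using s c by (simp add: field_simps)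
    then have "\<kappa>0 * ((3 * c - 2 * s) / c ^ 3) \<le> \<kappa>0 * (1 / s\<^sup>2)" using pos by (intro mult_left_mono) auto
    moreover have "\<delta> c * (\<alpha> * (s - c)) = \<kappa>0 / c\<^sup>2 - \<kappa>0 * ((3 * c - 2 * s) / c ^ 3)"
      unfolding dc using pos c by (simp add: field_simps power2_eq_square power3_eq_cube)
    moreover have "\<delta> c * (1 + \<alpha> * (s - c)) = \<delta> c + \<delta> c * (\<alpha> * (s - c))"
      by (simp add: distrib_left)
    ultimately show ?thesis unfolding \<delta>_def by simp
  qed
  \<comment> \<open>Strictness of the minimum stems from here, as the argument is nonzero for
    \<open>s \<noteq> c\<close>.\<close>
  have "1 + \<alpha> * (s - c) < exp (\<alpha> * (s - c))"
    using exp_minus_greater[of "- (\<alpha> * (s - c))"] s pos by simp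
  then have "\<delta> c * (1 + \<alpha> * (s - c)) < \<delta> c * exp (\<alpha> * (s - c))"
    using dc0 by (intro mult_strict_left_mono)
  with tangent have "\<delta> s < \<delta> c * exp (\<alpha> * (s - c))" by linarith
  then have "exp (\<alpha> * c) * \<delta> s < exp (\<alpha> * c) * (\<delta> c * exp (\<alpha> * (s - c)))" by simp
  also have "\<dots> = exp (\<alpha> * s) * \<delta> c" by (simp add: algebra_simps flip: exp_add)
  finally show ?thesis using dc0 s(2) by (simp add: \<delta>_def field_simps)
qed

text \<open>The exponential sits in the cost weight when \<open>lam > 0\<close> and in the variance
  factor when \<open>lam < 0\<close>; their product has the same form in both cases.\<close>

lemma optimal_choice_noncritical:
  fixes \<kappa> :: "nat \<Rightarrow> real"
  assumes pos: "\<And>i. i \<le> 3 \<Longrightarrow> 0 < \<kappa> i" and e: "0 < \<epsilon>" and lam: "lam \<noteq> 0"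
    and c: "0 < c" "\<bar>lam\<bar> * c * (\<epsilon>\<^sup>2 * c\<^sup>2 - \<kappa> 0) = 2 * \<kappa> 0"
  shows "optimal_choice lam \<kappa> \<epsilon> t k \<longleftrightarrow>
    t = c \<and> k = variance_factor lam \<kappa> c * \<bar>lam\<bar> * c ^ 3 / (2 * \<kappa> 0)"
proof -
  have k0: "0 < \<kappa> 0" and k2: "0 < \<kappa> 2" and k3: "0 < \<kappa> 3" using pos by auto
  define K where "K = (if lam > 0 then \<kappa> 2 else \<kappa> 3)"
  have K: "0 < K" using k2 k3 by (simp add: K_def)
  have J: "cost_weight lam s * variance_factor lam \<kappa> s = K * exp (\<bar>lam\<bar> * s)" for s
    using lam by (auto simp: cost_weight_def variance_factor_def K_def)
  have dc: "\<epsilon>\<^sup>2 - \<kappa> 0 / c\<^sup>2 = 2 * \<kappa> 0 / (\<bar>lam\<bar> * c ^ 3)"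
    using critical_denominator[OF _ k0 c] lam by simp
  have "optimal_choice lam \<kappa> \<epsilon> t k \<longleftrightarrow> t = c \<and> k = variance_factor lam \<kappa> c / (\<epsilon>\<^sup>2 - \<kappa> 0 / c\<^sup>2)"
  proof (rule optimal_choice_iff)
    fix s assume s: "0 < s" "0 < \<epsilon>\<^sup>2 - \<kappa> 0 / s\<^sup>2" "s \<noteq> c"
    have "K * (exp (\<bar>lam\<bar> * c) / (\<epsilon>\<^sup>2 - \<kappa> 0 / c\<^sup>2)) < K * (exp (\<bar>lam\<bar> * s) / (\<epsilon>\<^sup>2 - \<kappa> 0 / s\<^sup>2))"
      using exponential_cost_strict_min[OF _ k0 e c s] lam K by (intro mult_strict_left_mono) auto
    then show "cost_weight lam c * variance_factor lam \<kappa> c / (\<epsilon>\<^sup>2 - \<kappa> 0 / c\<^sup>2)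
        < cost_weight lam s * variance_factor lam \<kappa> s / (\<epsilon>\<^sup>2 - \<kappa> 0 / s\<^sup>2)"
      by (simp add: J)
  qed (use pos c k0 lam dc in auto)
  also have "variance_factor lam \<kappa> c / (\<epsilon>\<^sup>2 - \<kappa> 0 / c\<^sup>2) = variance_factor lam \<kappa> c * \<bar>lam\<bar> * c ^ 3 / (2 * \<kappa> 0)"
    unfolding dc by simp
  finally show ?thesis .
qed

section \<open>Complexity of the estimator\<close>

text \<open>The inequality \<open>y \<le> exp y\<close> at \<open>y = \<delta> * t / 3\<close>
  spends one third of the extra exponent on each factor \<open>t\<close>.\<close>

lemma cube_exp_bound:
  fixes \<alpha> \<delta> t :: real
  assumes "0 < \<delta>" "0 \<le> t"
  shows "t ^ 3 * exp (\<alpha> * t) \<le> (3 / \<delta>) ^ 3 * exp ((\<alpha> + \<delta>) * t)"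
proof -
  have "\<delta> * t / 3 \<le> exp (\<delta> * t / 3)" using exp_ge_add_one_self[of "\<delta> * t / 3"] by linarith
  then have "(3 / \<delta>) * (\<delta> * t / 3) \<le> (3 / \<delta>) * exp (\<delta> * t / 3)"
    using assms by (intro mult_left_mono) auto
  then have "t \<le> (3 / \<delta>) * exp (\<delta> * t / 3)" using assms by simp
  then have "t ^ 3 \<le> ((3 / \<delta>) * exp (\<delta> * t / 3)) ^ 3" using assms by (intro power_mono)
  also have "\<dots> = (3 / \<delta>) ^ 3 * exp (\<delta> * t)" by (simp only: power_mult_distrib exp_of_nat_mult[symmetric]) simp
  finally have "t ^ 3 * exp (\<alpha> * t) \<le> (3 / \<delta>) ^ 3 * exp (\<delta> * t) * exp (\<alpha> * t)"
    by (intro mult_right_mono) auto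
  then show ?thesis by (simp add: algebra_simps exp_add)
qed

theorem theorem5p3:
  fixes S :: neutron_data and Pr :: "config \<Rightarrow> history measure"
    and lam :: real and phi phit g :: "config \<Rightarrow> real" and x :: config
    and \<kappa> :: "nat \<Rightarrow> real"
  assumes "neutron_setting S"
    and "\<And>y. y \<in> phase S \<Longrightarrow> nbp_law S y (Pr y)"
    and "eigen_triple S Pr lam phi phit"
    and "g \<in> Linf_plus S" and "inner_DV S g phit > 0"
    and "x \<in> phase S"
    and "error_constants Pr lam g x \<kappa>"
  shows "\<exists>(k :: real \<Rightarrow> nat) (t :: real \<Rightarrow> real) (kopt :: real \<Rightarrow> real) (topt :: real \<Rightarrow> real).
    (\<forall>\<epsilon>>0. 0 < k \<epsilon> \<and> 0 < t \<epsilon> \<and> sq_error Pr lam g x (k \<epsilon>) (t \<epsilon>) \<le> ennreal (\<epsilon>\<^sup>2)) \<and>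
    (\<forall>\<epsilon>>0. \<forall>t' k'. optimal_choice lam \<kappa> \<epsilon> t' k' \<longleftrightarrow> t' = topt \<epsilon> \<and> k' = kopt \<epsilon>) \<and>
    (\<forall>\<^sub>F \<epsilon> in at_right 0. t \<epsilon> = topt \<epsilon> \<and> k \<epsilon> = nat \<lceil>kopt \<epsilon>\<rceil>) \<and>
    (lam = 0 \<longrightarrow>
      (\<exists>C. \<forall>\<^sub>F \<epsilon> in at_right 0.
         mean_Cost S Pr x (k \<epsilon>) (t \<epsilon>) \<le> ennreal (C * \<epsilon> powr (-4))) \<and>
      (\<forall>\<epsilon>>0. topt \<epsilon> = sqrt (2 * \<kappa> 0) * inverse \<epsilon> \<and>
         kopt \<epsilon> = \<kappa> 1 * inverse (\<kappa> 0) * topt \<epsilon> ^ 3)) \<and>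
    (lam > 0 \<longrightarrow>
      (\<forall>\<kappa>'>\<kappa> 0. \<exists>C. \<forall>\<^sub>F \<epsilon> in at_right 0.
         mean_Cost S Pr x (k \<epsilon>) (t \<epsilon>) \<le> ennreal (C * exp (lam * sqrt \<kappa>' * inverse \<epsilon>))) \<and>
      topt \<sim>[at_right 0] (\<lambda>\<epsilon>. sqrt (\<kappa> 0) * inverse \<epsilon>) \<and>
      kopt \<sim>[at_right 0] (\<lambda>\<epsilon>. lam * sqrt (\<kappa> 0) * \<kappa> 2 * inverse (\<epsilon> ^ 3) / 2)) \<and>
    (lam < 0 \<longrightarrow>
      (\<forall>\<kappa>'>\<kappa> 0. \<exists>C. \<forall>\<^sub>F \<epsilon> in at_right 0.
         mean_Cost S Pr x (k \<epsilon>) (t \<epsilon>) \<le> ennreal (C * exp (\<bar>lam\<bar> * sqrt \<kappa>' * inverse \<epsilon>))) \<and>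
      topt \<sim>[at_right 0] (\<lambda>\<epsilon>. sqrt (\<kappa> 0) * inverse \<epsilon>) \<and>
      kopt \<sim>[at_right 0]
        (\<lambda>\<epsilon>. \<bar>lam\<bar> * sqrt (\<kappa> 0) * \<kappa> 3 * inverse (\<epsilon> ^ 3) * exp (\<bar>lam\<bar> * topt \<epsilon>) / 2))"
proof -
  define \<alpha> where "\<alpha> = \<bar>lam\<bar>"
  define K where "K = (if lam > 0 then \<kappa> 2 else \<kappa> 3)"
  have pos: "\<And>i. i \<le> 3 \<Longrightarrow> 0 < \<kappa> i" using assms(7) by (auto simp: error_constants_def)
  have k0: "0 < \<kappa> 0" and k1: "0 < \<kappa> 1" and K: "0 < K" using pos by (auto simp: K_def)
  obtain T N where err: "\<And>t k. T \<le> t \<Longrightarrow> N \<le> k \<Longrightarrow> sq_error Pr lam g x k t \<le> ennreal (error_bound lam \<kappa> t (real k))"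
    using assms(7) unfolding error_constants_def by blast

  \<comment> \<open>The optimal pair\<close>
  define topt where "topt \<epsilon> = (if lam = 0 then sqrt (2 * \<kappa> 0) * inverse \<epsilon> else
    SOME t. sqrt (\<kappa> 0) / \<epsilon> \<le> t \<and> t \<le> sqrt (\<kappa> 0) / \<epsilon> + 1 / \<alpha> \<and> \<alpha> * t * (\<epsilon>\<^sup>2 * t\<^sup>2 - \<kappa> 0) = 2 * \<kappa> 0)" for \<epsilon>
  define kopt where "kopt \<epsilon> = (if lam = 0 then \<kappa> 1 * inverse (\<kappa> 0) * topt \<epsilon> ^ 3
    else variance_factor lam \<kappa> (topt \<epsilon>) * \<alpha> * topt \<epsilon> ^ 3 / (2 * \<kappa> 0))" for \<epsilon>
  have topt_nc: "sqrt (\<kappa> 0) / \<epsilon> \<le> topt \<epsilon> \<and> topt \<epsilon> \<le> sqrt (\<kappa> 0) / \<epsilon> + 1 / \<alpha> \<and> \<alpha> * topt \<epsilon> * (\<epsilon>\<^sup>2 * (topt \<epsilon>)\<^sup>2 - \<kappa> 0) = 2 * \<kappa> 0"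
    if "lam \<noteq> 0" "0 < \<epsilon>" for \<epsilon>
  proof -
    have "0 < \<alpha>" using that by (simp add: \<alpha>_def)
    from someI_ex[OF optimal_time_exists[OF this k0 that(2)]] show ?thesis using that(1) by (simp add: topt_def)
  qed
  have topt_lower: "sqrt (\<kappa> 0) / \<epsilon> \<le> topt \<epsilon>" if "0 < \<epsilon>" for \<epsilon>
  proof (cases "lam = 0")
    case True
    have "sqrt (\<kappa> 0) \<le> sqrt (2 * \<kappa> 0)" using k0 by simp
    then show ?thesis using True that by (simp add: topt_def divide_inverse mult_right_mono)
  qed (use topt_nc that in auto)
  have topt_pos: "0 < topt \<epsilon>" if "0 < \<epsilon>" for \<epsilon>
    by (rule less_le_trans[OF _ topt_lower[OF that]]) (use k0 that in simp)
  \<comment> \<open>The minimum is strict at whichever root \<open>topt\<close> selects, so the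
    arbitrary choice of a root still yields the unique minimiser.\<close>
  have opt: "optimal_choice lam \<kappa> \<epsilon> t' k' \<longleftrightarrow> t' = topt \<epsilon> \<and> k' = kopt \<epsilon>" if e: "0 < \<epsilon>" for \<epsilon> t' k'
  proof (cases "lam = 0")
    case True
    then show ?thesis using optimal_choice_critical[where \<kappa> = \<kappa>, OF _ e, of t' k'] pos by (auto simp: topt_def kopt_def)
  next
    case False
    then show ?thesis
      using optimal_choice_noncritical[where \<kappa> = \<kappa>, OF _ e False topt_pos[OF e], of t' k'] pos topt_nc[OF False e]
      by (simp add: kopt_def \<alpha>_def)
  qed
  have feasible: "0 < kopt \<epsilon>" "error_bound lam \<kappa> (topt \<epsilon>) (kopt \<epsilon>) \<le> \<epsilon>\<^sup>2" if "0 < \<epsilon>" for \<epsilon>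
    using opt[OF that, of "topt \<epsilon>" "kopt \<epsilon>"] by (auto simp: optimal_choice_def is_arg_min_def)

  \<comment> \<open>Divergence of the optimal time and sample size\<close>
  have topt_lim: "filterlim topt at_top (at_right 0)"
  proof (rule filterlim_at_top_mono)
    have "filterlim (\<lambda>\<epsilon>. sqrt (\<kappa> 0) * inverse \<epsilon>) at_top (at_right 0)"
      using k0 by (intro filterlim_tendsto_pos_mult_at_top[OF tendsto_const] filterlim_inverse_at_top_right) auto
    then show "filterlim (\<lambda>\<epsilon>. sqrt (\<kappa> 0) / \<epsilon>) at_top (at_right 0)" by (simp add: divide_inverse)
    show "\<forall>\<^sub>F \<epsilon> in at_right 0. sqrt (\<kappa> 0) / \<epsilon> \<le> topt \<epsilon>"
      using topt_lower by (auto simp: eventually_at_right_field intro: exI[of _ 1])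
  qed
  \<comment> \<open>Constant for which \<open>kopt\<close> is at least \<open>c * topt^3\<close> in
    all three cases; for \<open>lam < 0\<close> the exponential in the variance factor is at least
    1. It reappears in the cost estimates.\<close>
  define c where "c = (if lam = 0 then \<kappa> 1 * inverse (\<kappa> 0) else K * \<alpha> / (2 * \<kappa> 0))"
  have c: "0 < c" using k0 k1 K by (simp add: c_def \<alpha>_def)
  have kopt_lower: "c * topt \<epsilon> ^ 3 \<le> kopt \<epsilon>" if e: "0 < \<epsilon>" for \<epsilon>
  proof (cases "lam = 0")
    case False
    have "K \<le> variance_factor lam \<kappa> (topt \<epsilon>)"
      using False topt_pos[OF e] K by (auto simp: K_def variance_factor_def mult_nonpos_nonneg)
    then have "K * (\<alpha> * topt \<epsilon> ^ 3 / (2 * \<kappa> 0)) \<le> variance_factor lam \<kappa> (topt \<epsilon>) * (\<alpha> * topt \<epsilon> ^ 3 / (2 * \<kappa> 0))"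
      using k0 topt_pos[OF e] by (intro mult_right_mono) (auto simp: \<alpha>_def)
    then show ?thesis using False by (simp add: c_def kopt_def mult.assoc)
  qed (simp add: c_def kopt_def)
  have ev_pos: "\<forall>\<^sub>F \<epsilon> in at_right 0. 0 < (\<epsilon>::real)"
    by (simp add: eventually_at_right_less)
  have kopt_lim: "filterlim kopt at_top (at_right 0)"
  proof (rule filterlim_at_top_mono)
    show "filterlim (\<lambda>\<epsilon>. c * topt \<epsilon> ^ 3) at_top (at_right 0)"
      using c by (intro filterlim_tendsto_pos_mult_at_top[OF tendsto_const] filterlim_pow_at_top topt_lim) auto
    show "\<forall>\<^sub>F \<epsilon> in at_right 0. c * topt \<epsilon> ^ 3 \<le> kopt \<epsilon>"
      using ev_pos by eventually_elim (rule kopt_lower)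
  qed

  \<comment> \<open>An admissible choice for every tolerance\<close>
  have "\<forall>\<^sub>F \<epsilon> in at_right 0. T \<le> topt \<epsilon> \<and> real N \<le> kopt \<epsilon>"
    using topt_lim kopt_lim by (auto simp: filterlim_at_top eventually_conj_iff)
  then obtain b where b: "0 < b" and b': "\<And>\<epsilon>. 0 < \<epsilon> \<Longrightarrow> \<epsilon> < b \<Longrightarrow> T \<le> topt \<epsilon> \<and> real N \<le> kopt \<epsilon>"
    unfolding eventually_at_right_field by auto
  \<comment> \<open>The error bound is known only for large \<open>t\<close> and \<open>k\<close>.
    For larger tolerances the choice made at \<open>\<epsilon>1\<close> is kept, which meets a
    stricter requirement.\<close>
  define \<epsilon>1 where "\<epsilon>1 = b / 2"
  define t where "t \<epsilon> = topt (min \<epsilon> \<epsilon>1)" for \<epsilon>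
  define k where "k \<epsilon> = nat \<lceil>kopt (min \<epsilon> \<epsilon>1)\<rceil>" for \<epsilon>
  have error: "0 < k \<epsilon> \<and> 0 < t \<epsilon> \<and> sq_error Pr lam g x (k \<epsilon>) (t \<epsilon>) \<le> ennreal (\<epsilon>\<^sup>2)" if "0 < \<epsilon>" for \<epsilon>
  proof -
    define e where "e = min \<epsilon> \<epsilon>1"
    have e: "0 < e" "e < b" "e \<le> \<epsilon>" using that b by (auto simp: e_def \<epsilon>1_def min_def)
    have k_ge: "kopt e \<le> real (k \<epsilon>)" unfolding k_def e_def by (rule real_nat_ceiling_ge)
    have TN: "T \<le> topt e" "real N \<le> kopt e" using b' e by auto
    then have "real N \<le> real (k \<epsilon>)" using k_ge by linarith
    then have "N \<le> k \<epsilon>" by simp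
    then have "sq_error Pr lam g x (k \<epsilon>) (t \<epsilon>) \<le> ennreal (error_bound lam \<kappa> (topt e) (real (k \<epsilon>)))"
      unfolding t_def e_def[symmetric] by (rule err[OF TN(1)])
    \<comment> \<open>Rounding up enlarges \<open>k\<close> and so lowers the only term that depends
      on it.\<close>
    also have "error_bound lam \<kappa> (topt e) (real (k \<epsilon>)) \<le> error_bound lam \<kappa> (topt e) (kopt e)"
    proof -
      have "0 \<le> variance_factor lam \<kappa> (topt e)"
        using topt_pos[OF e(1)] pos[of 1] pos[of 2] pos[of 3] by (auto simp: variance_factor_def)
      then show ?thesis unfolding error_bound_eq
        using k_ge feasible(1)[OF e(1)] by (intro add_right_mono divide_left_mono) auto
    qed
    also have "\<dots> \<le> e\<^sup>2" by (rule feasible(2)[OF e(1)])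
    also have "\<dots> \<le> \<epsilon>\<^sup>2" using e by (intro power_mono) auto
    finally have "sq_error Pr lam g x (k \<epsilon>) (t \<epsilon>) \<le> ennreal (\<epsilon>\<^sup>2)" by (simp add: ennreal_leI)
    moreover have "0 < real (k \<epsilon>)" using k_ge feasible(1)[OF e(1)] by linarith
    ultimately show ?thesis using topt_pos[OF e(1)] by (simp add: t_def e_def)
  qed
  have ev_eq: "\<forall>\<^sub>F \<epsilon> in at_right 0. t \<epsilon> = topt \<epsilon> \<and> k \<epsilon> = nat \<lceil>kopt \<epsilon>\<rceil>"
    unfolding eventually_at_right_field using b
    by (intro exI[of _ \<epsilon>1]) (auto simp: \<epsilon>1_def t_def k_def min_def)

  \<comment> \<open>Expected cost of the choice\<close>
  interpret neutron_process S "Pr x" x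
    using assms(1,2,6) by unfold_locales auto
  obtain C where C: "0 < C" and cost: "\<And>k t. 0 \<le> t \<Longrightarrow> mean_Cost S Pr x k t
      \<le> ennreal (C * real k * (if lam = 0 then 1 + t else if lam > 0 then exp (lam * t) else 1))"
    using mean_Cost_le[OF assms(3) refl] by blast
  define w where "w t = (if lam = 0 then 1 + t else if lam > 0 then exp (lam * t) else 1)" for t
  have ev_cost: "\<forall>\<^sub>F \<epsilon> in at_right 0. 0 < \<epsilon> \<and> 1 \<le> topt \<epsilon> \<and>
      mean_Cost S Pr x (k \<epsilon>) (t \<epsilon>) \<le> ennreal (2 * C * kopt \<epsilon> * w (topt \<epsilon>))"
  proof -
    have "\<forall>\<^sub>F \<epsilon> in at_right 0. 1 \<le> topt \<epsilon> \<and> 1 \<le> kopt \<epsilon>"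
      using topt_lim kopt_lim by (auto simp: filterlim_at_top eventually_conj_iff)
    with ev_eq ev_pos show ?thesis
    proof eventually_elim
      case (elim \<epsilon>)
      have w0: "0 \<le> w (topt \<epsilon>)" using elim by (auto simp: w_def)
      \<comment> \<open>Once \<open>kopt \<epsilon> \<ge> 1\<close>, rounding up at most doubles
        it.\<close>
      have "real (nat \<lceil>kopt \<epsilon>\<rceil>) \<le> kopt \<epsilon> + 1" using elim by linarith
      then have "real (nat \<lceil>kopt \<epsilon>\<rceil>) \<le> 2 * kopt \<epsilon>" using elim by linarith
      then have "C * real (nat \<lceil>kopt \<epsilon>\<rceil>) * w (topt \<epsilon>) \<le> C * (2 * kopt \<epsilon>) * w (topt \<epsilon>)"
        using C w0 by (intro mult_right_mono mult_left_mono) auto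
      moreover have "mean_Cost S Pr x (k \<epsilon>) (t \<epsilon>) \<le> ennreal (C * real (nat \<lceil>kopt \<epsilon>\<rceil>) * w (topt \<epsilon>))"
        using cost[of "topt \<epsilon>" "nat \<lceil>kopt \<epsilon>\<rceil>"] elim by (simp add: w_def)
      ultimately have "mean_Cost S Pr x (k \<epsilon>) (t \<epsilon>) \<le> ennreal (C * (2 * kopt \<epsilon>) * w (topt \<epsilon>))"
        by (meson ennreal_leI order_trans)
      then show ?case using elim by (simp add: mult.left_commute mult.assoc)
    qed
  qed

  have critical: "(\<exists>C. \<forall>\<^sub>F \<epsilon> in at_right 0. mean_Cost S Pr x (k \<epsilon>) (t \<epsilon>) \<le> ennreal (C * \<epsilon> powr (-4)))" if "lam = 0"
  proof
    show "\<forall>\<^sub>F \<epsilon> in at_right 0. mean_Cost S Pr x (k \<epsilon>) (t \<epsilon>)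
        \<le> ennreal (4 * C * c * (2 * \<kappa> 0)\<^sup>2 * \<epsilon> powr (-4))"
      using ev_cost
    proof eventually_elim
      case (elim \<epsilon>)
      define s where "s = topt \<epsilon>"
      have s: "1 \<le> s" using elim by (simp add: s_def)
      have "2 * C * kopt \<epsilon> * w s = 2 * C * c * s ^ 3 * (1 + s)" using that by (simp add: kopt_def c_def w_def s_def)
      \<comment> \<open>\<open>topt \<epsilon> \<ge> 1\<close> absorbs the constant in
        \<open>1 + s\<close>, which leaves a multiple of \<open>s^4\<close>.\<close>
      also have "\<dots> \<le> 2 * C * c * s ^ 3 * (2 * s)" using s C c by (intro mult_left_mono) auto
      also have "\<dots> = 4 * C * c * (s\<^sup>2)\<^sup>2" by (simp add: power2_eq_square power3_eq_cube)
      also have "s\<^sup>2 = 2 * \<kappa> 0 * inverse (\<epsilon>\<^sup>2)"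
        using that k0 by (simp add: s_def topt_def power_mult_distrib power_inverse)
      also have "(2 * \<kappa> 0 * inverse (\<epsilon>\<^sup>2))\<^sup>2 = (2 * \<kappa> 0)\<^sup>2 * \<epsilon> powr (-4)"
        using elim by (simp add: power_mult_distrib powr_minus power_inverse flip: power_mult)
      finally have "2 * C * kopt \<epsilon> * w s \<le> 4 * C * c * (2 * \<kappa> 0)\<^sup>2 * \<epsilon> powr (-4)"
        by (simp only: mult.assoc)
      then show ?case using elim unfolding s_def by (meson ennreal_leI order_trans)
    qed
  qed
  have noncritical: "\<exists>C. \<forall>\<^sub>F \<epsilon> in at_right 0. mean_Cost S Pr x (k \<epsilon>) (t \<epsilon>) \<le> ennreal (C * exp (\<alpha> * sqrt \<kappa>' * inverse \<epsilon>))"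
    if lam: "lam \<noteq> 0" and kap: "\<kappa> 0 < \<kappa>'" for \<kappa>'
  proof
    define \<beta> where "\<beta> = sqrt \<kappa>' / sqrt (\<kappa> 0)"
    \<comment> \<open>Chosen so that \<open>(\<alpha> + \<delta>) * sqrt (\<kappa> 0) = \<alpha> *
      sqrt \<kappa>'\<close>: the gap between \<open>\<kappa> 0\<close> and \<open>\<kappa>'\<close>
      pays for the factor \<open>topt^3\<close>.\<close>
    define \<delta> where "\<delta> = \<alpha> * (\<beta> - 1)"
    have \<alpha>: "0 < \<alpha>" using lam by (simp add: \<alpha>_def)
    have \<beta>: "1 < \<beta>" using k0 kap by (simp add: \<beta>_def)
    have \<delta>: "0 < \<delta>" using \<alpha> \<beta> by (simp add: \<delta>_def)
    have \<alpha>\<delta>: "\<alpha> + \<delta> = \<alpha> * \<beta>" by (simp add: \<delta>_def algebra_simps)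
    show "\<forall>\<^sub>F \<epsilon> in at_right 0. mean_Cost S Pr x (k \<epsilon>) (t \<epsilon>)
        \<le> ennreal (2 * C * c * ((3 / \<delta>) ^ 3 * exp \<beta>) * exp (\<alpha> * sqrt \<kappa>' * inverse \<epsilon>))"
      using ev_cost
    proof eventually_elim
      case (elim \<epsilon>)
      define s where "s = topt \<epsilon>"
      have s: "0 \<le> s" "s \<le> sqrt (\<kappa> 0) / \<epsilon> + 1 / \<alpha>" using elim topt_nc[OF lam, of \<epsilon>] by (auto simp: s_def)
      have "variance_factor lam \<kappa> s * w s = K * exp (\<alpha> * s)"
        using lam by (auto simp: variance_factor_def w_def K_def \<alpha>_def)
      moreover have "2 * C * kopt \<epsilon> * w s = 2 * C * (\<alpha> * s ^ 3 / (2 * \<kappa> 0)) * (variance_factor lam \<kappa> s * w s)"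
        using lam by (simp add: kopt_def s_def)
      ultimately have "2 * C * kopt \<epsilon> * w s = 2 * C * c * (s ^ 3 * exp (\<alpha> * s))"
        using lam by (simp add: c_def)
      also have "\<dots> \<le> 2 * C * c * ((3 / \<delta>) ^ 3 * exp ((\<alpha> + \<delta>) * s))"
        using C c by (intro mult_left_mono cube_exp_bound[OF \<delta> s(1)]) auto
      also have "\<dots> \<le> 2 * C * c * ((3 / \<delta>) ^ 3 * exp (\<beta> + \<alpha> * sqrt \<kappa>' * inverse \<epsilon>))"
      proof -
        \<comment> \<open>The excess \<open>1 / \<alpha>\<close> of the optimal time contributes
          only the constant factor \<open>exp \<beta>\<close>.\<close>
        have "(\<alpha> + \<delta>) * s \<le> (\<alpha> * \<beta>) * (sqrt (\<kappa> 0) / \<epsilon> + 1 / \<alpha>)"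
          unfolding \<alpha>\<delta> using s \<alpha> \<beta> by (intro mult_left_mono) auto
        also have "\<dots> = \<beta> + \<alpha> * (\<beta> * sqrt (\<kappa> 0)) * inverse \<epsilon>"
          using \<alpha> by (simp add: distrib_left divide_inverse)
        also have "\<beta> * sqrt (\<kappa> 0) = sqrt \<kappa>'" using k0 by (simp add: \<beta>_def)
        finally show ?thesis using C c \<delta> by (intro mult_left_mono) auto
      qed
      also have "\<dots> = 2 * C * c * ((3 / \<delta>) ^ 3 * exp \<beta>) * exp (\<alpha> * sqrt \<kappa>' * inverse \<epsilon>)"
        by (simp add: exp_add)
      finally show ?case using elim unfolding s_def by (meson ennreal_leI order_trans)
    qed
  qed

  \<comment> \<open>Leading-order asymptotics\<close>
  define \<rho> where "\<rho> \<epsilon> = topt \<epsilon> / (sqrt (\<kappa> 0) * inverse \<epsilon>)" for \<epsilon>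
  have ratio: "(\<rho> \<longlongrightarrow> 1) (at_right 0)" if lam: "lam \<noteq> 0"
  proof (rule tendsto_sandwich)
    have \<alpha>: "0 < \<alpha>" using lam by (simp add: \<alpha>_def)
    show "\<forall>\<^sub>F \<epsilon> in at_right 0. 1 \<le> \<rho> \<epsilon>"
      using ev_pos
    proof eventually_elim
      case (elim \<epsilon>)
      then show ?case using topt_lower[OF elim] k0 by (simp add: \<rho>_def field_simps)
    qed
    show "\<forall>\<^sub>F \<epsilon> in at_right 0. \<rho> \<epsilon> \<le> 1 + \<epsilon> / (\<alpha> * sqrt (\<kappa> 0))"
      using ev_pos
    proof eventually_elim
      case (elim \<epsilon>)
      have "topt \<epsilon> \<le> sqrt (\<kappa> 0) / \<epsilon> + 1 / \<alpha>" using topt_nc[OF lam elim] by simp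
      then have "\<rho> \<epsilon> \<le> (sqrt (\<kappa> 0) / \<epsilon> + 1 / \<alpha>) / (sqrt (\<kappa> 0) * inverse \<epsilon>)"
        unfolding \<rho>_def using k0 elim by (intro divide_right_mono) auto
      also have "\<dots> = 1 + \<epsilon> / (\<alpha> * sqrt (\<kappa> 0))"
        using k0 elim \<alpha> by (simp add: field_simps)
      finally show ?case .
    qed
    show "((\<lambda>\<epsilon>. 1 + \<epsilon> / (\<alpha> * sqrt (\<kappa> 0))) \<longlongrightarrow> 1) (at_right 0)"
      using \<alpha> k0 by (auto intro!: tendsto_eq_intros)
  qed simp
  have topt_equiv: "topt \<sim>[at_right 0] (\<lambda>\<epsilon>. sqrt (\<kappa> 0) * inverse \<epsilon>)" if "lam \<noteq> 0"
    using ratio[OF that] unfolding \<rho>_def by (rule asymp_equivI')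
  \<comment> \<open>The variance factor is kept at the exact time \<open>topt \<epsilon>\<close> and
    cancels, since asymptotic equivalence does not pass through the exponential; what remains is the
    cube of \<open>\<rho>\<close>.\<close>
  have kopt_equiv: "kopt \<sim>[at_right 0] h"
    if lam: "lam \<noteq> 0"
      and h: "\<And>\<epsilon>. 0 < \<epsilon> \<Longrightarrow> h \<epsilon> = \<alpha> * sqrt (\<kappa> 0) * variance_factor lam \<kappa> (topt \<epsilon>) * inverse (\<epsilon> ^ 3) / 2" for h
  proof (rule asymp_equivI')
    have "((\<lambda>\<epsilon>. \<rho> \<epsilon> ^ 3) \<longlongrightarrow> 1 ^ 3) (at_right 0)" by (intro tendsto_power ratio[OF lam])
    then have lim: "((\<lambda>\<epsilon>. \<rho> \<epsilon> ^ 3) \<longlongrightarrow> 1) (at_right 0)" by simp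
    show "((\<lambda>\<epsilon>. kopt \<epsilon> / h \<epsilon>) \<longlongrightarrow> 1) (at_right 0)"
    proof (rule Lim_transform_eventually[OF lim])
      show "\<forall>\<^sub>F \<epsilon> in at_right 0. \<rho> \<epsilon> ^ 3 = kopt \<epsilon> / h \<epsilon>"
        using ev_pos
      proof eventually_elim
        case (elim \<epsilon>)
        have v: "variance_factor lam \<kappa> (topt \<epsilon>) \<noteq> 0"
          using lam pos[of 2] pos[of 3] by (auto simp: variance_factor_def)
        have s3: "sqrt (\<kappa> 0) ^ 3 = \<kappa> 0 * sqrt (\<kappa> 0)" using k0 by (simp add: power3_eq_cube)
        have "kopt \<epsilon> / h \<epsilon> = topt \<epsilon> ^ 3 / (\<kappa> 0 * sqrt (\<kappa> 0) * inverse (\<epsilon> ^ 3))"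
          using lam v k0 elim by (simp add: kopt_def h[OF elim] \<alpha>_def)
        then show ?case unfolding \<rho>_def by (simp add: power_divide power_mult_distrib s3 power_inverse)
      qed
    qed
  qed

  have vf: "lam > 0 \<Longrightarrow> variance_factor lam \<kappa> s = \<kappa> 2" "lam < 0 \<Longrightarrow> variance_factor lam \<kappa> s = \<kappa> 3 * exp (\<bar>lam\<bar> * s)" for s
    by (auto simp: variance_factor_def)
  show ?thesis
  proof (rule exI[of _ k], rule exI[of _ t], rule exI[of _ kopt], rule exI[of _ topt], intro conjI impI)
    show "\<forall>\<epsilon>>0. 0 < k \<epsilon> \<and> 0 < t \<epsilon> \<and> sq_error Pr lam g x (k \<epsilon>) (t \<epsilon>) \<le> ennreal (\<epsilon>\<^sup>2)" using error by blast
    show "\<forall>\<epsilon>>0. \<forall>t' k'. optimal_choice lam \<kappa> \<epsilon> t' k' \<longleftrightarrow> t' = topt \<epsilon> \<and> k' = kopt \<epsilon>" using opt by blast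
    show "\<forall>\<^sub>F \<epsilon> in at_right 0. t \<epsilon> = topt \<epsilon> \<and> k \<epsilon> = nat \<lceil>kopt \<epsilon>\<rceil>" by (rule ev_eq)
  next
    assume lam: "lam = 0"
    show "\<exists>C. \<forall>\<^sub>F \<epsilon> in at_right 0. mean_Cost S Pr x (k \<epsilon>) (t \<epsilon>) \<le> ennreal (C * \<epsilon> powr (-4))"
      by (rule critical[OF lam])
    show "\<forall>\<epsilon>>0. topt \<epsilon> = sqrt (2 * \<kappa> 0) * inverse \<epsilon> \<and> kopt \<epsilon> = \<kappa> 1 * inverse (\<kappa> 0) * topt \<epsilon> ^ 3"
      using lam by (simp add: topt_def kopt_def)
  next
    assume lam: "lam > 0"
    show "\<forall>\<kappa>'>\<kappa> 0. \<exists>C. \<forall>\<^sub>F \<epsilon> in at_right 0. mean_Cost S Pr x (k \<epsilon>) (t \<epsilon>) \<le> ennreal (C * exp (lam * sqrt \<kappa>' * inverse \<epsilon>))"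
      using noncritical lam by (simp add: \<alpha>_def)
    show "topt \<sim>[at_right 0] (\<lambda>\<epsilon>. sqrt (\<kappa> 0) * inverse \<epsilon>)" using lam by (intro topt_equiv) simp
    show "kopt \<sim>[at_right 0] (\<lambda>\<epsilon>. lam * sqrt (\<kappa> 0) * \<kappa> 2 * inverse (\<epsilon> ^ 3) / 2)"
      using lam by (intro kopt_equiv) (simp_all add: vf \<alpha>_def)
  next
    assume lam: "lam < 0"
    show "\<forall>\<kappa>'>\<kappa> 0. \<exists>C. \<forall>\<^sub>F \<epsilon> in at_right 0. mean_Cost S Pr x (k \<epsilon>) (t \<epsilon>) \<le> ennreal (C * exp (\<bar>lam\<bar> * sqrt \<kappa>' * inverse \<epsilon>))"
      using noncritical lam by (simp add: \<alpha>_def)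
    show "topt \<sim>[at_right 0] (\<lambda>\<epsilon>. sqrt (\<kappa> 0) * inverse \<epsilon>)" using lam by (intro topt_equiv) simp
    show "kopt \<sim>[at_right 0] (\<lambda>\<epsilon>. \<bar>lam\<bar> * sqrt (\<kappa> 0) * \<kappa> 3 * inverse (\<epsilon> ^ 3) * exp (\<bar>lam\<bar> * topt \<epsilon>) / 2)"
      using lam by (intro kopt_equiv) (simp_all add: vf \<alpha>_def)
  qed
qed

end
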